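(* Let $\beta_1$ and $\beta_2$ be two braid words in the generators $H_1^{\pm1},\dots,H_{n-1}^{\pm1}$ of $B_n[D,K]$, where $(H_1,\dots,H_{n-1})$ is the standard frame. Let $\Gamma_1=\mathrm{ProcessWord}(\beta_1)=\langle\gamma_{1,1},\dots,\gamma_{1,n}\rangle$ and $\Gamma_2=\mathrm{ProcessWord}(\beta_2)=\langle\gamma_{2,1},\dots,\gamma_{2,n}\rangle$, where every $\gamma_{j,i}$ is a reduced word in the standard generators of $\pi_1(D\setminus K,u)$. Then $\beta_1=\beta_2$ (that is, the two words represent the same element of the braid group) if and only if $\gamma_{1,i}\equiv\gamma_{2,i}$ (equality letter by letter) for every $1\le i\le n$.
   Context: **Fundamental group.** $D$ is the closed unit disk with counterclockwise (positive) orientation, $u=(0,-1)$, and $K=\{k_1,\dots,k_n\}$ is a set of $n$ points of the interior of $D$ on the $x$-axis, numbered from left to right. For a simple path $q$ from $u$ to $k_i$ meeting $K$ only at $k_i$, $l(q)=q'\cup c\cup q'^{-1}\in\pi_1(D\setminus K,u)$, where $c$ is the positively oriented boundary of a small neighbourhood $V$ of $k_i$ and $q'=q\setminus(V\cap q)$; loops are concatenated from left to right. The standard g-base is $\langle\gamma_1,\dots,\gamma_n\rangle$ with $\gamma_i=l(T_i)$, $T_i$ the straight segment from $u$ to $k_i$. Its elements are the standard generators; $\pi_1(D\setminus K,u)$ is free on them. A word in the $\gamma_i^{\pm1}$ is reduced if it contains no two consecutive letters $\gamma_i^{e}\gamma_i^{-e}$, $e\in\{1,-1\}$. **Braid group.**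 Let $B$ be the group of diffeomorphisms $\beta$ of $D$ with $\beta(K)=K$ and $\beta|_{\partial D}=\mathrm{Id}|_{\partial D}$; compositions are taken from left to right. $B_n[D,K]$ is the quotient of $B$ identifying diffeomorphisms that induce the same automorphism of $\pi_1(D\setminus K,u)$. For a simple path $\sigma$ in $D\setminus\partial D$ joining two points $a,b\in K$ and avoiding the other points of $K$, the positive half-twist $H(\sigma)$ is the braid of the following diffeomorphism. Take a small regular neighbourhood $U$ of $\sigma$ and an orientation-preserving diffeomorphism $f:\mathbb{R}^2\to\mathbb{C}$ with $f(\sigma)=[-1,1]$, $f(U)=\{|z|<2\}$. Let $h(re^{i\varphi})=re^{i(\varphi+\alpha(r)\pi)}$ with $\alpha$ smooth monotone, $\alpha=1$ on $[0,3/2]$, $\alpha=0$ on $[2,\infty)$. The diffeomorphism is the conjugate of $h$ by $f$ (apply $f$, then $h$, then $f^{-1}$), restricted to $D$. The standard frame is $(H_1,\dots,H_{n-1})$, $H_i=H(\sigma_i)$ with $\sigma_i$ the straight segment from $k_i$ to $k_{i+1}$; it generates $B_n[D,K]$. A braid word is a finite sequence of letters $H_i^{e}$, $e\in\{1,-1\}$. **Braid moves.** The tuple $\langle\gamma_1',\dots,\gamma_n'\rangle$ is obtained from $\langle\delta_1,\dots,\delta_n\rangle$ by the braid move $H_i$ if $\gamma'_j=\delta_j$ for $j\ne i,i+1$, $\gamma'_i=\delta_{i+1}$ and $\gamma'_{i+1}=\delta_{i+1}\delta_i\delta_{i+1}^{-1}$. In that case $\langle\delta_1,\dots,\delta_n\rangle$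 is said to be obtained from $\langle\gamma_1',\dots,\gamma_n'\rangle$ by the braid move $H_i^{-1}$. **Algorithm ProcessWord($w$).** Start with $\Gamma=\langle\gamma_1,\dots,\gamma_n\rangle$, the standard g-base. For each letter $H_i^{e}$ of the braid word $w$, going from the end of $w$ to its beginning, apply to $\Gamma$ the braid move $H_i$ if $e=1$ and $H_i^{-1}$ if $e=-1$, and then freely reduce each entry of $\Gamma$ (delete all pairs $\gamma_j\gamma_j^{-1}$ and $\gamma_j^{-1}\gamma_j$ until the word is reduced). Return $\Gamma$, a tuple of $n$ reduced words in the standard generators. *)

theory Defs
  imports "HOL-Complex_Analysis.Complex_Analysis" "HOL-Algebra.Bij"
begin

section \<open>Smooth maps\<close>

text \<open>On an open set: \<open>f\<close> has continuous iterated directional derivatives up to order \<open>m\<close>.\<close>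

primrec Ck_on :: "nat \<Rightarrow> ('a::euclidean_space \<Rightarrow> 'b::euclidean_space) \<Rightarrow> 'a set \<Rightarrow> bool" where
  "Ck_on 0 f S \<longleftrightarrow> continuous_on S f"
| "Ck_on (Suc m) f S \<longleftrightarrow>
     (\<forall>x\<in>S. f differentiable (at x)) \<and>
     (\<forall>v. Ck_on m (\<lambda>x. frechet_derivative f (at x) v) S)"

text \<open>On an arbitrary set (such as the closed disk), smoothness means that there is a smooth
  extension to an open neighbourhood.\<close>

definition smooth_on :: "'a::euclidean_space set \<Rightarrow> ('a \<Rightarrow> 'b::euclidean_space) \<Rightarrow> bool" where
  "smooth_on S f \<longleftrightarrow>
     (\<exists>T g. open T \<and> S \<subseteq> T \<and> (\<forall>m. Ck_on m g T) \<and> (\<forall>x\<in>S. g x = f x))"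

text \<open>The plane is identified with the complex numbers; derivatives are those over the reals.\<close>

definition jacobian_det :: "(complex \<Rightarrow> complex) \<Rightarrow> complex \<Rightarrow> real" where
  "jacobian_det f z =
     (let f' = frechet_derivative f (at z)
      in Re (f' 1) * Im (f' \<i>) - Re (f' \<i>) * Im (f' 1))"

definition plane_diffeo :: "(complex \<Rightarrow> complex) \<Rightarrow> bool" where
  "plane_diffeo f \<longleftrightarrow> bij f \<and> smooth_on UNIV f \<and> smooth_on UNIV (inv_into UNIV f)"

definition orientation_preserving :: "(complex \<Rightarrow> complex) \<Rightarrow> bool" where
  "orientation_preserving f \<longleftrightarrow> (\<forall>z. jacobian_det f z > 0)"


section \<open>The fundamental group\<close>

definition homotopy_class :: "complex set \<Rightarrow> (real \<Rightarrow> complex) \<Rightarrow> (real \<Rightarrow> complex) set" where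
  "homotopy_class S p = {q. homotopic_paths S p q}"

definition loops_at :: "complex set \<Rightarrow> complex \<Rightarrow> (real \<Rightarrow> complex) set" where
  "loops_at S b = {p. path p \<and> path_image p \<subseteq> S \<and> pathstart p = b \<and> pathfinish p = b}"

definition fundamental_group :: "complex set \<Rightarrow> complex \<Rightarrow> (real \<Rightarrow> complex) set monoid" where
  "fundamental_group S b =
     \<lparr>carrier = homotopy_class S ` loops_at S b,
      mult = (\<lambda>X Y. \<Union>p\<in>X. \<Union>q\<in>Y. homotopy_class S (p +++ q)),
      one = homotopy_class S (\<lambda>_. b)\<rparr>"

definition disk :: "complex set" where
  "disk = cball 0 1"

definition base_pt :: complex where
  "base_pt = - \<i>"

abbreviation pi1_disk :: "complex set \<Rightarrow> (real \<Rightarrow> complex) set monoid" where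
  "pi1_disk K \<equiv> fundamental_group (disk - K) base_pt"


section \<open>The standard g-base\<close>

text \<open>The loop for the straight segment from the base point to \<open>z\<close>, with the closed disk of
  radius \<open>\<epsilon>\<close> about \<open>z\<close> as the small neighbourhood: run along the segment to the boundary circle,
  once counterclockwise around it, and back.\<close>

definition segment_loop :: "complex \<Rightarrow> real \<Rightarrow> real \<Rightarrow> complex" where
  "segment_loop z \<epsilon> =
     (let \<theta> = Arg (base_pt - z);
          q' = linepath base_pt (z + rcis \<epsilon> \<theta>)
      in q' +++ (part_circlepath z \<epsilon> \<theta> (\<theta> + 2 * pi) +++ reversepath q'))"

text \<open>The class in the fundamental group is the same for every admissible \<open>\<epsilon>\<close>.\<close>

definition std_gen :: "complex set \<Rightarrow> complex \<Rightarrow> (real \<Rightarrow> complex) set" where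
  "std_gen K z =
     homotopy_class (disk - K)
       (segment_loop z (SOME \<epsilon>. 0 < \<epsilon> \<and> cball z \<epsilon> \<subseteq> interior disk \<and> cball z \<epsilon> \<inter> K = {z}))"


section \<open>The braid group\<close>

text \<open>Multiplication is composition from left to right.\<close>

definition disk_diffeos :: "complex set \<Rightarrow> (complex \<Rightarrow> complex) monoid" where
  "disk_diffeos K =
     \<lparr>carrier = {\<beta> \<in> Bij disk. smooth_on disk \<beta> \<and> smooth_on disk (inv_into disk \<beta>) \<and>
                   \<beta> ` K = K \<and> (\<forall>z\<in>frontier disk. \<beta> z = z)},
      mult = (\<lambda>\<beta> \<beta>'. compose disk \<beta>' \<beta>),
      one = (\<lambda>z\<in>disk. z)\<rparr>"

definition induced_aut ::
  "complex set \<Rightarrow> (complex \<Rightarrow> complex) \<Rightarrow> (real \<Rightarrow> complex) set \<Rightarrow> (real \<Rightarrow> complex) set" where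
  "induced_aut K \<beta> =
     (\<lambda>X\<in>carrier (pi1_disk K). \<Union>p\<in>X. homotopy_class (disk - K) (\<beta> \<circ> p))"

definition braid_class :: "complex set \<Rightarrow> (complex \<Rightarrow> complex) \<Rightarrow> (complex \<Rightarrow> complex) set" where
  "braid_class K \<beta> = {\<beta>' \<in> carrier (disk_diffeos K). induced_aut K \<beta>' = induced_aut K \<beta>}"

definition braid_group :: "complex set \<Rightarrow> (complex \<Rightarrow> complex) set monoid" where
  "braid_group K =
     \<lparr>carrier = braid_class K ` carrier (disk_diffeos K),
      mult = (\<lambda>X Y. \<Union>\<beta>\<in>X. \<Union>\<beta>'\<in>Y. braid_class K (\<beta> \<otimes>\<^bsub>disk_diffeos K\<^esub> \<beta>')),
      one = braid_class K \<one>\<^bsub>disk_diffeos K\<^esub>\<rparr>"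


section \<open>Half-twists\<close>

definition twist_profile :: "(real \<Rightarrow> real) \<Rightarrow> bool" where
  "twist_profile \<alpha> \<longleftrightarrow> smooth_on {0..} \<alpha> \<and> antimono_on {0..} \<alpha> \<and>
     (\<forall>r\<in>{0..3/2}. \<alpha> r = 1) \<and> (\<forall>r\<in>{2..}. \<alpha> r = 0)"

definition twist_map :: "(real \<Rightarrow> real) \<Rightarrow> complex \<Rightarrow> complex" where
  "twist_map \<alpha> z = z * cis (\<alpha> (cmod z) * pi)"

text \<open>Smallness of the regular neighbourhood \<open>U\<close> of \<open>\<sigma>\<close>: its closure lies in the open disk and
  contains no point of \<open>K\<close> other than the endpoints of \<open>\<sigma>\<close>.\<close>

definition half_twist_diffeo ::
  "complex set \<Rightarrow> (real \<Rightarrow> complex) \<Rightarrow> (complex \<Rightarrow> complex) \<Rightarrow> bool" where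
  "half_twist_diffeo K \<sigma> \<beta> \<longleftrightarrow>
     (\<exists>U f \<alpha>. open U \<and> path_image \<sigma> \<subseteq> U \<and> closure U \<subseteq> interior disk \<and>
        closure U \<inter> K = {pathstart \<sigma>, pathfinish \<sigma>} \<and>
        plane_diffeo f \<and> orientation_preserving f \<and>
        f ` path_image \<sigma> = closed_segment (-1) 1 \<and> f ` U = ball 0 2 \<and>
        twist_profile \<alpha> \<and>
        \<beta> = restrict (inv_into UNIV f \<circ> twist_map \<alpha> \<circ> f) disk)"

text \<open>The braid does not depend on the choices of \<open>U\<close>, \<open>f\<close> and \<open>\<alpha>\<close>.\<close>

definition half_twist :: "complex set \<Rightarrow> (real \<Rightarrow> complex) \<Rightarrow> (complex \<Rightarrow> complex) set" where
  "half_twist K \<sigma> = braid_class K (SOME \<beta>. half_twist_diffeo K \<sigma> \<beta>)"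


section \<open>Braid words\<close>

text \<open>The marked points are \<open>k 1, \<dots>, k n\<close>.  The letter \<open>(i, True)\<close> stands for the \<open>i\<close>-th standard
  half-twist and \<open>(i, False)\<close> for its inverse.\<close>

type_synonym braid_word = "(nat \<times> bool) list"

definition std_frame ::
  "nat \<Rightarrow> (nat \<Rightarrow> complex) \<Rightarrow> nat \<Rightarrow> (complex \<Rightarrow> complex) set" where
  "std_frame n k i = half_twist (k ` {1..n}) (linepath (k i) (k (Suc i)))"

definition braid_letter ::
  "nat \<Rightarrow> (nat \<Rightarrow> complex) \<Rightarrow> nat \<times> bool \<Rightarrow> (complex \<Rightarrow> complex) set" where
  "braid_letter n k =
     (\<lambda>(i, e). if e then std_frame n k i
               else inv\<^bsub>braid_group (k ` {1..n})\<^esub> (std_frame n k i))"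

definition braid_of_word ::
  "nat \<Rightarrow> (nat \<Rightarrow> complex) \<Rightarrow> braid_word \<Rightarrow> (complex \<Rightarrow> complex) set" where
  "braid_of_word n k w =
     foldr (\<lambda>l b. braid_letter n k l \<otimes>\<^bsub>braid_group (k ` {1..n})\<^esub> b) w
       \<one>\<^bsub>braid_group (k ` {1..n})\<^esub>"


section \<open>Words in generators\<close>

text \<open>The letter \<open>(g, True)\<close> stands for the generator \<open>g\<close> and \<open>(g, False)\<close> for its inverse.\<close>

type_synonym 'g gen_word = "('g \<times> bool) list"

definition inv_word :: "'g gen_word \<Rightarrow> 'g gen_word" where
  "inv_word w = rev (map (\<lambda>(g, e). (g, \<not> e)) w)"

definition reduced_word :: "'g gen_word \<Rightarrow> bool" where
  "reduced_word w \<longleftrightarrow> \<not> (\<exists>xs g e ys. w = xs @ [(g, e), (g, \<not> e)] @ ys)"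

inductive cancel_step :: "'g gen_word \<Rightarrow> 'g gen_word \<Rightarrow> bool" where
  "cancel_step (xs @ [(g, e), (g, \<not> e)] @ ys) (xs @ ys)"

fun cancel_Cons :: "'g \<times> bool \<Rightarrow> 'g gen_word \<Rightarrow> 'g gen_word" where
  "cancel_Cons x [] = [x]"
| "cancel_Cons x (y # w) = (if fst y = fst x \<and> snd y = (\<not> snd x) then w else x # y # w)"

definition free_reduce :: "'g gen_word \<Rightarrow> 'g gen_word" where
  "free_reduce w = foldr cancel_Cons w []"

lemma cancel_step_Cons: "cancel_step v w \<Longrightarrow> cancel_step (x # v) (x # w)"
  by (metis append_Cons cancel_step.cases cancel_step.intros)

lemma cancel_steps_free_reduce: "cancel_step\<^sup>*\<^sup>* w (free_reduce w)"
proof (induction w)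
  case Nil
  then show ?case by (simp add: free_reduce_def)
next
  case (Cons x w)
  have "cancel_step\<^sup>*\<^sup>* (x # w) (x # free_reduce w)"
    using Cons.IH by (induction rule: rtranclp_induct)
      (auto intro: rtranclp.rtrancl_into_rtrancl cancel_step_Cons)
  moreover have "cancel_step\<^sup>*\<^sup>* (x # v) (cancel_Cons x v)" for v
  proof (cases v)
    case (Cons y v')
    then show ?thesis
      using cancel_step.intros[of "[]" "fst x" "snd x" v']
      by (cases x; cases y) auto
  qed simp
  ultimately show ?case
    by (metis (no_types, lifting) foldr.simps(2) free_reduce_def o_apply rtranclp_trans)
qed

lemma reduced_word_free_reduce: "reduced_word (free_reduce w)"
proof (induction w)
  case Nil
  then show ?case by (simp add: free_reduce_def reduced_word_def)
next
  case (Cons x w)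
  have "reduced_word (cancel_Cons x v)" if v: "reduced_word v" for v
  proof (cases v)
    case Nil
    then show ?thesis by (auto simp: reduced_word_def append_eq_Cons_conv Cons_eq_append_conv)
  next
    case v': (Cons y v')
    show ?thesis
    proof (cases "fst y = fst x \<and> snd y = (\<not> snd x)")
      case True
      then show ?thesis
        using v v' unfolding reduced_word_def by (metis append_Cons cancel_Cons.simps(2))
    next
      case False
      then show ?thesis
        using v v' by (auto simp: reduced_word_def Cons_eq_append_conv)
    qed
  qed
  with Cons.IH show ?case by (simp add: free_reduce_def)
qed


section \<open>Braid moves and the algorithm\<close>

definition braid_move :: "nat \<Rightarrow> (nat \<Rightarrow> 'g gen_word) \<Rightarrow> nat \<Rightarrow> 'g gen_word" where
  "braid_move i \<Gamma> =
     \<Gamma>(i := \<Gamma> (Suc i), Suc i := \<Gamma> (Suc i) @ \<Gamma> i @ inv_word (\<Gamma> (Suc i)))"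

text \<open>The solution for \<open>\<Delta>\<close> of the requirement that \<open>\<Gamma>\<close> is obtained from \<open>\<Delta>\<close> by the positive
  braid move.\<close>

definition braid_move_inv :: "nat \<Rightarrow> (nat \<Rightarrow> 'g gen_word) \<Rightarrow> nat \<Rightarrow> 'g gen_word" where
  "braid_move_inv i \<Gamma> =
     \<Gamma>(i := inv_word (\<Gamma> i) @ \<Gamma> (Suc i) @ \<Gamma> i, Suc i := \<Gamma> i)"

lemma cancel_steps_inv_word: "cancel_step\<^sup>*\<^sup>* (xs @ v @ inv_word v @ ys) (xs @ ys)"
proof (induction v arbitrary: xs ys rule: rev_induct)
  case Nil
  then show ?case by (simp add: inv_word_def)
next
  case (snoc x v)
  obtain g e where "x = (g, e)" by (cases x)
  then have "cancel_step (xs @ (v @ [x]) @ inv_word (v @ [x]) @ ys) (xs @ v @ inv_word v @ ys)"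
    using cancel_step.intros[of "xs @ v" g e "inv_word v @ ys"] by (simp add: inv_word_def)
  then show ?case
    using snoc.IH[of xs ys] by (rule converse_rtranclp_into_rtranclp)
qed

lemma braid_move_braid_move_inv: "cancel_step\<^sup>*\<^sup>* (braid_move i (braid_move_inv i \<Gamma>) j) (\<Gamma> j)"
proof -
  have "cancel_step\<^sup>*\<^sup>* (\<Gamma> i @ inv_word (\<Gamma> i) @ \<Gamma> (Suc i) @ \<Gamma> i @ inv_word (\<Gamma> i)) (\<Gamma> (Suc i))"
    using rtranclp_trans[OF cancel_steps_inv_word[of "[]" "\<Gamma> i" "\<Gamma> (Suc i) @ \<Gamma> i @ inv_word (\<Gamma> i)"]]
      cancel_steps_inv_word[of "\<Gamma> (Suc i)" "\<Gamma> i" "[]"] by simp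
  then show ?thesis
    by (auto simp: braid_move_def braid_move_inv_def)
qed

text \<open>Here \<open>g\<close> is the tuple of generators; \<open>foldr\<close> treats the last letter of the word first.\<close>

definition process_letter ::
  "nat \<times> bool \<Rightarrow> (nat \<Rightarrow> 'g gen_word) \<Rightarrow> nat \<Rightarrow> 'g gen_word" where
  "process_letter =
     (\<lambda>(i, e) \<Gamma>. free_reduce \<circ> (if e then braid_move i \<Gamma> else braid_move_inv i \<Gamma>))"

definition process_word :: "(nat \<Rightarrow> 'g) \<Rightarrow> braid_word \<Rightarrow> nat \<Rightarrow> 'g gen_word" where
  "process_word g w = foldr process_letter w (\<lambda>j. [(g j, True)])"

end

theory Submission imports Defs begin

text \<open>Reading off the segments of the real axis that a path crosses assigns to every path in a convex set
  with punctures on the real axis a reduced word in a free group. This word is multiplicative under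
  concatenation, and two paths with the same end points are homotopic if and only if their words agree.
  Hence \<open>\<pi>\<^sub>1(D - K)\<close> embeds into a free group, the standard generators become free generators, and
  a braid is determined by the words of the images of the standard loops.

  A half-twist \<open>\<beta>\<close> about a segment is conjugate by \<open>f\<close> to a rotation \<open>h\<close> inside a disk. In the coordinate
  \<open>f\<close>, a path off the segment can be pushed radially out of that disk, where \<open>h\<close> is the identity, so \<open>\<beta>\<close>
  fixes its class. Applied to the standard loops around the other points and to a loop around both end
  points, this leaves only the class of \<open>\<beta>(\<gamma>\<^sub>i)\<close> to be found. The loop \<open>L\<close> around one end point
  satisfies \<open>h(L) L = \<partial>\<close>, the boundary of the twice punctured disk, and winding numbers identify the loops
  to which \<open>L\<close> and \<open>\<partial>\<close> correspond under an arbitrary orientation-preserving \<open>f\<close>. The result is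
  the braid move, and the theorem follows by induction on the word: prepending a letter substitutes the
  words already obtained into the move of that letter.\<close>

section \<open>Free groups of reduced words\<close>

text \<open>The obstacle is that a half-twist is known only through an unspecified \<open>f\<close>:
  not even the end of the segment that goes to -1 is fixed, so the image of a loop cannot be traced
  by a formula. One equation forces it instead. The twist fixes the class of a path from the base
  point to the edge of the neighbourhood, and conjugating the relation of the model along that path
  gives \<beta>(x) x = y x, where x and y are the i-th and the next generator; hence \<beta>(x) = y.
  Invariance of the product y x then gives \<beta>(y) = y x y^-1.

  Winding numbers suffice to carry loops through \<open>f\<close> because the two regions involved,
  a punctured disk and a disk without a segment, have infinite cyclic fundamental groups. About
  \<open>f\<close> itself one fact is needed: a loop winding once about \<open>k i\<close> is mapped
  to one winding once about \<open>f (k i)\<close>. This is where the Jacobian enters, at a single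
  point.

  Words are indexed by numbers until the very end, where the indices are replaced by the homotopy
  classes that the theorem uses as letters.\<close>

lemma cancel_Cons_cancel:
  assumes "reduced_word v"
  shows "cancel_Cons (g, e) (cancel_Cons (g, \<not> e) v) = v"
proof (cases v)
  case (Cons y w)
  then show ?thesis
  proof (cases "fst y = g \<and> snd y = e")
    case True
    then have y: "y = (g, e)" by (cases y) auto
    \<comment> \<open>The outer step puts \<open>(g, e)\<close> back in front of \<open>w\<close>.
      This must not start a second cancellation, which is what reducedness of \<open>v\<close>
      excludes.\<close>
    have "\<not> (fst z = g \<and> snd z = (\<not> e))" if "w = z # w'" for z w'
    proof
      assume "fst z = g \<and> snd z = (\<not> e)"
      then have "v = [] @ [(g, e), (g, \<not> e)] @ w'" using Cons y that by (cases z) auto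
      then show False using assms unfolding reduced_word_def by blast
    qed
    then show ?thesis using Cons y by (cases w) auto
  qed (cases y, auto)
qed simp

lemma reduced_word_cancel_Cons: "reduced_word v \<Longrightarrow> reduced_word (cancel_Cons x v)"
proof (cases v)
  case Nil
  then show ?thesis by (auto simp: reduced_word_def append_eq_Cons_conv Cons_eq_append_conv)
next
  case (Cons y v')
  assume "reduced_word v"
  then show ?thesis
    using Cons by (cases "fst y = fst x \<and> snd y = (\<not> snd x)")
      (auto simp: reduced_word_def Cons_eq_append_conv)
qed

lemma reduced_word_foldr: "reduced_word v \<Longrightarrow> reduced_word (foldr cancel_Cons u v)"
  by (induction u) (auto intro: reduced_word_cancel_Cons)

text \<open>Van der Waerden's argument: letters act on reduced words through
  \<open>cancel_Cons\<close>, and inverse letters act by inverse maps, so deleting an adjacent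
  inverse pair does not change the action of a word. Associativity of the free group comes from
  this.\<close>

lemma foldr_cancel_Cons:
  assumes "reduced_word v"
  shows "foldr cancel_Cons (cancel_Cons x w) v = cancel_Cons x (foldr cancel_Cons w v)"
proof (cases w)
  case (Cons y w')
  show ?thesis
  proof (cases "fst y = fst x \<and> snd y = (\<not> snd x)")
    case True
    then have "y = (fst x, \<not> snd x)" by (cases y) auto
    then show ?thesis
      using Cons cancel_Cons_cancel[OF reduced_word_foldr[OF assms], of "fst x" "snd x" w'] by simp
  next
    case False
    then have "cancel_Cons x w = x # w" using Cons by simp
    then show ?thesis by simp
  qed
qed simp

lemma foldr_cancel_Cons_free_reduce:
  assumes "reduced_word v"
  shows "foldr cancel_Cons (free_reduce u) v = foldr cancel_Cons u v"
  by (induction u) (auto simp: free_reduce_def foldr_cancel_Cons[OF assms])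

lemma free_reduce_append: "free_reduce (u @ v) = foldr cancel_Cons u (free_reduce v)"
  by (simp add: free_reduce_def)

lemma free_reduce_reduced: "reduced_word w \<Longrightarrow> free_reduce w = w"
proof (induction w)
  case Nil
  then show ?case by (simp add: free_reduce_def)
next
  case (Cons x w)
  have w: "reduced_word w"
    using Cons.prems unfolding reduced_word_def by (metis append_Cons)
  have "cancel_Cons x w = x # w"
  proof (cases w)
    case w': (Cons y w')
    obtain g e where x: "x = (g, e)" by (cases x)
    have "y \<noteq> (g, \<not> e)"
    proof
      assume "y = (g, \<not> e)"
      then have "x # w = [] @ [(g, e), (g, \<not> e)] @ w'"
        using w' x by simp
      then show False using Cons.prems unfolding reduced_word_def by blast
    qed
    then show ?thesis using w' x by (cases y) simp
  qed simp
  then show ?case using Cons.IH[OF w] by (simp add: free_reduce_def)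
qed

text \<open>With the reduced words themselves as elements, equality in the group is the
  letter-by-letter equality of the theorem. The notation is additive because
  \<open>group_add\<close> is the type class of groups, commutative or not.\<close>

typedef 'g fgroup = "{w :: 'g gen_word. reduced_word w}"
  morphisms fg_word Abs_fgroup
  by (auto simp: reduced_word_def intro!: exI[of _ "[]"])

definition fg_class :: "'g gen_word \<Rightarrow> 'g fgroup" where
  "fg_class w = Abs_fgroup (free_reduce w)"

lemma fg_word_class [simp]: "fg_word (fg_class w) = free_reduce w"
  by (simp add: fg_class_def Abs_fgroup_inverse reduced_word_free_reduce)

lemma reduced_fg_word [simp]: "reduced_word (fg_word x)"
  using fg_word by auto

lemma fg_class_word [simp]: "fg_class (fg_word x) = x"
  by (simp add: fg_class_def free_reduce_reduced fg_word_inverse)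

lemma fg_class_eq_iff: "fg_class u = fg_class v \<longleftrightarrow> free_reduce u = free_reduce v"
  by (metis fg_class_def fg_word_class)

lemma free_reduce_idem [simp]: "free_reduce (free_reduce w) = free_reduce w"
  by (simp add: free_reduce_reduced reduced_word_free_reduce)

lemma fg_class_free_reduce [simp]: "fg_class (free_reduce w) = fg_class w"
  by (simp add: fg_class_eq_iff)

lemma free_reduce_append_reduce:
  "free_reduce (free_reduce u @ v) = free_reduce (u @ v)"
  "free_reduce (u @ free_reduce v) = free_reduce (u @ v)"
  by (simp_all add: free_reduce_append foldr_cancel_Cons_free_reduce reduced_word_free_reduce)

lemma free_reduce_cancel: "free_reduce (u @ (g, e) # (g, \<not> e) # v) = free_reduce (u @ v)"
  using cancel_Cons_cancel[OF reduced_word_free_reduce, of g e v]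
  by (simp add: free_reduce_append) (simp add: free_reduce_def)

lemma free_reduce_inv_word: "free_reduce (inv_word w @ w) = []"
proof (induction w)
  case Nil
  then show ?case by (simp add: inv_word_def free_reduce_def)
next
  case (Cons x w)
  then show ?case
    using free_reduce_cancel[of "inv_word w" "fst x" "\<not> snd x" w]
    by (cases x) (simp add: inv_word_def)
qed

instantiation fgroup :: (type) group_add
begin

definition "0 = fg_class []"
definition "x + y = fg_class (fg_word x @ fg_word y)"
definition "- x = fg_class (inv_word (fg_word x))"
definition "x - y = x + - (y :: 'a fgroup)"

instance
proof
  fix a b c :: "'a fgroup"
  show "a + b + c = a + (b + c)"
    by (simp add: plus_fgroup_def fg_class_eq_iff free_reduce_append_reduce)
  show "0 + a = a" "a + 0 = a"
    by (simp_all add: plus_fgroup_def zero_fgroup_def free_reduce_def)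
  show "- a + a = 0"
    by (simp add: plus_fgroup_def zero_fgroup_def uminus_fgroup_def fg_class_eq_iff
        free_reduce_append_reduce free_reduce_inv_word free_reduce_reduced[of "[]"] reduced_word_def)
  show "a + - b = a - b"
    by (simp add: minus_fgroup_def)
qed

end

lemma fg_class_append: "fg_class (u @ v) = fg_class u + fg_class v"
  by (simp add: plus_fgroup_def fg_class_eq_iff free_reduce_append_reduce)

lemma fg_class_Nil [simp]: "fg_class [] = 0"
  by (simp add: zero_fgroup_def)

lemma fg_class_inv_word: "fg_class (inv_word w) = - fg_class w"
proof -
  have "fg_class (inv_word w) + fg_class w = 0"
    by (metis fg_class_append fg_class_free_reduce fg_class_Nil free_reduce_inv_word)
  then show ?thesis
    by (metis add_eq_0_iff minus_minus eq_neg_iff_add_eq_0)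
qed

section \<open>Generators, evaluation homomorphisms and letters\<close>

definition fg_gen :: "'g \<Rightarrow> 'g fgroup" where
  "fg_gen g = fg_class [(g, True)]"

lemma fg_class_letter: "fg_class [(g, e)] = (if e then fg_gen g else - fg_gen g)"
  using fg_class_inv_word[of "[(g, True)]"] by (simp add: fg_gen_def inv_word_def)

lemma fg_gen_inject: "fg_gen g = fg_gen h \<longleftrightarrow> g = h"
  by (simp add: fg_gen_def fg_class_eq_iff free_reduce_def)

definition fg_eval :: "('g \<Rightarrow> 'h::group_add) \<Rightarrow> 'g gen_word \<Rightarrow> 'h" where
  "fg_eval f w = foldr (\<lambda>(g, e) a. (if e then f g else - f g) + a) w 0"

lemma fg_eval_Nil [simp]: "fg_eval f [] = 0"
  by (simp add: fg_eval_def)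

lemma fg_eval_Cons [simp]: "fg_eval f ((g, e) # w) = (if e then f g else - f g) + fg_eval f w"
  by (simp add: fg_eval_def)

lemma fg_eval_append [simp]: "fg_eval f (u @ v) = fg_eval f u + fg_eval f v"
  by (induction u) (auto simp: add.assoc)

lemma fg_eval_gen: "fg_eval fg_gen w = fg_class w"
proof (induction w)
  case (Cons x w)
  then show ?case
    using fg_class_append[of "[x]" w] by (cases x) (auto simp: fg_class_letter)
qed simp

text \<open>There is a generator for every natural number, but only the indices in
  \<open>{1..n}\<close> belong to punctures. Wherever a letter is replaced by an actual loop, all
  other letters have to be ruled out.\<close>

definition fg_letters :: "'g fgroup \<Rightarrow> 'g set" where
  "fg_letters x = fst ` set (fg_word x)"

lemma letters_cancel_Cons: "fst ` set (cancel_Cons x w) \<subseteq> insert (fst x) (fst ` set w)"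
  by (cases w) auto

lemma letters_free_reduce: "fst ` set (free_reduce w) \<subseteq> fst ` set w"
proof (induction w)
  case (Cons x w)
  have "fst ` set (free_reduce (x # w)) \<subseteq> insert (fst x) (fst ` set (free_reduce w))"
    using letters_cancel_Cons[of x "free_reduce w"] by (simp add: free_reduce_def)
  also have "\<dots> \<subseteq> fst ` set (x # w)"
    using Cons.IH by auto
  finally show ?case .
qed (simp add: free_reduce_def)

lemma fg_letters_class: "fg_letters (fg_class w) \<subseteq> fst ` set w"
  by (simp add: fg_letters_def letters_free_reduce)

lemma fg_letters_add: "fg_letters (x + y) \<subseteq> fg_letters x \<union> fg_letters y"
  using fg_letters_class[of "fg_word x @ fg_word y"]
  by (auto simp: plus_fgroup_def fg_letters_def)

lemma letters_inv_word: "fst ` set (inv_word w) = fst ` set w"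
  by (force simp: inv_word_def)

lemma fg_letters_minus: "fg_letters (- x) \<subseteq> fg_letters x"
  using fg_letters_class[of "inv_word (fg_word x)"]
  by (auto simp: uminus_fgroup_def fg_letters_def letters_inv_word)

lemma fg_letters_0 [simp]: "fg_letters 0 = {}"
  using fg_letters_class[of "[]"] by simp

lemma fg_letters_gen [simp]: "fg_letters (fg_gen g) = {g}"
  by (simp add: fg_letters_def fg_gen_def free_reduce_def)

lemma cancel_Cons_map:
  assumes "inj_on f A" "fst x \<in> A" "fst ` set w \<subseteq> A"
  shows "cancel_Cons (map_prod f (\<lambda>e. e) x) (map (map_prod f (\<lambda>e. e)) w) = map (map_prod f (\<lambda>e. e)) (cancel_Cons x w)"
  using assms by (cases w) (auto simp: inj_on_eq_iff)

text \<open>An injective relabelling creates no new inverse pairs. This is what allows the passage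
  from indices to homotopy classes as letters.\<close>

lemma free_reduce_map:
  assumes "inj_on f A" "fst ` set w \<subseteq> A"
  shows "free_reduce (map (map_prod f (\<lambda>e. e)) w) = map (map_prod f (\<lambda>e. e)) (free_reduce w)"
  using assms(2)
proof (induction w)
  case (Cons x w)
  let ?m = "map (map_prod f (\<lambda>e. e))"
  have "free_reduce (?m (x # w)) = cancel_Cons (map_prod f (\<lambda>e. e) x) (free_reduce (?m w))"
    by (simp add: free_reduce_def)
  also have "\<dots> = cancel_Cons (map_prod f (\<lambda>e. e) x) (?m (free_reduce w))"
    using Cons by simp
  also have "\<dots> = ?m (cancel_Cons x (free_reduce w))"
    using Cons.prems letters_free_reduce[of w] by (intro cancel_Cons_map[OF assms(1)]) auto
  finally show ?case by (simp add: free_reduce_def)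
qed (simp add: free_reduce_def)

section \<open>Crossing words of paths\<close>

text \<open>The word of a path that rises through the gap with \<open>a\<close> punctures on its
  left and descends left of all punctures. Closed up below the axis, it surrounds the punctures 1 to
  \<open>a\<close> counterclockwise, which makes the rightmost one come first in the
  product.\<close>

primrec stair :: "nat \<Rightarrow> nat fgroup" where
  "stair 0 = 0"
| "stair (Suc a) = fg_gen (Suc a) + stair a"

lemma fg_letters_stair: "fg_letters (stair a) \<subseteq> {1..a}"
proof (induction a)
  case (Suc a)
  then show ?case
    using fg_letters_add[of "fg_gen (Suc a)" "stair a"] by fastforce
qed simp

text \<open>Used for three domains: the unit disk, the disk of radius 2 punctured at 1 and -1, and
  the plane with one puncture. The points \<open>bp\<close> and \<open>tp\<close> are centres about
  which the two halves are starlike; \<open>lp\<close> and \<open>rp\<close> stand for the outermost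
  gaps of the axis.\<close>

locale slit =
  fixes D :: "complex set" and n :: nat and k :: "nat \<Rightarrow> complex" and bp tp lp rp :: complex
  assumes convex_D: "convex D"
    and k_in: "\<And>i. i \<in> {1..n} \<Longrightarrow> k i \<in> D" "\<And>i. i \<in> {1..n} \<Longrightarrow> Im (k i) = 0"
    and k_mono: "strict_mono_on {1..n} (\<lambda>i. Re (k i))"
    and bp: "bp \<in> D" "Im bp < 0" and tp: "tp \<in> D" "Im tp > 0"
    and lp: "lp \<in> D" "Im lp = 0" "\<And>i. i \<in> {1..n} \<Longrightarrow> Re lp < Re (k i)"
    and rp: "rp \<in> D" "Im rp = 0" "\<And>i. i \<in> {1..n} \<Longrightarrow> Re (k i) < Re rp"
begin

abbreviation "K \<equiv> k ` {1..n}"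
abbreviation "X \<equiv> D - K"

definition idx :: "complex \<Rightarrow> nat" where
  "idx z = card {i \<in> {1..n}. Re (k i) < Re z}"

text \<open>The axis counts as part of the lower side. Only steps too short to pass a puncture matter, so
  \<open>idx x\<close> stands for the number of punctures to the left of the point where the axis is crossed.\<close>

definition crossing :: "complex \<Rightarrow> complex \<Rightarrow> nat fgroup" where
  "crossing x y = (if Im x \<le> 0 then if Im y \<le> 0 then 0 else stair (idx x)
     else if Im y \<le> 0 then - stair (idx x) else 0)"

lemma crossing_refl [simp]: "crossing x x = 0"
  by (simp add: crossing_def)

lemma finite_K: "finite K"
  by simp

lemma idx_le: "idx z \<le> n"
proof -
  have "card {i \<in> {1..n}. Re (k i) < Re z} \<le> card {1..n}"
    by (rule card_mono) auto
  then show ?thesis by (simp add: idx_def)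
qed

lemma fg_letters_crossing: "fg_letters (crossing x y) \<subseteq> {1..n}"
proof -
  have "fg_letters (stair (idx x)) \<subseteq> {1..n}"
    using fg_letters_stair[of "idx x"] idx_le[of x] by fastforce
  moreover have "fg_letters (- stair (idx x)) \<subseteq> {1..n}"
    using calculation fg_letters_minus[of "stair (idx x)"] by blast
  ultimately show ?thesis by (simp add: crossing_def)
qed

text \<open>The source of every local argument: near a point off the axis nothing can be crossed,
  and near an unpunctured point of the axis all crossings go through the same gap.\<close>

lemma near_cases:
  assumes "z \<notin> K"
  obtains e where "e > 0" "(\<forall>x\<in>ball z e. Im x < 0) \<or> (\<forall>x\<in>ball z e. Im x > 0) \<or>
    (Im z = 0 \<and> (\<forall>x\<in>ball z e. idx x = idx z) \<and> ball z e \<inter> K = {})"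
proof (cases "Im z = 0")
  case True
  obtain e where e: "e > 0" "ball z e \<inter> K = {}"
    using finite_imp_closed[OF finite_K] assms
    by (metis Compl_iff disjoint_eq_subset_Compl open_Compl open_contains_ball)
  have "idx x = idx z" if x: "x \<in> ball z e" for x
  proof -
    have "Re (k i) < Re x \<longleftrightarrow> Re (k i) < Re z" if i: "i \<in> {1..n}" for i
    proof -
      have "k i \<notin> ball z e" using e i by blast
      moreover have "dist z (k i) = \<bar>Re (k i) - Re z\<bar>"
        using True k_in(2)[OF i] by (simp add: dist_norm norm_minus_commute cmod_eq_Re)
      moreover have "\<bar>Re x - Re z\<bar> < e"
        using abs_Re_le_cmod[of "x - z"] x by (simp add: dist_norm norm_minus_commute)
      ultimately show ?thesis by (auto simp: abs_if split: if_splits)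
    qed
    then show ?thesis unfolding idx_def by metis
  qed
  then show ?thesis using that e True by blast
next
  case False
  have im: "\<bar>Im x - Im z\<bar> < \<bar>Im z\<bar>" if "x \<in> ball z \<bar>Im z\<bar>" for x
    using abs_Im_le_cmod[of "x - z"] that by (simp add: dist_norm norm_minus_commute)
  have "(\<forall>x\<in>ball z \<bar>Im z\<bar>. Im x < 0) \<or> (\<forall>x\<in>ball z \<bar>Im z\<bar>. Im x > 0)"
  proof (cases "Im z > 0")
    case True
    then show ?thesis using im by fastforce
  next
    case F: False
    then show ?thesis using im by fastforce
  qed
  then show ?thesis using that[of "\<bar>Im z\<bar>"] False by auto
qed

text \<open>In a ball given by \<open>near_cases\<close> the crossing is a difference F(x) - F(y),
  with F equal to one fixed stair on the lower side and 0 above, or it vanishes. Hence it is a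
  cocycle there, and a Lebesgue number of the cover of \<open>C\<close> gives a radius that works
  everywhere.\<close>

lemma crossing_lebesgue:
  assumes "compact C" "C \<inter> K = {}"
  obtains d where "d > 0"
    "\<And>z x y w. \<lbrakk>z \<in> C; x \<in> ball z d; y \<in> ball z d; w \<in> ball z d\<rbrakk>
       \<Longrightarrow> crossing x y + crossing y w = crossing x w"
proof -
  have "\<exists>e>0. \<forall>x\<in>ball z e. \<forall>y\<in>ball z e. \<forall>w\<in>ball z e. crossing x y + crossing y w = crossing x w"
    if "z \<in> C" for z
  proof -
    have "z \<notin> K" using that assms by blast
    then obtain e where e: "e > 0" "(\<forall>x\<in>ball z e. Im x < 0) \<or> (\<forall>x\<in>ball z e. Im x > 0) \<or>
      (Im z = 0 \<and> (\<forall>x\<in>ball z e. idx x = idx z) \<and> ball z e \<inter> K = {})"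
      by (rule near_cases)
    have "crossing x y + crossing y w = crossing x w"
      if b: "x \<in> ball z e" "y \<in> ball z e" "w \<in> ball z e" for x y w
    proof -
      consider "Im x < 0" "Im y < 0" "Im w < 0" | "Im x > 0" "Im y > 0" "Im w > 0"
        | "idx x = idx z" "idx y = idx z" "idx w = idx z"
        using e(2) b by metis
      then show ?thesis by cases (simp_all add: crossing_def)
    qed
    then show ?thesis using e(1) by blast
  qed
  then obtain e where e: "\<And>z. z \<in> C \<Longrightarrow> e z > 0"
    "\<And>z x y w. \<lbrakk>z \<in> C; x \<in> ball z (e z); y \<in> ball z (e z); w \<in> ball z (e z)\<rbrakk>
       \<Longrightarrow> crossing x y + crossing y w = crossing x w"
    by metis
  have "C \<subseteq> \<Union>((\<lambda>z. ball z (e z)) ` C)" using e(1) centre_in_ball by blast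
  moreover have "open G" if "G \<in> (\<lambda>z. ball z (e z)) ` C" for G using that by auto
  ultimately obtain d where d: "d > 0" "\<And>x. x \<in> C \<Longrightarrow> \<exists>G\<in>(\<lambda>z. ball z (e z)) ` C. ball x d \<subseteq> G"
    by (metis Heine_Borel_lemma[OF assms(1)])
  show ?thesis
  proof (rule that[OF d(1)])
    fix z x y w assume a: "z \<in> C" "x \<in> ball z d" "y \<in> ball z d" "w \<in> ball z d"
    obtain z' where z': "z' \<in> C" "ball z d \<subseteq> ball z' (e z')" using d(2)[OF a(1)] by blast
    show "crossing x y + crossing y w = crossing x w"
      by (rule e(2)[OF z'(1)]) (use z'(2) a in blast)+
  qed
qed

section \<open>Crossing sums of sampled paths\<close>

definition csum :: "(nat \<Rightarrow> complex) \<Rightarrow> nat \<Rightarrow> nat \<Rightarrow> nat fgroup" where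
  "csum f a b = sum_list (map (\<lambda>j. crossing (f j) (f (Suc j))) [a..<b])"

lemma csum_same [simp]: "csum f a a = 0"
  by (simp add: csum_def)

lemma csum_Suc: "a \<le> b \<Longrightarrow> csum f a (Suc b) = csum f a b + crossing (f b) (f (Suc b))"
  by (simp add: csum_def)

lemma csum_add:
  assumes "a \<le> b" "b \<le> c"
  shows "csum f a b + csum f b c = csum f a c"
  using assms(2)
proof (induction c rule: dec_induct)
  case (step m)
  then show ?case using assms(1) by (simp add: csum_Suc add.assoc[symmetric])
qed simp

lemma csum_cong: "(\<And>j. a \<le> j \<Longrightarrow> j \<le> b \<Longrightarrow> f j = g j) \<Longrightarrow> csum f a b = csum g a b"
  unfolding csum_def by (intro arg_cong[of _ _ sum_list] map_cong) auto

lemma csum_shift: "csum f d (b + d) = csum (\<lambda>j. f (j + d)) 0 b"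
proof -
  have "[d..<b + d] = map (\<lambda>j. j + d) [0..<b]"
    by (simp add: map_add_upt)
  then show ?thesis by (simp add: csum_def o_def)
qed

lemma csum_zero: "(\<And>j. a \<le> j \<Longrightarrow> j < b \<Longrightarrow> crossing (f j) (f (Suc j)) = 0) \<Longrightarrow> csum f a b = 0"
proof -
  assume *: "\<And>j. a \<le> j \<Longrightarrow> j < b \<Longrightarrow> crossing (f j) (f (Suc j)) = 0"
  have "map (\<lambda>j. crossing (f j) (f (Suc j))) [a..<b] = map (\<lambda>j. 0) [a..<b]"
    by (rule map_cong) (auto intro!: *)
  then show ?thesis unfolding csum_def by (simp only: sum_list_0)
qed

lemma csum_telescope:
  assumes "\<And>x y w. \<lbrakk>x \<in> {a..b}; y \<in> {a..b}; w \<in> {a..b}\<rbrakk>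
    \<Longrightarrow> crossing (f x) (f y) + crossing (f y) (f w) = crossing (f x) (f w)" "a \<le> b"
  shows "csum f a b = crossing (f a) (f b)"
proof -
  have "csum f a m = crossing (f a) (f m)" if "a \<le> m" "m \<le> b" for m
    using that
  proof (induction m rule: dec_induct)
    case (step m)
    then show ?case using assms(1)[of a m "Suc m"] by (simp add: csum_Suc)
  qed simp
  then show ?thesis using assms(2) by simp
qed

lemma fg_letters_csum: "fg_letters (csum f a b) \<subseteq> {1..n}"
proof (cases "a \<le> b")
  case True
  then show ?thesis
  proof (induction b rule: dec_induct)
    case (step m)
    then show ?case
      using fg_letters_add[of "csum f a m" "crossing (f m) (f (Suc m))"]
        fg_letters_crossing[of "f m" "f (Suc m)"] by (auto simp: csum_Suc)
  qed simp
qed (simp add: csum_def)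

definition wsum :: "(real \<Rightarrow> complex) \<Rightarrow> nat \<Rightarrow> nat fgroup" where
  "wsum p N = csum (\<lambda>j. p (real j / real N)) 0 N"

text \<open>On the scale \<open>1 / N\<close> the crossings form a cocycle along \<open>p\<close>, so refining the sampling does not
  change the sum.\<close>

definition adequate :: "(real \<Rightarrow> complex) \<Rightarrow> nat \<Rightarrow> bool" where
  "adequate p N \<longleftrightarrow> N > 0 \<and> (\<forall>s\<in>{0..1}. \<forall>x\<in>{0..1}. \<forall>y\<in>{0..1}. \<forall>w\<in>{0..1}.
     \<bar>x - s\<bar> \<le> 1 / N \<longrightarrow> \<bar>y - s\<bar> \<le> 1 / N \<longrightarrow> \<bar>w - s\<bar> \<le> 1 / N \<longrightarrow>
     crossing (p x) (p y) + crossing (p y) (p w) = crossing (p x) (p w))"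

definition W :: "(real \<Rightarrow> complex) \<Rightarrow> nat fgroup" where
  "W p = wsum p (SOME N. adequate p N)"

text \<open>Uniform continuity of \<open>p\<close> turns the radius of
  \<open>crossing_lebesgue\<close> into a time step.\<close>

lemma eventually_adequate:
  assumes "path p" "path_image p \<inter> K = {}"
  shows "eventually (adequate p) sequentially"
proof -
  have "compact (path_image p)" using assms by (simp add: compact_path_image)
  then obtain d where d: "d > 0"
    "\<And>z x y w. \<lbrakk>z \<in> path_image p; x \<in> ball z d; y \<in> ball z d; w \<in> ball z d\<rbrakk>
       \<Longrightarrow> crossing x y + crossing y w = crossing x w"
    using crossing_lebesgue assms(2) by blast
  have "uniformly_continuous_on {0..1} p"
    using assms(1) by (simp add: path_def compact_uniformly_continuous)
  then obtain h where h: "h > 0" "\<And>x y. \<lbrakk>x \<in> {0..1}; y \<in> {0..1}; dist y x < h\<rbrakk> \<Longrightarrow> dist (p y) (p x) < d"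
    unfolding uniformly_continuous_on_def using d(1) by metis
  obtain N0 :: nat where N0: "1 / h < N0" using reals_Archimedean2 by blast
  have "adequate p N" if "N \<ge> max 1 N0" for N
  proof -
    have N: "N > 0" "1 / N < h"
      using that N0 h(1) by (auto simp: field_simps) (meson less_le_trans mult_left_mono of_nat_mono less_imp_le)
    have *: "p x \<in> ball (p s) d" if "x \<in> {0..1}" "s \<in> {0..1}" "\<bar>x - s\<bar> \<le> 1 / N" for x s
      using h(2)[OF that(2,1)] that N by (simp add: dist_real_def dist_commute)
    then show ?thesis
      unfolding adequate_def
    proof (intro conjI ballI impI N(1))
      fix s x y w assume a: "s \<in> {0..1}" "x \<in> {0..1}" "y \<in> {0..1}" "w \<in> {0..1}"
        "\<bar>x - s\<bar> \<le> 1 / N" "\<bar>y - s\<bar> \<le> 1 / N" "\<bar>w - s\<bar> \<le> 1 / N"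
      have "p s \<in> path_image p" using a(1) by (simp add: path_image_def)
      then show "crossing (p x) (p y) + crossing (p y) (p w) = crossing (p x) (p w)"
        using d(2) * a by blast
    qed
  qed
  then show ?thesis unfolding eventually_sequentially by blast
qed

lemma wsum_refine:
  assumes "adequate p N" "M > 0"
  shows "wsum p (N * M) = wsum p N"
proof -
  have N: "N > 0" using assms by (simp add: adequate_def)
  have "csum (\<lambda>j. p (real j / real (N * M))) 0 (m * M) = csum (\<lambda>j. p (real j / real N)) 0 m"
    if "m \<le> N" for m
    using that
  proof (induction m)
    case (Suc m)
    let ?f = "\<lambda>j. p (real j / real (N * M))"
    have rng: "real x / real (N * M) \<in> {0..1}" "\<bar>real x / real (N * M) - real m / real N\<bar> \<le> 1 / N"
      if "x \<in> {m * M..Suc m * M}" for x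
    proof -
      have "real m * real M \<le> real x" "real x \<le> real (Suc m) * real M"
        using that by (metis atLeastAtMost_iff of_nat_le_iff of_nat_mult)+
      then have 1: "real m / N \<le> real x / real (N * M)" "real x / real (N * M) \<le> real (Suc m) / N"
        using N assms(2) by (auto simp: field_simps)
      have 2: "real (Suc m) / N = real m / N + 1 / N" by (simp add: add_divide_distrib)
      have 3: "real (Suc m) / N \<le> 1" using Suc.prems N by simp
      show "real x / real (N * M) \<in> {0..1}" using 1 3 by auto
      show "\<bar>real x / real (N * M) - real m / real N\<bar> \<le> 1 / N" using 1 2 by auto
    qed
    have m01: "real m / N \<in> {0..1}" using Suc.prems N by auto
    have "csum ?f (m * M) (Suc m * M) = crossing (?f (m * M)) (?f (Suc m * M))"
    proof (rule csum_telescope)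
      fix x y w assume a: "x \<in> {m * M..Suc m * M}" "y \<in> {m * M..Suc m * M}" "w \<in> {m * M..Suc m * M}"
      have c: "\<lbrakk>s \<in> {0..1}; x \<in> {0..1}; y \<in> {0..1}; w \<in> {0..1};
          \<bar>x - s\<bar> \<le> 1 / N; \<bar>y - s\<bar> \<le> 1 / N; \<bar>w - s\<bar> \<le> 1 / N\<rbrakk> \<Longrightarrow>
          crossing (p x) (p y) + crossing (p y) (p w) = crossing (p x) (p w)" for s x y w
        using assms(1) unfolding adequate_def by blast
      show "crossing (?f x) (?f y) + crossing (?f y) (?f w) = crossing (?f x) (?f w)"
        by (rule c[OF m01 rng(1)[OF a(1)] rng(1)[OF a(2)] rng(1)[OF a(3)]
            rng(2)[OF a(1)] rng(2)[OF a(2)] rng(2)[OF a(3)]])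
    qed simp
    moreover have "?f (m * M) = p (real m / N)" for m
      using assms(2) by (simp only: of_nat_mult) simp
    moreover have "csum ?f 0 (Suc m * M) = csum ?f 0 (m * M) + csum ?f (m * M) (Suc m * M)"
      by (rule csum_add[symmetric]) auto
    ultimately have "csum ?f 0 (Suc m * M) =
        csum ?f 0 (m * M) + crossing (p (real m / N)) (p (real (Suc m) / N))"
      by presburger
    then show ?case using Suc.IH Suc.prems by (simp add: csum_Suc del: of_nat_Suc of_nat_mult mult_Suc)
  qed simp
  then show ?thesis by (simp add: wsum_def)
qed

text \<open>The given scale \<open>N\<close> and the chosen scale \<open>M\<close> have the common
  refinement \<open>N * M\<close>.\<close>

lemma W_eqI:
  assumes "adequate p N"
  shows "W p = wsum p N"
proof -
  define M where "M = (SOME N. adequate p N)"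
  have M: "adequate p M" unfolding M_def using assms by (rule someI)
  have "wsum p (N * M) = wsum p N" "wsum p (M * N) = wsum p M"
    using wsum_refine assms M by (auto simp: adequate_def)
  then show ?thesis by (simp add: W_def M_def[symmetric] mult.commute)
qed

lemma W_obtain:
  assumes "path p" "path_image p \<inter> K = {}"
  obtains N where "N \<ge> m" "N > 0" "adequate p N" "W p = wsum p N"
proof -
  obtain N where "N \<ge> max m 1" "adequate p N"
    using eventually_happens'[OF sequentially_bot
        eventually_conj[OF eventually_ge_at_top[of "max m 1"] eventually_adequate[OF assms]]] by blast
  then show ?thesis using that W_eqI by (metis max.bounded_iff adequate_def)
qed

lemma fg_letters_W: "fg_letters (W p) \<subseteq> {1..n}"
  unfolding W_def wsum_def by (rule fg_letters_csum)

text \<open>The join runs through each half at double speed, so its first \<open>N\<close> steps at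
  scale \<open>N + N\<close> are those of \<open>p\<close> at scale \<open>N\<close>, and the
  remaining ones are those of \<open>q\<close>.\<close>

lemma W_join:
  assumes "path p" "path_image p \<inter> K = {}" "path q" "path_image q \<inter> K = {}"
    "pathfinish p = pathstart q"
  shows "W (p +++ q) = W p + W q"
proof -
  have pq: "path (p +++ q)" "path_image (p +++ q) \<inter> K = {}"
    using assms by (auto simp: path_image_join)
  obtain N0 where N0: "\<And>N. N \<ge> N0 \<Longrightarrow> adequate p N \<and> adequate q N \<and> adequate (p +++ q) N"
    using eventually_conj[OF eventually_adequate[OF assms(1,2)]
        eventually_conj[OF eventually_adequate[OF assms(3,4)] eventually_adequate[OF pq]]]
    unfolding eventually_sequentially by blast
  define N where "N = max 1 N0"
  have N: "N > 0" "adequate p N" "adequate q N" "adequate (p +++ q) (N + N)"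
    using N0[of N] N0[of "N + N"] by (auto simp: N_def)
  let ?f = "\<lambda>j. (p +++ q) (real j / real (N + N))"
  have 1: "csum ?f 0 N = csum (\<lambda>j. p (real j / N)) 0 N"
  proof (rule csum_cong)
    fix j assume "j \<le> N"
    then have "real j / real (N + N) \<le> 1 / 2" "2 * (real j / real (N + N)) = real j / N"
      using N(1) by (auto simp: field_simps)
    then show "?f j = p (real j / N)" by (simp add: joinpaths_def)
  qed
  have 2: "csum ?f N (N + N) = csum (\<lambda>j. q (real j / N)) 0 N"
  proof -
    have "csum ?f N (N + N) = csum (\<lambda>j. ?f (j + N)) 0 N"
      by (rule csum_shift)
    also have "\<dots> = csum (\<lambda>j. q (real j / N)) 0 N"
    proof (rule csum_cong)
      fix j assume "j \<le> N"
      have *: "2 * (real (j + N) / real (N + N)) = real j / N + 1"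
        using N(1) by (simp add: field_simps)
      show "?f (j + N) = q (real j / N)"
      \<comment> \<open>At time 1/2 the join takes its value from \<open>p\<close>, so the first
        sample of \<open>q\<close> is reached only through the common end point.\<close>
      proof (cases "j = 0")
        case True
        then show ?thesis using * assms(5) by (simp add: joinpaths_def pathfinish_def pathstart_def)
      next
        case False
        then have "real j / N > 0" using N(1) by simp
        then have "\<not> real (j + N) / real (N + N) \<le> 1 / 2" using * by linarith
        then show ?thesis using * unfolding joinpaths_def by (simp only: if_False) simp
      qed
    qed
    finally show ?thesis by simp
  qed
  have "W (p +++ q) = wsum (p +++ q) (N + N)" "W p = wsum p N" "W q = wsum q N"
    using N W_eqI by auto
  then show ?thesis
    using csum_add[of 0 N "N + N" ?f] 1 2 by (simp add: wsum_def)
qed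

text \<open>A ladder argument. For close \<open>s\<close> and \<open>s'\<close> every square between
  the sampled paths lies in a ball where crossings form a cocycle, so the sum can be moved across
  one rung after another; the first and the last rung are trivial because the end points are fixed.
  Connectedness of the interval spreads the local equality.\<close>

lemma W_homotopic:
  assumes "homotopic_paths X p q"
  shows "W p = W q"
proof -
  obtain h where h: "continuous_on ({0..1} \<times> {0..1}) h" "h \<in> ({0..1} \<times> {0..1}) \<rightarrow> X"
    "\<And>x. x \<in> {0..1} \<Longrightarrow> h (0, x) = p x" "\<And>x. x \<in> {0..1} \<Longrightarrow> h (1, x) = q x"
    "\<And>s. s \<in> {0..1::real} \<Longrightarrow> pathstart (h \<circ> Pair s) = pathstart p \<and> pathfinish (h \<circ> Pair s) = pathfinish p"
    using assms unfolding homotopic_paths by blast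
  let ?I = "{0..1::real}"
  have "compact (h ` (?I \<times> ?I))"
    using h(1) by (intro compact_continuous_image compact_Times) auto
  moreover have "h ` (?I \<times> ?I) \<inter> K = {}" using h(2) by auto
  ultimately obtain d where d: "d > 0"
    "\<And>z x y w. \<lbrakk>z \<in> h ` (?I \<times> ?I); x \<in> ball z d; y \<in> ball z d; w \<in> ball z d\<rbrakk>
       \<Longrightarrow> crossing x y + crossing y w = crossing x w"
    using crossing_lebesgue by blast
  have "uniformly_continuous_on (?I \<times> ?I) h"
    using h(1) by (intro compact_uniformly_continuous compact_Times) auto
  then obtain r where r: "r > 0"
    "\<And>x y. \<lbrakk>x \<in> ?I \<times> ?I; y \<in> ?I \<times> ?I; dist y x < r\<rbrakk> \<Longrightarrow> dist (h y) (h x) < d"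
    unfolding uniformly_continuous_on_def using d(1) by metis
  have r2: "h (s', x') \<in> ball (h (s, x)) d"
    if "s \<in> ?I" "s' \<in> ?I" "x \<in> ?I" "x' \<in> ?I" "\<bar>s' - s\<bar> < r / 2" "\<bar>x' - x\<bar> < r / 2" for s s' x x'
  proof -
    have "dist (s', x') (s, x) \<le> \<bar>s' - s\<bar> + \<bar>x' - x\<bar>"
      unfolding dist_Pair_Pair dist_real_def by (intro order_trans[OF sqrt_sum_squares_le_sum_abs]) simp
    then show ?thesis using r(2)[of "(s, x)" "(s', x')"] that by (simp add: dist_commute)
  qed
  have hp: "path (h \<circ> Pair s)" "path_image (h \<circ> Pair s) \<inter> K = {}" if "s \<in> ?I" for s
  proof -
    show "path (h \<circ> Pair s)"
      unfolding path_def by (rule continuous_on_o_Pair[OF h(1) that])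
    show "path_image (h \<circ> Pair s) \<inter> K = {}"
      using h(2) that by (auto simp: path_image_def)
  qed
  have loc: "W (h \<circ> Pair s) = W (h \<circ> Pair s')" if s: "s \<in> ?I" "s' \<in> ?I" "\<bar>s' - s\<bar> < r / 2" for s s'
  proof -
    let ?p = "h \<circ> Pair s" and ?q = "h \<circ> Pair s'"
    obtain M :: nat where M: "2 / r < M" using reals_Archimedean2 by blast
    obtain N where N: "N \<ge> max M 1" "adequate ?p N" "adequate ?q N"
      using eventually_happens'[OF sequentially_bot eventually_conj[OF eventually_ge_at_top[of "max M 1"]
            eventually_conj[OF eventually_adequate[OF hp[OF s(1)]] eventually_adequate[OF hp[OF s(2)]]]]]
      by blast
    have N1: "N > 0" "1 / N < r / 2"
    proof -
      show "N > 0" using N by simp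
      have "2 / r < N" using M N by linarith
      then show "1 / N < r / 2" using r(1) \<open>N > 0\<close> by (simp add: field_simps)
    qed
    let ?f = "\<lambda>j. ?p (real j / N)" and ?g = "\<lambda>j. ?q (real j / N)"
    have ends: "?f 0 = ?g 0" "?f N = ?g N"
      using h(5)[OF s(1)] h(5)[OF s(2)] N1 by (simp_all add: pathstart_def pathfinish_def)
    have "csum ?f 0 m + crossing (?f m) (?g m) = csum ?g 0 m" if "m \<le> N" for m
      using that
    proof (induction m)
      case 0
      have "crossing (?f 0) (?g 0) = 0" using ends(1) by (metis crossing_refl)
      then show ?case by (simp only: csum_same add_0_right)
    next
      case (Suc m)
      have I: "real m / N \<in> ?I" "real (Suc m) / N \<in> ?I" using Suc.prems N1 by auto
      have dd: "\<bar>real (Suc m) / N - real m / N\<bar> < r / 2" "\<bar>real m / N - real m / N\<bar> < r / 2" "\<bar>s - s\<bar> < r / 2"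
        using N1 r(1) by (simp_all add: diff_divide_distrib[symmetric])
      have b: "?f m \<in> ball (?f m) d" "?f (Suc m) \<in> ball (?f m) d" "?g m \<in> ball (?f m) d"
        "?g (Suc m) \<in> ball (?f m) d"
        unfolding o_def using r2[OF s(1) s(1) I(1) I(1) dd(3) dd(2)] r2[OF s(1) s(1) I dd(3) dd(1)]
          r2[OF s(1) s(2) I(1) I(1) s(3) dd(2)] r2[OF s(1) s(2) I s(3) dd(1)] by blast+
      have im: "?f m \<in> h ` (?I \<times> ?I)" using I s by auto
      have "csum ?f 0 (Suc m) + crossing (?f (Suc m)) (?g (Suc m)) =
          csum ?f 0 m + (crossing (?f m) (?f (Suc m)) + crossing (?f (Suc m)) (?g (Suc m)))"
        by (simp only: csum_Suc[of 0 m] le0 add.assoc)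
      also have "crossing (?f m) (?f (Suc m)) + crossing (?f (Suc m)) (?g (Suc m)) = crossing (?f m) (?g (Suc m))"
        by (rule d(2)[OF im b(1,2,4)])
      also have "\<dots> = crossing (?f m) (?g m) + crossing (?g m) (?g (Suc m))"
        by (rule d(2)[OF im b(1,3,4), symmetric])
      also have "csum ?f 0 m + \<dots> = csum ?g 0 m + crossing (?g m) (?g (Suc m))"
        using Suc by (simp only: add.assoc[symmetric])
      also have "\<dots> = csum ?g 0 (Suc m)"
        by (simp only: csum_Suc[of 0 m] le0)
      finally show ?case .
    qed
    from this[of N] have "wsum ?p N + crossing (?f N) (?g N) = wsum ?q N"
      by (simp only: wsum_def)
    moreover have "crossing (?f N) (?g N) = 0" using ends(2) by (metis crossing_refl)
    ultimately have "wsum ?p N = wsum ?q N" by (simp only: add_0_right)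
    then show ?thesis using W_eqI N by metis
  qed
  have "W (h \<circ> Pair 0) = W (h \<circ> Pair 1)"
  proof (rule connected_equivalence_relation[where S = ?I and R = "\<lambda>a b. W (h \<circ> Pair a) = W (h \<circ> Pair b)"])
    show "\<exists>T. openin (top_of_set ?I) T \<and> a \<in> T \<and> (\<forall>x\<in>T. W (h \<circ> Pair a) = W (h \<circ> Pair x))"
      if "a \<in> ?I" for a
    proof (intro exI conjI)
      show "openin (top_of_set ?I) (?I \<inter> ball a (r / 2))" by (simp add: openin_open_Int)
      show "a \<in> ?I \<inter> ball a (r / 2)" using that r(1) by simp
      show "\<forall>x\<in>?I \<inter> ball a (r / 2). W (h \<circ> Pair a) = W (h \<circ> Pair x)"
        using loc[OF that] by (auto simp: dist_real_def abs_minus_commute)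
    qed
  qed auto
  moreover have "W (h \<circ> Pair 0) = W p" "W (h \<circ> Pair 1) = W q"
  proof -
    \<comment> \<open>The homotopy agrees with \<open>p\<close> and \<open>q\<close> on the unit
      interval only, so it must be checked that \<open>W\<close> ignores all other values.\<close>
    have cong: "W p = W q" if pp: "path p" "path_image p \<inter> K = {}" "\<And>x. x \<in> ?I \<Longrightarrow> p x = q x" for p q
    proof -
      have q: "path q" "path_image q \<inter> K = {}"
        using pp continuous_on_eq[of ?I p q] unfolding path_def path_image_def by (blast, force)
      obtain N where N: "N > 0" "adequate p N" "adequate q N"
        using eventually_happens'[OF sequentially_bot eventually_conj[OF eventually_gt_at_top[of 0]
            eventually_conj[OF eventually_adequate[OF pp(1,2)] eventually_adequate[OF q]]]] by blast
      have "wsum p N = wsum q N"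
        unfolding wsum_def by (intro csum_cong pp(3)) (use N in auto)
      then show ?thesis using W_eqI N by metis
    qed
    show "W (h \<circ> Pair 0) = W p" using cong hp[of 0] h(3) by simp
    show "W (h \<circ> Pair 1) = W q" using cong hp[of 1] h(4) by simp
  qed
  ultimately show ?thesis by simp
qed

lemma W_const [simp]: "W (linepath x x) = 0"
  unfolding W_def wsum_def by (rule csum_zero) (simp add: linepath_refl)

lemma W_reversepath:
  assumes "path p" "path_image p \<subseteq> X"
  shows "W (reversepath p) = - W p"
proof -
  have "W (p +++ reversepath p) = 0"
    using W_homotopic[OF homotopic_paths_rinv[OF assms]] by simp
  moreover have "W (p +++ reversepath p) = W p + W (reversepath p)"
    using assms by (intro W_join) auto
  ultimately show ?thesis by (metis minus_unique)
qed

lemma W_lower: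
  assumes "\<And>z. z \<in> path_image p \<Longrightarrow> Im z \<le> 0"
  shows "W p = 0"
proof (cases "\<exists>N. adequate p N")
  case True
  then obtain N where N: "adequate p N" by blast
  have "wsum p N = 0"
    unfolding wsum_def
  proof (rule csum_zero)
    fix j assume "0 \<le> j" "j < N"
    then have "p (real j / N) \<in> path_image p" "p (real (Suc j) / N) \<in> path_image p"
      by (auto simp: path_image_def intro!: imageI)
    then show "crossing (p (real j / N)) (p (real (Suc j) / N)) = 0"
      using assms by (simp add: crossing_def)
  qed
  then show ?thesis using W_eqI[OF N] by simp
next
  case False
  \<comment> \<open>Without an adequate scale, \<open>W p\<close> is the sum at an arbitrary
    \<open>N\<close>, and it vanishes for the same reason.\<close>
  define N where "N = (SOME N. adequate p N)"
  have "wsum p N = 0"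
    unfolding wsum_def
  proof (rule csum_zero)
    fix j assume "0 \<le> j" "j < N"
    then have "p (real j / N) \<in> path_image p" "p (real (Suc j) / N) \<in> path_image p"
      by (auto simp: path_image_def intro!: imageI)
    then show "crossing (p (real j / N)) (p (real (Suc j) / N)) = 0"
      using assms by (simp add: crossing_def)
  qed
  then show ?thesis by (simp add: W_def N_def)
qed

text \<open>Only the first sampling step can cross the axis, since every later sample is strictly
  above it.\<close>

lemma W_upper_open:
  assumes "\<And>x. 0 < x \<Longrightarrow> x \<le> 1 \<Longrightarrow> Im (p x) > 0"
    "path p" "path_image p \<inter> K = {}"
  shows "W p = (if Im (pathstart p) \<le> 0 then stair (idx (pathstart p)) else 0)"
proof -
  obtain N where N: "N > 0" "W p = wsum p N"
    using W_obtain[OF assms(2,3)] by blast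
  let ?f = "\<lambda>j. p (real j / N)"
  have "csum ?f 0 N = csum ?f 0 1 + csum ?f 1 N"
    using N by (intro csum_add[symmetric]) auto
  moreover have "csum ?f 1 N = 0"
  proof (rule csum_zero)
    fix j assume "1 \<le> j" "j < N"
    then have "Im (?f j) > 0" "Im (?f (Suc j)) > 0" by (auto intro!: assms(1))
    then show "crossing (?f j) (?f (Suc j)) = 0" by (simp add: crossing_def)
  qed
  moreover have "csum ?f 0 1 = crossing (?f 0) (?f 1)" by (simp add: csum_def)
  moreover have "Im (?f 1) > 0" using N by (intro assms(1)) auto
  ultimately show ?thesis using N by (simp add: wsum_def crossing_def pathstart_def)
qed

end

section \<open>Paths with equal crossing words are homotopic\<close>

definition path_between :: "'a::real_normed_vector set \<Rightarrow> 'a \<Rightarrow> 'a \<Rightarrow> (real \<Rightarrow> 'a) \<Rightarrow> bool" where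
  "path_between S a b p \<longleftrightarrow> path p \<and> path_image p \<subseteq> S \<and> pathstart p = a \<and> pathfinish p = b"

lemma path_between_join [intro]:
  "path_between S a b p \<Longrightarrow> path_between S b c q \<Longrightarrow> path_between S a c (p +++ q)"
  by (auto simp: path_between_def path_image_join)

lemma path_between_reversepath [intro]:
  "path_between S a b p \<Longrightarrow> path_between S b a (reversepath p)"
  by (auto simp: path_between_def)

lemma path_between_linepath [intro]:
  "closed_segment a b \<subseteq> S \<Longrightarrow> path_between S a b (linepath a b)"
  by (auto simp: path_between_def)

lemma path_between_const: "a \<in> S \<Longrightarrow> path_between S a a (linepath a a)"
  by (auto simp: path_between_def)

lemma path_between_mono: "path_between S a b p \<Longrightarrow> S \<subseteq> T \<Longrightarrow> path_between T a b p"
  by (auto simp: path_between_def)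

lemma path_between_homotopic: "homotopic_paths S p q \<Longrightarrow> path_between S a b p \<Longrightarrow> path_between S a b q"
  using homotopic_paths_imp_path homotopic_paths_imp_subset homotopic_paths_imp_pathstart
    homotopic_paths_imp_pathfinish unfolding path_between_def by metis

lemma path_between_start: "path_between S a b p \<Longrightarrow> a \<in> S"
  unfolding path_between_def using pathstart_in_path_image by blast

lemma path_between_finish: "path_between S a b p \<Longrightarrow> b \<in> S"
  unfolding path_between_def using pathfinish_in_path_image by blast

lemma path_between_image:
  assumes "path_between S a b p" "continuous_on S f" "f ` S \<subseteq> T"
  shows "path_between T (f a) (f b) (f \<circ> p)"
  using assms unfolding path_between_def
  by (auto simp: path_image_compose pathstart_compose pathfinish_compose
      intro!: path_continuous_image intro: continuous_on_subset)

lemma hp_refl: "path_between S a b p \<Longrightarrow> homotopic_paths S p p"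
  by (simp add: path_between_def)

lemma hp_join:
  "homotopic_paths S p p' \<Longrightarrow> homotopic_paths S q q' \<Longrightarrow> path_between S a b p \<Longrightarrow> path_between S b c q
    \<Longrightarrow> homotopic_paths S (p +++ q) (p' +++ q')"
  by (rule homotopic_paths_join) (auto simp: path_between_def)

lemma hp_join_left:
  "homotopic_paths S p p' \<Longrightarrow> path_between S a b p \<Longrightarrow> path_between S b c q
    \<Longrightarrow> homotopic_paths S (p +++ q) (p' +++ q)"
  by (rule homotopic_paths_join) (auto simp: path_between_def)

lemma hp_join_right:
  "homotopic_paths S q q' \<Longrightarrow> path_between S a b p \<Longrightarrow> path_between S b c q
    \<Longrightarrow> homotopic_paths S (p +++ q) (p +++ q')"
  by (rule homotopic_paths_join) (auto simp: path_between_def)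

lemma hp_assoc:
  "path_between S a b p \<Longrightarrow> path_between S b c q \<Longrightarrow> path_between S c d r
    \<Longrightarrow> homotopic_paths S ((p +++ q) +++ r) (p +++ (q +++ r))"
  by (rule homotopic_paths_sym, rule homotopic_paths_assoc) (auto simp: path_between_def)

lemma hp_lid: "path_between S a b p \<Longrightarrow> homotopic_paths S (linepath a a +++ p) p"
  by (rule homotopic_paths_lid') (auto simp: path_between_def)

lemma hp_rid: "path_between S a b p \<Longrightarrow> homotopic_paths S (p +++ linepath b b) p"
  by (rule homotopic_paths_rid') (auto simp: path_between_def)

lemma hp_rinv: "path_between S a b p \<Longrightarrow> homotopic_paths S (p +++ reversepath p) (linepath a a)"
  using homotopic_paths_rinv[of p S] by (auto simp: path_between_def)

lemma hp_linv: "path_between S a b p \<Longrightarrow> homotopic_paths S (reversepath p +++ p) (linepath b b)"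
  using homotopic_paths_linv[of p S] by (auto simp: path_between_def)

lemma hp_cancel_left:
  assumes "path_between S a b t" "path_between S b c q"
  shows "homotopic_paths S (reversepath t +++ (t +++ q)) q"
proof -
  have "homotopic_paths S (reversepath t +++ (t +++ q)) ((reversepath t +++ t) +++ q)"
    using assms by (intro homotopic_paths_sym[OF hp_assoc]) auto
  also have "homotopic_paths S \<dots> (linepath b b +++ q)"
    using assms by (intro hp_join_left[OF hp_linv]) auto
  also have "homotopic_paths S \<dots> q" using assms(2) by (rule hp_lid)
  finally show ?thesis .
qed

lemma hp_cancel_right:
  assumes "path_between S a b p" "path_between S b c t"
  shows "homotopic_paths S ((p +++ t) +++ reversepath t) p"
proof -
  have "homotopic_paths S ((p +++ t) +++ reversepath t) (p +++ (t +++ reversepath t))"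
    using assms by (intro hp_assoc) auto
  also have "homotopic_paths S \<dots> (p +++ linepath b b)"
    using assms by (intro hp_join_right[OF hp_rinv]) auto
  also have "homotopic_paths S \<dots> p" using assms(1) by (rule hp_rid)
  finally show ?thesis .
qed

lemma homotopy_class_eq_iff:
  assumes "path_between S a b p"
  shows "homotopy_class S p = homotopy_class S q \<longleftrightarrow> homotopic_paths S p q"
proof
  assume "homotopy_class S p = homotopy_class S q"
  moreover have "p \<in> homotopy_class S p" using hp_refl[OF assms] by (simp add: homotopy_class_def)
  ultimately show "homotopic_paths S p q" by (simp add: homotopy_class_def homotopic_paths_sym_eq)
next
  assume "homotopic_paths S p q"
  then show "homotopy_class S p = homotopy_class S q"
    unfolding homotopy_class_def
    by (intro Collect_cong iffI) (meson homotopic_paths_sym homotopic_paths_trans)+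
qed

lemma loops_at_iff: "p \<in> loops_at S b \<longleftrightarrow> path_between S b b p"
  by (auto simp: loops_at_def path_between_def)

text \<open>The product is defined as a union over all pairs of representatives. Joins respect
  homotopy, so all the sets in this union coincide.\<close>

lemma fundamental_group_mult:
  assumes "path_between S b b p" "path_between S b b q"
  shows "homotopy_class S p \<otimes>\<^bsub>fundamental_group S b\<^esub> homotopy_class S q = homotopy_class S (p +++ q)"
proof -
  have "homotopy_class S (p' +++ q') = homotopy_class S (p +++ q)"
    if "p' \<in> homotopy_class S p" "q' \<in> homotopy_class S q" for p' q'
  proof -
    have "homotopic_paths S (p +++ q) (p' +++ q')"
      using that assms by (intro hp_join[of _ _ _ _ _ b b b]) (auto simp: homotopy_class_def)
    then show ?thesis
      using homotopy_class_eq_iff[of S b b "p +++ q"] assms by blast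
  qed
  moreover have "p \<in> homotopy_class S p" "q \<in> homotopy_class S q"
    using assms by (auto simp: homotopy_class_def path_between_def)
  ultimately have "(\<Union>p'\<in>homotopy_class S p. \<Union>q'\<in>homotopy_class S q. homotopy_class S (p' +++ q')) =
      homotopy_class S (p +++ q)"
    by blast
  then show ?thesis
    unfolding fundamental_group_def by simp
qed

lemma fundamental_group_one: "\<one>\<^bsub>fundamental_group S b\<^esub> = homotopy_class S (linepath b b)"
  by (simp add: fundamental_group_def linepath_refl)

lemma fundamental_group_carrier:
  "x \<in> carrier (fundamental_group S b) \<longleftrightarrow> (\<exists>p. path_between S b b p \<and> x = homotopy_class S p)"
  by (auto simp: fundamental_group_def loops_at_iff)

lemma fundamental_group_carrierE:
  assumes "x \<in> carrier (fundamental_group S b)"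
  obtains p where "path_between S b b p" "x = homotopy_class S p"
  using assms unfolding fundamental_group_carrier by metis

lemma fundamental_group_carrierI:
  "path_between S b b p \<Longrightarrow> homotopy_class S p \<in> carrier (fundamental_group S b)"
  unfolding fundamental_group_carrier by metis

lemma group_fundamental_group:
  assumes "b \<in> S"
  shows "group (fundamental_group S b)"
proof (rule groupI)
  have l: "path_between S b b (linepath b b)" using assms by (rule path_between_const)
  show "\<one>\<^bsub>fundamental_group S b\<^esub> \<in> carrier (fundamental_group S b)"
    unfolding fundamental_group_one using l by (rule fundamental_group_carrierI)
  show "x \<otimes>\<^bsub>fundamental_group S b\<^esub> y \<in> carrier (fundamental_group S b)"
    if "x \<in> carrier (fundamental_group S b)" "y \<in> carrier (fundamental_group S b)" for x y
    using that by (elim fundamental_group_carrierE)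
      (simp add: fundamental_group_mult fundamental_group_carrierI path_between_join)
  show "x \<otimes>\<^bsub>fundamental_group S b\<^esub> y \<otimes>\<^bsub>fundamental_group S b\<^esub> z = x \<otimes>\<^bsub>fundamental_group S b\<^esub> (y \<otimes>\<^bsub>fundamental_group S b\<^esub> z)"
    if x: "x \<in> carrier (fundamental_group S b)" and y: "y \<in> carrier (fundamental_group S b)"
      and z: "z \<in> carrier (fundamental_group S b)" for x y z
  proof -
    obtain p where p: "path_between S b b p" "x = homotopy_class S p"
      by (rule fundamental_group_carrierE[OF x])
    obtain q where q: "path_between S b b q" "y = homotopy_class S q"
      by (rule fundamental_group_carrierE[OF y])
    obtain r where r: "path_between S b b r" "z = homotopy_class S r"
      by (rule fundamental_group_carrierE[OF z])
    have "homotopic_paths S ((p +++ q) +++ r) (p +++ (q +++ r))"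
      using p(1) q(1) r(1) by (rule hp_assoc)
    then have "homotopy_class S ((p +++ q) +++ r) = homotopy_class S (p +++ (q +++ r))"
      using homotopy_class_eq_iff[OF path_between_join[OF path_between_join[OF p(1) q(1)] r(1)]] by blast
    then show ?thesis
      using p q r by (simp add: fundamental_group_mult path_between_join)
  qed
  show "\<one>\<^bsub>fundamental_group S b\<^esub> \<otimes>\<^bsub>fundamental_group S b\<^esub> x = x"
    if x: "x \<in> carrier (fundamental_group S b)" for x
  proof -
    obtain p where p: "path_between S b b p" "x = homotopy_class S p"
      by (rule fundamental_group_carrierE[OF x])
    have "homotopy_class S (linepath b b +++ p) = homotopy_class S p"
      using homotopy_class_eq_iff[OF path_between_join[OF l p(1)]] hp_lid[OF p(1)] by blast
    then show ?thesis
      using p l by (simp add: fundamental_group_one fundamental_group_mult)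
  qed
  show "\<exists>y\<in>carrier (fundamental_group S b). y \<otimes>\<^bsub>fundamental_group S b\<^esub> x = \<one>\<^bsub>fundamental_group S b\<^esub>"
    if x: "x \<in> carrier (fundamental_group S b)" for x
  proof -
    obtain p where p: "path_between S b b p" "x = homotopy_class S p"
      by (rule fundamental_group_carrierE[OF x])
    have "homotopy_class S (reversepath p +++ p) = homotopy_class S (linepath b b)"
      using homotopy_class_eq_iff[OF path_between_join[OF path_between_reversepath[OF p(1)] p(1)]]
        hp_linv[OF p(1)] by blast
    then have "homotopy_class S (reversepath p) \<otimes>\<^bsub>fundamental_group S b\<^esub> x = \<one>\<^bsub>fundamental_group S b\<^esub>"
      unfolding fundamental_group_one p(2)
      using fundamental_group_mult[OF path_between_reversepath[OF p(1)] p(1)] by simp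
    then show ?thesis
      using fundamental_group_carrierI[OF path_between_reversepath[OF p(1)]] by blast
  qed
qed

text \<open>The counterpart of \<open>fg_eval\<close> for groups given by a carrier set, such as the
  fundamental group, which is no instance of \<open>group_add\<close>.\<close>

definition (in group) word_eval :: "('g \<Rightarrow> 'a) \<Rightarrow> 'g gen_word \<Rightarrow> 'a" where
  "word_eval f w = foldr (\<lambda>(g, e) a. (if e then f g else inv (f g)) \<otimes> a) w \<one>"

context group
begin

context
  fixes f :: "'g \<Rightarrow> 'a"
  assumes f: "\<And>g. f g \<in> carrier G"
begin

lemma word_eval_Nil [simp]: "word_eval f [] = \<one>"
  by (simp add: word_eval_def)

lemma word_eval_Cons: "word_eval f ((g, e) # w) = (if e then f g else inv (f g)) \<otimes> word_eval f w"
  by (simp add: word_eval_def)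

lemma word_eval_closed [simp]: "word_eval f w \<in> carrier G"
  by (induction w) (auto simp: word_eval_Cons f)

lemma word_eval_append: "word_eval f (u @ v) = word_eval f u \<otimes> word_eval f v"
  by (induction u) (auto simp: word_eval_Cons f m_assoc)

lemma word_eval_cancel_Cons: "word_eval f (cancel_Cons x w) = word_eval f (x # w)"
  by (cases x; cases w) (auto simp: word_eval_Cons f m_assoc[symmetric])

lemma word_eval_free_reduce: "word_eval f (free_reduce w) = word_eval f w"
proof (induction w)
  case (Cons x w)
  have "word_eval f (free_reduce (x # w)) = word_eval f (x # free_reduce w)"
    unfolding word_eval_cancel_Cons[symmetric] by (simp add: free_reduce_def)
  then show ?case using Cons by (cases x) (simp add: word_eval_Cons)
qed (simp add: free_reduce_def)

lemma word_eval_add: "word_eval f (fg_word (x + y)) = word_eval f (fg_word x) \<otimes> word_eval f (fg_word y)"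
  by (simp add: plus_fgroup_def word_eval_free_reduce word_eval_append)

lemma word_eval_zero: "word_eval f (fg_word 0) = \<one>"
  by (simp add: zero_fgroup_def word_eval_free_reduce del: fg_class_Nil)

lemma word_eval_minus: "word_eval f (fg_word (- x)) = inv (word_eval f (fg_word x))"
proof -
  have "word_eval f (fg_word (- x)) \<otimes> word_eval f (fg_word x) = \<one>"
    by (simp add: word_eval_add[symmetric] word_eval_zero)
  then show ?thesis by (metis inv_equality word_eval_closed)
qed

lemma word_eval_gen: "word_eval f (fg_word (fg_gen g)) = f g"
  by (simp add: fg_gen_def word_eval_free_reduce word_eval_Cons f)

end

end

section \<open>Starlike pieces of the punctured domain\<close>

context slit
begin

text \<open>A sample point in each gap of the axis; gap 0 lies left of all punctures and gap
  \<open>n\<close> right of them.\<close>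

definition mid :: "nat \<Rightarrow> complex" where
  "mid a = (if a = 0 then lp else if a = n then rp else midpoint (k a) (k (Suc a)))"

lemma k_less: "i \<in> {1..n} \<Longrightarrow> j \<in> {1..n} \<Longrightarrow> i < j \<Longrightarrow> Re (k i) < Re (k j)"
  using k_mono by (auto simp: strict_mono_on_def)

lemma k_le: "i \<in> {1..n} \<Longrightarrow> j \<in> {1..n} \<Longrightarrow> i \<le> j \<Longrightarrow> Re (k i) \<le> Re (k j)"
  using k_less[of i j] by (cases "i = j") auto

lemma idxI:
  assumes "a \<le> n" "\<And>i. i \<in> {1..a} \<Longrightarrow> Re (k i) < Re z" "\<And>i. i \<in> {Suc a..n} \<Longrightarrow> Re z \<le> Re (k i)"
  shows "idx z = a"
proof -
  have "{i \<in> {1..n}. Re (k i) < Re z} = {1..a}"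
    using assms by (auto simp: not_le[symmetric]) (metis Suc_leI atLeastAtMost_iff not_le)+
  then show ?thesis by (simp add: idx_def)
qed

lemma Im_mid: "a \<le> n \<Longrightarrow> Im (mid a) = 0"
  using lp rp k_in(2)[of a] k_in(2)[of "Suc a"] by (auto simp: mid_def midpoint_def)

lemma mid_between:
  assumes "a \<le> n"
  shows "i \<in> {1..a} \<Longrightarrow> Re (k i) < Re (mid a)" "i \<in> {Suc a..n} \<Longrightarrow> Re (mid a) < Re (k i)"
proof -
  have m: "Re (mid a) = (Re (k a) + Re (k (Suc a))) / 2" "Re (k a) < Re (k (Suc a))"
    if "a \<noteq> 0" "a \<noteq> n"
    using that assms k_less[of a "Suc a"] by (auto simp: mid_def midpoint_def)
  show "Re (k i) < Re (mid a)" if i: "i \<in> {1..a}"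
  proof (cases "a = n")
    case True
    then show ?thesis using rp(3)[of i] i by (simp add: mid_def)
  next
    case False
    then have "Re (k i) \<le> Re (k a)" using i assms by (intro k_le) auto
    then show ?thesis using m False i by simp
  qed
  show "Re (mid a) < Re (k i)" if i: "i \<in> {Suc a..n}"
  proof (cases "a = 0")
    case True
    then show ?thesis using lp(3)[of i] i by (simp add: mid_def)
  next
    case False
    then have "Re (k (Suc a)) \<le> Re (k i)" using i assms by (intro k_le) auto
    then show ?thesis using m False i by auto
  qed
qed

lemma idx_mid: "a \<le> n \<Longrightarrow> idx (mid a) = a"
  by (rule idxI) (simp_all only: mid_between less_imp_le)

lemma mid_in_X:
  assumes "a \<le> n"
  shows "mid a \<in> X"
proof -
  have "mid a \<in> D"
    using assms lp rp convexD_alt[OF convex_D k_in(1) k_in(1), of a "Suc a" "1/2"]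
    by (auto simp: mid_def midpoint_def scaleR_add_right)
  moreover have "mid a \<noteq> k i" if "i \<in> {1..n}" for i
    using mid_between[OF assms, of i] that by (cases "i \<le> a") auto
  ultimately show ?thesis by blast
qed

lemma Im_K: "z \<in> K \<Longrightarrow> Im z = 0"
  using k_in(2) by auto

lemma bp_in_X: "bp \<in> X" and tp_in_X: "tp \<in> X"
  using bp tp Im_K by auto

lemma lp_in_X: "lp \<in> X"
  using lp by fastforce

text \<open>Since \<open>x\<close> lies strictly below the axis, the segment can touch the axis only
  at its end \<open>y\<close>, which is no puncture.\<close>

lemma segment_lower:
  assumes "x \<in> D" "y \<in> X" "Im x < 0" "Im y \<le> 0"
  shows "closed_segment x y \<subseteq> X \<inter> {z. Im z \<le> 0}"
proof
  fix z assume z: "z \<in> closed_segment x y"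
  then obtain s where s: "z = (1 - s) *\<^sub>R x + s *\<^sub>R y" "0 \<le> s" "s \<le> 1"
    by (auto simp: closed_segment_def)
  have "z \<in> D" using z assms convex_D by (meson DiffE closed_segment_subset subsetD)
  moreover have "Im z \<le> 0" using s assms by (simp add: mult_nonneg_nonpos add_nonpos_nonpos)
  moreover have "z \<notin> K"
  proof
    assume "z \<in> K"
    then have "(1 - s) * Im x + s * Im y = 0" using Im_K[of z] s by simp
    moreover have "(1 - s) * Im x \<le> 0" "s * Im y \<le> 0"
      using s assms by (simp_all add: mult_nonneg_nonpos)
    ultimately have "(1 - s) * Im x = 0" by linarith
    then show False using assms s \<open>z \<in> K\<close> by auto
  qed
  ultimately show "z \<in> X \<inter> {z. Im z \<le> 0}" by blast
qed

lemma segment_upper: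
  assumes "x \<in> D" "y \<in> X" "Im x > 0" "Im y \<ge> 0"
  shows "closed_segment x y \<subseteq> X \<inter> {z. Im z \<ge> 0}"
proof
  fix z assume z: "z \<in> closed_segment x y"
  then obtain s where s: "z = (1 - s) *\<^sub>R x + s *\<^sub>R y" "0 \<le> s" "s \<le> 1"
    by (auto simp: closed_segment_def)
  have "z \<in> D" using z assms convex_D by (meson DiffE closed_segment_subset subsetD)
  moreover have "Im z \<ge> 0" using s assms by simp
  moreover have "z \<notin> K"
  proof
    assume "z \<in> K"
    then have "(1 - s) * Im x + s * Im y = 0" using Im_K[of z] s by simp
    moreover have "(1 - s) * Im x \<ge> 0" "s * Im y \<ge> 0"
      using s assms by simp_all
    ultimately have "(1 - s) * Im x = 0" by linarith
    then show False using assms s \<open>z \<in> K\<close> by auto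
  qed
  ultimately show "z \<in> X \<inter> {z. Im z \<ge> 0}" by blast
qed

text \<open>A puncture between \<open>x\<close> and \<open>y\<close> would be counted by the index
  of the right one and not by that of the left one.\<close>

lemma segment_axis:
  assumes "x \<in> X" "y \<in> X" "Im x = 0" "Im y = 0" "idx x = idx y"
  shows "closed_segment x y \<subseteq> X \<inter> {z. Im z = 0}"
proof -
  have *: "closed_segment x y \<subseteq> X \<inter> {z. Im z = 0}"
    if xy: "x \<in> X" "y \<in> X" "Im x = 0" "Im y = 0" "idx x = idx y" "Re x \<le> Re y" for x y
  proof
    fix z assume z: "z \<in> closed_segment x y"
    then obtain s where s: "z = (1 - s) *\<^sub>R x + s *\<^sub>R y" "0 \<le> s" "s \<le> 1"
      by (auto simp: closed_segment_def)
    have "z \<in> D" using z xy convex_D by (meson DiffE closed_segment_subset subsetD)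
    moreover have im: "Im z = 0" using s xy by simp
    moreover have re: "Re x \<le> Re z" "Re z \<le> Re y"
    proof -
      have "Re z = Re x + s * (Re y - Re x)" unfolding s(1) by (simp add: algebra_simps)
      then show "Re x \<le> Re z" using xy s by simp
      have "Re z = Re y - (1 - s) * (Re y - Re x)" unfolding s(1) by (simp add: algebra_simps)
      then show "Re z \<le> Re y" using xy s by simp
    qed
    moreover have "z \<notin> K"
    proof
      assume "z \<in> K"
      then obtain i where i: "i \<in> {1..n}" "z = k i" by blast
      have "z \<noteq> x" "z \<noteq> y" using \<open>z \<in> K\<close> xy by auto
      then have "Re x < Re (k i)" "Re (k i) < Re y"
        using re i im xy by (auto simp: complex_eq_iff less_le)
      then have "i \<in> {j \<in> {1..n}. Re (k j) < Re y}" "i \<notin> {j \<in> {1..n}. Re (k j) < Re x}"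
        "{j \<in> {1..n}. Re (k j) < Re x} \<subseteq> {j \<in> {1..n}. Re (k j) < Re y}"
        using i xy(6) by auto
      then have "{j \<in> {1..n}. Re (k j) < Re x} \<subset> {j \<in> {1..n}. Re (k j) < Re y}"
        by blast
      then have "idx x < idx y" unfolding idx_def by (intro psubset_card_mono) auto
      then show False using xy by simp
    qed
    ultimately show "z \<in> X \<inter> {z. Im z = 0}" by blast
  qed
  show ?thesis
    using *[of x y] *[of y x] assms by (metis closed_segment_commute linear)
qed

text \<open>Segments along the axis may run into punctures, but segments from \<open>bp\<close> do
  not, so the closed lower half is starlike and hence simply connected.\<close>

lemma hp_lower:
  assumes "path_between (X \<inter> {z. Im z \<le> 0}) x y p" "path_between (X \<inter> {z. Im z \<le> 0}) x y q"
  shows "homotopic_paths X p q"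
proof -
  have "starlike (X \<inter> {z. Im z \<le> 0})"
    unfolding starlike_def using segment_lower[OF bp(1) _ bp(2)] bp bp_in_X by (intro bexI[of _ bp]) auto
  then have "homotopic_paths (X \<inter> {z. Im z \<le> 0}) p q"
    using starlike_imp_simply_connected assms unfolding simply_connected_eq_homotopic_paths path_between_def by metis
  then show ?thesis by (rule homotopic_paths_subset) auto
qed

lemma hp_upper:
  assumes "path_between (X \<inter> {z. Im z \<ge> 0}) x y p" "path_between (X \<inter> {z. Im z \<ge> 0}) x y q"
  shows "homotopic_paths X p q"
proof -
  have "starlike (X \<inter> {z. Im z \<ge> 0})"
    unfolding starlike_def using segment_upper[OF tp(1) _ tp(2)] tp tp_in_X by (intro bexI[of _ tp]) auto
  then have "homotopic_paths (X \<inter> {z. Im z \<ge> 0}) p q"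
    using starlike_imp_simply_connected assms unfolding simply_connected_eq_homotopic_paths path_between_def by metis
  then show ?thesis by (rule homotopic_paths_subset) auto
qed

lemma W_path_join:
  "path_between X a b p \<Longrightarrow> path_between X b c q \<Longrightarrow> W (p +++ q) = W p + W q"
  by (rule W_join) (auto simp: path_between_def)

lemma W_path_reverse: "path_between X a b p \<Longrightarrow> W (reversepath p) = - W p"
  by (rule W_reversepath) (auto simp: path_between_def)

lemma W_path_lower: "path_between (X \<inter> {z. Im z \<le> 0}) a b p \<Longrightarrow> W p = 0"
  by (rule W_lower) (auto simp: path_between_def)

lemma W_linepath_upper:
  assumes "x \<in> X" "y \<in> D" "Im x \<ge> 0" "Im y > 0"
  shows "W (linepath x y) = (if Im x \<le> 0 then stair (idx x) else 0)"
proof -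
  have "path_image (linepath x y) \<inter> K = {}"
    using segment_upper[OF assms(2,1,4,3)] by (auto simp: closed_segment_commute)
  moreover have "Im (linepath x y s) > 0" if "0 < s" "s \<le> 1" for s
    using that assms by (simp add: linepath_def add_nonneg_pos)
  ultimately show ?thesis
    using W_upper_open[of "linepath x y"] by simp
qed

text \<open>The path may touch the axis many times on its way. The homotopic detour through
  \<open>tp\<close> meets it at most at the two ends, and only those contribute.\<close>

lemma W_path_upper:
  assumes "path_between (X \<inter> {z. Im z \<ge> 0}) x y p"
  shows "W p = (if Im x \<le> 0 then stair (idx x) else 0) - (if Im y \<le> 0 then stair (idx y) else 0)"
proof -
  have xy: "x \<in> X" "y \<in> X" "Im x \<ge> 0" "Im y \<ge> 0"
    using path_between_start[OF assms] path_between_finish[OF assms] by auto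
  have l: "path_between (X \<inter> {z. Im z \<ge> 0}) x tp (linepath x tp)"
    "path_between (X \<inter> {z. Im z \<ge> 0}) y tp (linepath y tp)"
    using segment_upper[OF tp(1) _ tp(2)] xy by (auto simp: closed_segment_commute intro!: path_between_linepath)
  then have l': "path_between X x tp (linepath x tp)" "path_between X y tp (linepath y tp)"
    by (auto elim!: path_between_mono)
  have "homotopic_paths X p (linepath x tp +++ reversepath (linepath y tp))"
    by (rule hp_upper[OF assms path_between_join[OF l(1) path_between_reversepath[OF l(2)]]])
  then have "W p = W (linepath x tp +++ reversepath (linepath y tp))" by (rule W_homotopic)
  also have "\<dots> = W (linepath x tp) + - W (linepath y tp)"
    using W_path_join[OF l'(1) path_between_reversepath[OF l'(2)]] W_path_reverse[OF l'(2)] by simp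
  also have "\<dots> = (if Im x \<le> 0 then stair (idx x) else 0) - (if Im y \<le> 0 then stair (idx y) else 0)"
    using W_linepath_upper[OF xy(1) tp(1) xy(3) tp(2)] W_linepath_upper[OF xy(2) tp(1) xy(4) tp(2)] by simp
  finally show ?thesis .
qed

section \<open>Closing paths up to loops\<close>

abbreviation "LG \<equiv> fundamental_group X bp"

lemma group_LG: "group LG"
  by (rule group_fundamental_group[OF bp_in_X])

text \<open>Points above the axis are reached through gap 0, whose word \<open>stair 0\<close> is
  trivial; so every tether has a trivial crossing word.\<close>

definition tether :: "complex \<Rightarrow> real \<Rightarrow> complex" where
  "tether z = (if Im z \<le> 0 then linepath bp z else linepath bp lp +++ linepath lp z)"

lemma tether_lower: "z \<in> X \<Longrightarrow> Im z \<le> 0 \<Longrightarrow> path_between (X \<inter> {z. Im z \<le> 0}) bp z (tether z)"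
  unfolding tether_def using path_between_linepath[OF segment_lower[OF bp(1) _ bp(2)]] by (simp only: if_True)

lemma tether: "z \<in> X \<Longrightarrow> path_between X bp z (tether z)"
proof (cases "Im z \<le> 0")
  case True
  assume "z \<in> X"
  then show ?thesis using path_between_mono[OF tether_lower[OF _ True]] by blast
next
  case False
  assume z: "z \<in> X"
  have "path_between X bp lp (linepath bp lp)"
    using segment_lower[OF bp(1) lp_in_X bp(2)] lp by auto
  moreover have "path_between X lp z (linepath lp z)"
    using segment_upper[of z lp] z False lp lp_in_X by (auto simp: closed_segment_commute)
  ultimately show ?thesis using False by (auto simp: tether_def)
qed

text \<open>Closing up along tethers turns paths with arbitrary end points into elements of one
  group, so that a path can be cut into short pieces and treated multiplicatively.\<close>

definition tethered :: "(real \<Rightarrow> complex) \<Rightarrow> (real \<Rightarrow> complex) set" where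
  "tethered p = homotopy_class X (tether (pathstart p) +++ (p +++ reversepath (tether (pathfinish p))))"

lemma tethered_loop:
  assumes "path_between X x y p"
  shows "path_between X bp bp (tether x +++ (p +++ reversepath (tether y)))"
  by (rule path_between_join[OF tether[OF path_between_start[OF assms]]
        path_between_join[OF assms path_between_reversepath[OF tether[OF path_between_finish[OF assms]]]]])

lemma tethered_eq: "path_between X x y p \<Longrightarrow> tethered p = homotopy_class X (tether x +++ (p +++ reversepath (tether y)))"
  by (simp add: tethered_def path_between_def)

lemma tethered_closed: "path_between X x y p \<Longrightarrow> tethered p \<in> carrier LG"
  by (simp only: tethered_eq fundamental_group_carrierI tethered_loop)

lemma tethered_eq_iff:
  assumes "path_between X x y p" "path_between X x y q"
  shows "tethered p = tethered q \<longleftrightarrow> homotopic_paths X p q"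
proof -
  have t: "path_between X bp x (tether x)" "path_between X bp y (tether y)"
    by (rule tether[OF path_between_start[OF assms(1)]] tether[OF path_between_finish[OF assms(1)]]
        tether[OF path_between_finish[OF assms(2)]])+
  have red: "homotopic_paths X (reversepath (tether x) +++ ((tether x +++ (p +++ reversepath (tether y))) +++ tether y)) p"
    if p: "path_between X x y p" for p
  proof -
    have "homotopic_paths X (reversepath (tether x) +++ ((tether x +++ (p +++ reversepath (tether y))) +++ tether y))
       (reversepath (tether x) +++ (tether x +++ ((p +++ reversepath (tether y)) +++ tether y)))"
      using p t by (intro hp_join_right[OF hp_assoc]) blast+
    also have "homotopic_paths X \<dots> ((p +++ reversepath (tether y)) +++ tether y)"
      using p t by (intro hp_cancel_left) blast+
    also have "homotopic_paths X \<dots> p"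
      using hp_cancel_right[OF p path_between_reversepath[OF t(2)]] by simp
    finally show ?thesis .
  qed
  have "homotopic_paths X p q" if "homotopic_paths X (tether x +++ (p +++ reversepath (tether y)))
      (tether x +++ (q +++ reversepath (tether y)))"
  proof -
    have "homotopic_paths X (reversepath (tether x) +++ ((tether x +++ (p +++ reversepath (tether y))) +++ tether y))
     (reversepath (tether x) +++ ((tether x +++ (q +++ reversepath (tether y))) +++ tether y))"
      by (rule hp_join_right[OF hp_join_left[OF that]]) (use t assms in blast)+
    then show ?thesis using red assms by (meson homotopic_paths_sym homotopic_paths_trans)
  qed
  moreover have "homotopic_paths X (tether x +++ (p +++ reversepath (tether y)))
      (tether x +++ (q +++ reversepath (tether y)))" if "homotopic_paths X p q"
    by (rule hp_join_right[OF hp_join_left[OF that]]) (use t assms in blast)+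
  ultimately show ?thesis
    unfolding tethered_eq[OF assms(1)] tethered_eq[OF assms(2)]
      homotopy_class_eq_iff[OF tethered_loop[OF assms(1)]] by blast
qed

lemma tethered_join:
  assumes "path_between X x y p" "path_between X y z q"
  shows "tethered (p +++ q) = tethered p \<otimes>\<^bsub>LG\<^esub> tethered q"
proof -
  have t: "path_between X bp x (tether x)" "path_between X bp y (tether y)" "path_between X bp z (tether z)"
    by (rule tether[OF path_between_start[OF assms(1)]] tether[OF path_between_finish[OF assms(1)]]
        tether[OF path_between_finish[OF assms(2)]])+
  let ?x = "tether x" and ?y = "tether y" and ?z = "reversepath (tether z)"
  have "homotopic_paths X ((?x +++ (p +++ reversepath ?y)) +++ (?y +++ (q +++ ?z)))
      (?x +++ ((p +++ reversepath ?y) +++ (?y +++ (q +++ ?z))))"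
    by (rule hp_assoc) (use t assms in blast)+
  also have "homotopic_paths X \<dots> (?x +++ (p +++ (reversepath ?y +++ (?y +++ (q +++ ?z)))))"
    by (rule hp_join_right[OF hp_assoc]) (use t assms in blast)+
  also have "homotopic_paths X \<dots> (?x +++ (p +++ (q +++ ?z)))"
    by (rule hp_join_right[OF hp_join_right[OF hp_cancel_left]]) (use t assms in blast)+
  also have "homotopic_paths X \<dots> (?x +++ ((p +++ q) +++ ?z))"
    by (rule hp_join_right[OF homotopic_paths_sym[OF hp_assoc]]) (use t assms in blast)+
  finally have h: "homotopic_paths X ((?x +++ (p +++ reversepath ?y)) +++ (?y +++ (q +++ ?z)))
     (?x +++ ((p +++ q) +++ ?z))" .
  have "tethered p \<otimes>\<^bsub>LG\<^esub> tethered q = homotopy_class X ((?x +++ (p +++ reversepath ?y)) +++ (?y +++ (q +++ ?z)))"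
    unfolding tethered_eq[OF assms(1)] tethered_eq[OF assms(2)]
    by (rule fundamental_group_mult) (use t assms in blast)+
  also have "\<dots> = homotopy_class X (?x +++ ((p +++ q) +++ ?z))"
    using h homotopy_class_eq_iff[OF path_between_join[OF tethered_loop[OF assms(1)] tethered_loop[OF assms(2)]]] by blast
  also have "\<dots> = tethered (p +++ q)"
    using tethered_eq[OF path_between_join[OF assms]] by simp
  finally show ?thesis by simp
qed

lemma tethered_lower:
  assumes "path_between (X \<inter> {z. Im z \<le> 0}) x y p"
  shows "tethered p = \<one>\<^bsub>LG\<^esub>"
proof -
  have xy: "x \<in> X" "y \<in> X" "Im x \<le> 0" "Im y \<le> 0"
    using path_between_start[OF assms] path_between_finish[OF assms] by auto
  have p: "path_between X x y p" using assms by (rule path_between_mono) auto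
  have "path_between (X \<inter> {z. Im z \<le> 0}) bp bp (tether x +++ (p +++ reversepath (tether y)))"
    using assms tether_lower xy by blast
  moreover have "path_between (X \<inter> {z. Im z \<le> 0}) bp bp (linepath bp bp)"
    using bp_in_X bp by (intro path_between_const) auto
  ultimately have "homotopic_paths X (tether x +++ (p +++ reversepath (tether y))) (linepath bp bp)"
    by (rule hp_lower)
  then show ?thesis
    unfolding fundamental_group_one tethered_eq[OF p] homotopy_class_eq_iff[OF tethered_loop[OF p]] .
qed

lemma tethered_const:
  assumes "x \<in> X"
  shows "tethered (linepath x x) = \<one>\<^bsub>LG\<^esub>"
proof -
  interpret group LG by (rule group_LG)
  have l: "path_between X x x (linepath x x)" using assms by (rule path_between_const)
  have "tethered (linepath x x) \<otimes>\<^bsub>LG\<^esub> tethered (linepath x x) = tethered (linepath x x)"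
    using tethered_join[OF l l] tethered_eq_iff[OF path_between_join[OF l l] l] hp_lid[OF l] by simp
  then show ?thesis using tethered_closed[OF l] by (metis l_cancel_one)
qed

lemma tethered_reverse:
  assumes "path_between X x y p"
  shows "tethered (reversepath p) = inv\<^bsub>LG\<^esub> (tethered p)"
proof -
  interpret group LG by (rule group_LG)
  note r = path_between_reversepath[OF assms]
  have l: "path_between X y y (linepath y y)" using path_between_finish[OF assms] by (rule path_between_const)
  have "tethered (reversepath p +++ p) = tethered (linepath y y)"
    using tethered_eq_iff[OF path_between_join[OF r assms] l] hp_linv[OF assms] by blast
  then have "tethered (reversepath p) \<otimes>\<^bsub>LG\<^esub> tethered p = \<one>\<^bsub>LG\<^esub>"
    using tethered_join[OF r assms] tethered_const[OF path_between_finish[OF assms]] by simp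
  then show ?thesis using inv_equality tethered_closed[OF assms] tethered_closed[OF r] by metis
qed

end

section \<open>Realising words by arcs through the gaps\<close>

context slit
begin

definition upper_arc :: "nat \<Rightarrow> nat \<Rightarrow> real \<Rightarrow> complex" where
  "upper_arc a b = linepath (mid a) tp +++ linepath tp (mid b)"

lemma upper_arc:
  assumes "a \<le> n" "b \<le> n"
  shows "path_between (X \<inter> {z. Im z \<ge> 0}) (mid a) (mid b) (upper_arc a b)"
proof -
  have "closed_segment tp (mid c) \<subseteq> X \<inter> {z. Im z \<ge> 0}" if "c \<le> n" for c
    using segment_upper[OF tp(1) mid_in_X tp(2)] that by (simp add: Im_mid)
  then show ?thesis
    unfolding upper_arc_def using assms
    by (intro path_between_join[of _ _ tp] path_between_linepath) (auto simp: closed_segment_commute)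
qed

lemma upper_arc_X: "a \<le> n \<Longrightarrow> b \<le> n \<Longrightarrow> path_between X (mid a) (mid b) (upper_arc a b)"
  by (rule path_between_mono[OF upper_arc]) auto

lemma tethered_upper_arc_join:
  assumes "a \<le> n" "b \<le> n" "c \<le> n"
  shows "tethered (upper_arc a b) \<otimes>\<^bsub>LG\<^esub> tethered (upper_arc b c) = tethered (upper_arc a c)"
proof -
  have "homotopic_paths X (upper_arc a b +++ upper_arc b c) (upper_arc a c)"
    by (rule hp_upper[OF path_between_join[OF upper_arc upper_arc] upper_arc]) (use assms in auto)
  then show ?thesis
    using tethered_join[OF upper_arc_X upper_arc_X] assms
      tethered_eq_iff[OF path_between_join[OF upper_arc_X upper_arc_X] upper_arc_X] by metis
qed

lemma tethered_upper_arc_refl: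
  assumes "a \<le> n"
  shows "tethered (upper_arc a a) = \<one>\<^bsub>LG\<^esub>"
  using tethered_upper_arc_join[OF assms assms assms] tethered_closed[OF upper_arc_X[OF assms assms]]
  by (metis group.l_cancel_one group_LG)

text \<open>Up through gap \<open>i\<close> and down through gap \<open>i - 1\<close>: a
  counterclockwise turn around the \<open>i\<close>-th puncture. The neutral element serves as a
  default because evaluation of words needs a value for every natural number.\<close>

definition gen_loop :: "nat \<Rightarrow> (real \<Rightarrow> complex) set" where
  "gen_loop i = (if i \<in> {1..n} then tethered (upper_arc i (i - 1)) else \<one>\<^bsub>LG\<^esub>)"

lemma gen_loop_closed: "gen_loop i \<in> carrier LG"
proof -
  have "tethered (upper_arc i (i - 1)) \<in> carrier LG" if "i \<in> {1..n}"
    by (rule tethered_closed[OF upper_arc_X]) (use that in auto)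
  then show ?thesis
    unfolding gen_loop_def using group.is_monoid[OF group_LG] by (simp add: monoid.one_closed)
qed

definition ev :: "nat fgroup \<Rightarrow> (real \<Rightarrow> complex) set" where
  "ev g = group.word_eval LG gen_loop (fg_word g)"

lemma ev_add: "ev (g + h) = ev g \<otimes>\<^bsub>LG\<^esub> ev h"
  unfolding ev_def by (rule group.word_eval_add[OF group_LG gen_loop_closed])

lemma ev_zero [simp]: "ev 0 = \<one>\<^bsub>LG\<^esub>"
  unfolding ev_def by (rule group.word_eval_zero[OF group_LG gen_loop_closed])

lemma ev_minus: "ev (- g) = inv\<^bsub>LG\<^esub> (ev g)"
  unfolding ev_def by (rule group.word_eval_minus[OF group_LG gen_loop_closed])

lemma ev_gen: "ev (fg_gen i) = gen_loop i"
  unfolding ev_def by (rule group.word_eval_gen[OF group_LG gen_loop_closed])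

text \<open>The arcs from gap \<open>a\<close> to \<open>a - 1\<close>, and so on down to gap 0,
  concatenate in the upper half to a single arc.\<close>

lemma ev_stair: "a \<le> n \<Longrightarrow> ev (stair a) = tethered (upper_arc a 0)"
proof (induction a)
  case 0
  then show ?case using tethered_upper_arc_refl[of 0] by simp
next
  case (Suc a)
  then have "gen_loop (Suc a) = tethered (upper_arc (Suc a) a)"
    by (simp add: gen_loop_def)
  then show ?case
    using Suc tethered_upper_arc_join[of "Suc a" a 0] by (simp add: ev_add ev_gen)
qed

text \<open>Because \<open>tethered\<close> determines the homotopy class of a path with given ends,
  proving this for every path makes \<open>W\<close> a complete invariant.\<close>

definition normal :: "(real \<Rightarrow> complex) \<Rightarrow> bool" where
  "normal p \<longleftrightarrow> tethered p = ev (W p)"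

lemma normal_join:
  "path_between X x y p \<Longrightarrow> path_between X y z q \<Longrightarrow> normal p \<Longrightarrow> normal q \<Longrightarrow> normal (p +++ q)"
  by (simp add: normal_def W_path_join tethered_join ev_add)

lemma normal_reverse: "path_between X x y p \<Longrightarrow> normal p \<Longrightarrow> normal (reversepath p)"
  by (simp add: normal_def W_path_reverse tethered_reverse ev_minus)

lemma normal_homotopic: 
  assumes "homotopic_paths X p q" "path_between X x y q" "normal q"
  shows "normal p"
proof -
  have p: "path_between X x y p"
    using path_between_homotopic[OF homotopic_paths_sym[OF assms(1)] assms(2)] .
  show ?thesis
    using assms(3) W_homotopic[OF assms(1)] tethered_eq_iff[OF p assms(2)] assms(1)
    unfolding normal_def by simp
qed

lemma normal_lower: "path_between (X \<inter> {z. Im z \<le> 0}) x y p \<Longrightarrow> normal p"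
  by (simp add: normal_def tethered_lower W_path_lower)

text \<open>The tether to \<open>y\<close> is the tether to \<open>lp\<close> followed by this very
  segment, so the closed-up loop runs along a path and back.\<close>

lemma tethered_linepath_lp:
  assumes "y \<in> X" "Im y > 0"
  shows "path_between (X \<inter> {z. Im z \<ge> 0}) lp y (linepath lp y)"
    "tethered (linepath lp y) = \<one>\<^bsub>LG\<^esub>"
proof -
  have y: "y \<in> D" using assms by blast
  show l: "path_between (X \<inter> {z. Im z \<ge> 0}) lp y (linepath lp y)"
    using segment_upper[OF y lp_in_X assms(2)] lp(2)
    by (intro path_between_linepath) (simp add: closed_segment_commute)
  have l': "path_between X lp y (linepath lp y)" by (rule path_between_mono[OF l]) auto
  have t: "path_between X bp lp (linepath bp lp)"
    using tether[OF lp_in_X] lp(2) by (simp add: tether_def)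
  let ?b = "linepath bp lp" and ?l = "linepath lp y"
  have bl: "path_between X bp y (?b +++ ?l)" by (rule path_between_join[OF t l'])
  have h: "homotopic_paths X (?b +++ (?l +++ reversepath (?b +++ ?l))) (linepath bp bp)"
    using homotopic_paths_trans[OF homotopic_paths_sym[OF hp_assoc[OF t l' path_between_reversepath[OF bl]]]
        hp_rinv[OF bl]] .
  have "tethered ?l = homotopy_class X (?b +++ (?l +++ reversepath (?b +++ ?l)))"
    using tethered_eq[OF l'] lp(2) assms(2) by (simp add: tether_def)
  also have "\<dots> = homotopy_class X (linepath bp bp)"
    using homotopy_class_eq_iff[OF path_between_join[OF t path_between_join[OF l' path_between_reversepath[OF bl]]]] h
    by blast
  finally show "tethered ?l = \<one>\<^bsub>LG\<^esub>" by (simp add: fundamental_group_one)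
qed

lemma normal_upper_open:
  assumes "path_between (X \<inter> {z. Im z > 0}) x y p"
  shows "normal p"
proof -
  interpret LG: group LG by (rule group_LG)
  have xy: "x \<in> X" "y \<in> X" "Im x > 0" "Im y > 0"
    using path_between_start[OF assms] path_between_finish[OF assms] by auto
  have p: "path_between (X \<inter> {z. Im z \<ge> 0}) x y p" by (rule path_between_mono[OF assms]) auto
  have p': "path_between X x y p" by (rule path_between_mono[OF assms]) auto
  note l = tethered_linepath_lp[OF xy(1,3)] tethered_linepath_lp[OF xy(2,4)]
  have lx: "path_between X lp x (linepath lp x)" by (rule path_between_mono[OF l(1)]) auto
  have ly: "path_between X lp y (linepath lp y)" by (rule path_between_mono[OF l(3)]) auto
  have "homotopic_paths X p (reversepath (linepath lp x) +++ linepath lp y)"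
    by (rule hp_upper[OF p path_between_join[OF path_between_reversepath[OF l(1)] l(3)]])
  then have "tethered p = tethered (reversepath (linepath lp x) +++ linepath lp y)"
    using tethered_eq_iff[OF p' path_between_join[OF path_between_reversepath[OF lx] ly]] by blast
  also have "\<dots> = \<one>\<^bsub>LG\<^esub>"
    by (simp only: tethered_join[OF path_between_reversepath[OF lx] ly] tethered_reverse[OF lx] l
        LG.inv_one LG.l_one LG.one_closed)
  finally have "tethered p = \<one>\<^bsub>LG\<^esub>" .
  moreover have "W p = 0" using W_path_upper[OF p] xy by simp
  ultimately show ?thesis by (simp add: normal_def)
qed

text \<open>In the upper half the segment is homotopic to sliding along its gap to
  \<open>mid\<close>, arching over to gap 0 and rising from \<open>lp\<close>. Of these three pieces
  only the arc has a nontrivial class, and \<open>ev_stair\<close> knows it.\<close>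

lemma normal_linepath_upper:
  assumes "z \<in> X" "Im z = 0" "y \<in> X" "Im y > 0"
  shows "normal (linepath z y)"
proof -
  interpret LG: group LG by (rule group_LG)
  let ?a = "idx z"
  have y: "y \<in> D" using assms by blast
  note a = idx_le[of z]
  have zm: "closed_segment z (mid ?a) \<subseteq> X \<inter> {z. Im z = 0}"
    by (rule segment_axis[OF assms(1) mid_in_X[OF a] assms(2) Im_mid[OF a] idx_mid[OF a, symmetric]])
  have zm_u: "path_between (X \<inter> {z. Im z \<ge> 0}) z (mid ?a) (linepath z (mid ?a))"
    by (rule path_between_linepath) (use zm in auto)
  have zm_l: "path_between (X \<inter> {z. Im z \<le> 0}) z (mid ?a) (linepath z (mid ?a))"
    by (rule path_between_linepath) (use zm in auto)
  have zm_x: "path_between X z (mid ?a) (linepath z (mid ?a))"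
    by (rule path_between_mono[OF zm_l]) auto
  have zy: "path_between (X \<inter> {z. Im z \<ge> 0}) z y (linepath z y)"
    using segment_upper[OF y assms(1,4)] assms(2)
    by (intro path_between_linepath) (simp add: closed_segment_commute)
  have zy_x: "path_between X z y (linepath z y)" by (rule path_between_mono[OF zy]) auto
  note l = tethered_linepath_lp[OF assms(3,4)]
  have m0: "mid 0 = lp" by (simp add: mid_def)
  have ua: "path_between (X \<inter> {z. Im z \<ge> 0}) (mid ?a) lp (upper_arc ?a 0)"
    "path_between X (mid ?a) lp (upper_arc ?a 0)"
    using upper_arc[OF a, of 0] upper_arc_X[OF a, of 0] m0 by auto
  have lx: "path_between X lp y (linepath lp y)" by (rule path_between_mono[OF l(1)]) auto
  have "homotopic_paths X (linepath z y) (linepath z (mid ?a) +++ (upper_arc ?a 0 +++ linepath lp y))"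
    by (rule hp_upper[OF zy path_between_join[OF zm_u path_between_join[OF ua(1) l(1)]]])
  then have "tethered (linepath z y) = tethered (linepath z (mid ?a) +++ (upper_arc ?a 0 +++ linepath lp y))"
    using tethered_eq_iff[OF zy_x path_between_join[OF zm_x path_between_join[OF ua(2) lx]]] by blast
  also have "\<dots> = tethered (linepath z (mid ?a)) \<otimes>\<^bsub>LG\<^esub> (tethered (upper_arc ?a 0) \<otimes>\<^bsub>LG\<^esub> tethered (linepath lp y))"
    by (simp only: tethered_join[OF zm_x path_between_join[OF ua(2) lx]] tethered_join[OF ua(2) lx])
  also have "\<dots> = tethered (upper_arc ?a 0)"
    by (simp only: l(2) tethered_lower[OF zm_l] tethered_closed[OF ua(2)] LG.l_one LG.r_one)
  also have "\<dots> = ev (stair ?a)" using ev_stair[OF a] by simp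
  also have "stair ?a = W (linepath z y)"
    using W_linepath_upper[OF assms(1) y] assms by simp
  finally show ?thesis by (simp add: normal_def)
qed

text \<open>Around an unpunctured point of the axis the ball is convex in \<open>D\<close>, so a
  path in it can be replaced by two segments through the centre \<open>z\<close>, each of which
  stays on one side of the axis.\<close>

lemma normal_local:
  assumes "z \<in> X"
  obtains e where "e > 0" "\<And>x y p. path_between (X \<inter> ball z e) x y p \<Longrightarrow> normal p"
proof -
  have "z \<notin> K" using assms by blast
  then obtain e where e: "e > 0" "(\<forall>x\<in>ball z e. Im x < 0) \<or> (\<forall>x\<in>ball z e. Im x > 0) \<or>
    (Im z = 0 \<and> (\<forall>x\<in>ball z e. idx x = idx z) \<and> ball z e \<inter> K = {})"
    by (rule near_cases)
  have "normal p" if p: "path_between (X \<inter> ball z e) x y p" for x y p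
  proof -
    consider "\<forall>x\<in>ball z e. Im x < 0" | "\<forall>x\<in>ball z e. Im x > 0" | "Im z = 0" "ball z e \<inter> K = {}"
      using e by blast
    then show ?thesis
    proof cases
      case 1
      have "path_between (X \<inter> {z. Im z \<le> 0}) x y p"
        by (rule path_between_mono[OF p]) (use 1 in force)
      then show ?thesis by (rule normal_lower)
    next
      case 2
      have "path_between (X \<inter> {z. Im z > 0}) x y p"
        by (rule path_between_mono[OF p]) (use 2 in blast)
      then show ?thesis by (rule normal_upper_open)
    next
      case 3
      let ?B = "D \<inter> ball z e"
      have B: "X \<inter> ball z e = ?B" using 3 by blast
      have cB: "convex ?B" using convex_D by (simp add: convex_Int)
      have zB: "z \<in> ?B" using assms e by simp
      have seg: "path_between ?B z w (linepath z w)" "path_between X z w (linepath z w)"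
        "normal (linepath z w)" if w: "w \<in> ?B" for w
      proof -
        have s: "closed_segment z w \<subseteq> ?B" by (rule closed_segment_subset[OF zB w cB])
        then show "path_between ?B z w (linepath z w)" by blast
        then show "path_between X z w (linepath z w)"
          by (rule path_between_mono) (use B in blast)
        show "normal (linepath z w)"
        proof (cases "Im w \<le> 0")
          case True
          have "closed_segment z w \<subseteq> {z. Im z \<le> 0}"
            by (rule closed_segment_subset) (use True 3 in \<open>auto simp: convex_halfspace_Im_le\<close>)
          then have "path_between (X \<inter> {z. Im z \<le> 0}) z w (linepath z w)"
            by (intro path_between_linepath) (use s B in blast)
          then show ?thesis by (rule normal_lower)
        next
          case False
          then show ?thesis
            using normal_linepath_upper[OF assms 3(1), of w] w B by fastforce
        qed
      qed
      have xy: "x \<in> ?B" "y \<in> ?B"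
        using path_between_start[OF p] path_between_finish[OF p] B by blast+
      note sx = seg[OF xy(1)] and sy = seg[OF xy(2)]
      let ?q = "reversepath (linepath z x) +++ linepath z y"
      have q: "path_between ?B x y ?q" by (rule path_between_join[OF path_between_reversepath[OF sx(1)] sy(1)])
      have "homotopic_paths ?B p ?q"
        using convex_imp_simply_connected[OF cB] p q
        unfolding simply_connected_eq_homotopic_paths path_between_def B by metis
      then have h: "homotopic_paths X p ?q"
        by (rule homotopic_paths_subset) (use B in blast)
      have "normal ?q"
        by (rule normal_join[OF path_between_reversepath[OF sx(2)] sy(2) normal_reverse[OF sx(2,3)] sy(3)])
      then show ?thesis
        using normal_homotopic[OF h path_between_join[OF path_between_reversepath[OF sx(2)] sy(2)]] by blast
    qed
  qed
  then show ?thesis using that e(1) by blast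
qed

text \<open>Normality of the subpath between two times is an equivalence relation on the unit
  interval. It holds locally by \<open>normal_local\<close>, and the interval is connected.\<close>

lemma normal_path:
  assumes "path_between X x y p"
  shows "normal p"
proof -
  have p: "path p" "path_image p \<subseteq> X" using assms by (auto simp: path_between_def)
  have sub: "path_between X (p s) (p t) (subpath s t p)" if "s \<in> {0..1}" "t \<in> {0..1}" for s t
    using that p path_image_subpath_subset[of s t p] unfolding path_between_def
    by (auto simp: path_subpath)
  have "normal (subpath 0 1 p)"
  proof (rule connected_equivalence_relation[where S = "{0..1}" and R = "\<lambda>s t. normal (subpath s t p)"])
    show "normal (subpath t s p)" if "normal (subpath s t p)" "s \<in> {0..1}" "t \<in> {0..1}" for s t
      using normal_reverse[OF sub[OF that(2,3)] that(1)] by (simp add: reversepath_subpath)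
    show "normal (subpath s r p)" if "normal (subpath s t p)" "normal (subpath t r p)"
      "s \<in> {0..1}" "t \<in> {0..1}" "r \<in> {0..1}" for s t r
    proof (rule normal_homotopic)
      show "homotopic_paths X (subpath s r p) (subpath s t p +++ subpath t r p)"
        using homotopic_join_subpaths[OF p that(3,4,5)] by (rule homotopic_paths_sym)
      show "path_between X (p s) (p r) (subpath s t p +++ subpath t r p)"
        using sub that by blast
      show "normal (subpath s t p +++ subpath t r p)"
        using normal_join[OF sub[OF that(3,4)] sub[OF that(4,5)] that(1,2)] .
    qed
    show "\<exists>T. openin (top_of_set {0..1}) T \<and> a \<in> T \<and> (\<forall>t\<in>T. normal (subpath a t p))"
      if a: "a \<in> {0..1}" for a
    proof -
      have "p a \<in> X" using path_between_start[OF sub[OF a a]] .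
      then obtain e where e: "e > 0" "\<And>x y q. path_between (X \<inter> ball (p a) e) x y q \<Longrightarrow> normal q"
        using normal_local by blast
      have "continuous_on {0..1} p" using p by (simp add: path_def)
      then obtain d where d: "d > 0" "\<And>t. t \<in> {0..1} \<Longrightarrow> dist t a < d \<Longrightarrow> dist (p t) (p a) < e"
        using a e(1) unfolding continuous_on_iff by blast
      have "normal (subpath a t p)" if t: "t \<in> {0..1} \<inter> ball a d" for t
      proof (rule e(2))
        have cs: "closed_segment a t \<subseteq> {0..1} \<inter> ball a d"
          by (rule closed_segment_subset) (use a t d in \<open>auto intro: convex_Int\<close>)
        have "p s \<in> ball (p a) e" if "s \<in> closed_segment a t" for s
        proof -
          have "s \<in> {0..1} \<inter> ball a d" using cs that by blast
          then show ?thesis using d(2)[of s] by (simp add: dist_commute)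
        qed
        then have "path_image (subpath a t p) \<subseteq> ball (p a) e"
          unfolding path_image_subpath_gen by blast
        then show "path_between (X \<inter> ball (p a) e) (p a) (p t) (subpath a t p)"
          using sub[of a t] a t by (auto simp: path_between_def)
      qed
      then show ?thesis
        using a d(1) by (intro exI[of _ "{0..1} \<inter> ball a d"]) (auto simp: openin_open_Int)
    qed
  qed auto
  then show ?thesis by simp
qed

theorem homotopic_iff_W:
  assumes "path_between X x y p" "path_between X x y q"
  shows "homotopic_paths X p q \<longleftrightarrow> W p = W q"
  using W_homotopic tethered_eq_iff[OF assms] normal_path[OF assms(1)] normal_path[OF assms(2)]
  unfolding normal_def by metis

section \<open>Loops spelled by words and their images\<close>

definition word_path :: "(nat \<Rightarrow> real \<Rightarrow> complex) \<Rightarrow> nat gen_word \<Rightarrow> real \<Rightarrow> complex" where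
  "word_path c w = foldr (\<lambda>(i, e) q. (if e then c i else reversepath (c i)) +++ q) w (linepath bp bp)"

lemma word_path_Cons:
  "word_path c ((i, e) # w) = (if e then c i else reversepath (c i)) +++ word_path c w"
  by (simp add: word_path_def)

lemma W_word_path:
  assumes "\<And>i. i \<in> {1..n} \<Longrightarrow> path_between X bp bp (c i)"
    "\<And>i. i \<in> {1..n} \<Longrightarrow> W (c i) = fg_gen i" "fst ` set w \<subseteq> {1..n}"
  shows "path_between X bp bp (word_path c w) \<and> W (word_path c w) = fg_class w"
  using assms(3)
proof (induction w)
  case Nil
  have "word_path c [] = linepath bp bp" by (simp only: word_path_def foldr.simps id_apply)
  then show ?case using path_between_const[OF bp_in_X] by (simp only: fg_class_Nil W_const simp_thms)
next
  case (Cons x w)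
  obtain i e where x: "x = (i, e)" by (cases x)
  then have i: "i \<in> {1..n}" using Cons.prems by simp
  let ?c = "if e then c i else reversepath (c i)"
  have c: "path_between X bp bp ?c" using assms(1)[OF i] by auto
  have IH: "path_between X bp bp (word_path c w)" "W (word_path c w) = fg_class w"
    using Cons by auto
  have "W ?c = (if e then fg_gen i else - fg_gen i)"
    using W_path_reverse[OF assms(1)[OF i]] assms(2)[OF i] by simp
  moreover have "fg_class (x # w) = fg_class [x] + fg_class w"
    using fg_class_append[of "[x]" w] by simp
  ultimately show ?case
    using path_between_join[OF c IH(1)] W_path_join[OF c IH(1)] IH(2)
    by (simp add: x word_path_Cons fg_class_letter)
qed

text \<open>By \<open>homotopic_iff_W\<close>, \<open>p\<close> is homotopic to the product of the
  loops \<open>c i\<close> spelled by \<open>w\<close>. Applying \<open>f\<close> keeps the homotopy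
  and maps the product factor by factor, so the induced map acts on words by substitution.\<close>

lemma W_image_eq_fg_eval:
  assumes "\<And>i. i \<in> {1..n} \<Longrightarrow> path_between X bp bp (c i)"
    "\<And>i. i \<in> {1..n} \<Longrightarrow> W (c i) = fg_gen i"
    and f: "continuous_on X f" "f ` X \<subseteq> X" "f bp = bp"
    and p: "path_between X bp bp p" "W p = fg_class w" "fst ` set w \<subseteq> {1..n}"
  shows "W (f \<circ> p) = fg_eval (\<lambda>i. W (f \<circ> c i)) w"
proof -
  note wp = W_word_path[of c, OF assms(1,2)]
  have im: "path_between X bp bp (f \<circ> q)" if "path_between X bp bp q" for q
    using path_between_image[OF that f(1,2)] f(3) by simp
  have "homotopic_paths X p (word_path c w)"
    using homotopic_iff_W[OF p(1)] wp[OF _ _ p(3)] p(2) by metis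
  then have "homotopic_paths X (f \<circ> p) (f \<circ> word_path c w)"
    by (rule homotopic_paths_continuous_image[OF _ f(1)]) (use f(2) in auto)
  then have "W (f \<circ> p) = W (f \<circ> word_path c w)" by (rule W_homotopic)
  also have "\<dots> = fg_eval (\<lambda>i. W (f \<circ> c i)) w"
    using p(3)
  proof (induction w)
    case Nil
    have "f \<circ> linepath bp bp = linepath bp bp" using f(3) by (auto simp: linepath_refl)
    moreover have "word_path c [] = linepath bp bp" by (simp only: word_path_def foldr.simps id_apply)
    ultimately show ?case by (simp only: W_const fg_eval_Nil)
  next
    case (Cons x w)
    obtain i e where x: "x = (i, e)" by (cases x)
    then have i: "i \<in> {1..n}" using Cons.prems by simp
    let ?c = "if e then c i else reversepath (c i)"
    have c: "path_between X bp bp ?c" using assms(1)[OF i] by auto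
    have w: "path_between X bp bp (word_path c w)" using wp[of w] Cons.prems by auto
    have "f \<circ> word_path c (x # w) = (f \<circ> ?c) +++ (f \<circ> word_path c w)"
      by (simp add: x word_path_Cons path_compose_join)
    then have "W (f \<circ> word_path c (x # w)) = W (f \<circ> ?c) + W (f \<circ> word_path c w)"
      using W_path_join[OF im[OF c] im[OF w]] by simp
    moreover have "W (f \<circ> ?c) = (if e then W (f \<circ> c i) else - W (f \<circ> c i))"
      using W_path_reverse[OF im[OF assms(1)[OF i]]] by (simp add: path_compose_reversepath)
    moreover have "W (f \<circ> word_path c w) = fg_eval (\<lambda>i. W (f \<circ> c i)) w"
      using Cons.prems by (intro Cons.IH) simp
    ultimately show ?case by (simp only: x fg_eval_Cons)
  qed
  finally show ?thesis .
qed

end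

section \<open>Winding numbers under homeomorphisms of the plane\<close>

lemma path_between_in: "path_between S a b p \<Longrightarrow> t \<in> {0..1} \<Longrightarrow> p t \<in> S"
  unfolding path_between_def path_image_def by blast

lemma hp_part_circlepath_split:
  assumes "\<theta>\<^sub>1 \<le> \<theta>\<^sub>2" "\<theta>\<^sub>2 \<le> \<theta>\<^sub>3" "path_image (part_circlepath z r \<theta>\<^sub>1 \<theta>\<^sub>3) \<subseteq> S"
  shows "homotopic_paths S (part_circlepath z r \<theta>\<^sub>1 \<theta>\<^sub>3)
           (part_circlepath z r \<theta>\<^sub>1 \<theta>\<^sub>2 +++ part_circlepath z r \<theta>\<^sub>2 \<theta>\<^sub>3)"
proof (cases "\<theta>\<^sub>1 = \<theta>\<^sub>3")
  \<comment> \<open>The arc is a constant path; the split parameter used otherwise would be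
    0/0.\<close>
  case True
  then have "\<theta>\<^sub>1 = \<theta>\<^sub>2" "\<theta>\<^sub>3 = \<theta>\<^sub>2" using assms by auto
  have "part_circlepath z r \<theta>\<^sub>2 \<theta>\<^sub>2 = linepath (z + r * exp (\<i> * \<theta>\<^sub>2)) (z + r * exp (\<i> * \<theta>\<^sub>2))"
    by (auto simp: part_circlepath_def linepath_def fun_eq_iff algebra_simps scaleR_conv_of_real)
  then show ?thesis
    using assms(3) homotopic_paths_sym[OF hp_lid[of S _ _ "part_circlepath z r \<theta>\<^sub>2 \<theta>\<^sub>2"]]
    unfolding \<open>\<theta>\<^sub>1 = \<theta>\<^sub>2\<close> \<open>\<theta>\<^sub>3 = \<theta>\<^sub>2\<close>
    by (auto simp: path_between_def)
next
  case False
  \<comment> \<open>The time at which the arc reaches the angle \<open>\<theta>\<^sub>2\<close>;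
    both pieces are then subpaths of the arc.\<close>
  define v where "v = (\<theta>\<^sub>2 - \<theta>\<^sub>1) / (\<theta>\<^sub>3 - \<theta>\<^sub>1)"
  let ?g = "part_circlepath z r \<theta>\<^sub>1 \<theta>\<^sub>3"
  have v: "v \<in> {0..1}" "\<theta>\<^sub>1 + v * (\<theta>\<^sub>3 - \<theta>\<^sub>1) = \<theta>\<^sub>2" using assms False by (auto simp: v_def field_simps)
  have *: "linepath \<theta>\<^sub>1 \<theta>\<^sub>3 ((v' - u) * x + u) = linepath (\<theta>\<^sub>1 + u * (\<theta>\<^sub>3 - \<theta>\<^sub>1)) (\<theta>\<^sub>1 + v' * (\<theta>\<^sub>3 - \<theta>\<^sub>1)) x" for u v' x :: real
    by (simp add: linepath_def algebra_simps)
  have "subpath 0 v ?g = part_circlepath z r \<theta>\<^sub>1 \<theta>\<^sub>2" "subpath v 1 ?g = part_circlepath z r \<theta>\<^sub>2 \<theta>\<^sub>3"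
    unfolding subpath_def part_circlepath_def * v(2) by auto
  then show ?thesis
    using homotopic_join_subpaths[of ?g S 0 v 1] assms(3) v(1) by (simp add: homotopic_paths_sym)
qed

lemma path_image_circle_subset:
  assumes "0 \<le> r"
  shows "path_image (part_circlepath z r s t) \<subseteq> sphere z r"
proof -
  have "cmod (exp (\<i> * complex_of_real x)) = 1" for x by simp
  then show ?thesis
    using assms by (auto simp: path_image_def part_circlepath_def dist_norm norm_mult)
qed

lemma part_circlepath_Im_bounds:
  assumes "Im z = 0" "r \<ge> 0"
  shows "0 \<le> s \<Longrightarrow> t \<le> pi \<Longrightarrow> s \<le> t \<Longrightarrow> w \<in> path_image (part_circlepath z r s t) \<Longrightarrow> Im w \<ge> 0"
    "- pi \<le> s \<Longrightarrow> t \<le> 0 \<Longrightarrow> s \<le> t \<Longrightarrow> w \<in> path_image (part_circlepath z r s t) \<Longrightarrow> Im w \<le> 0"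
    "pi \<le> s \<Longrightarrow> t \<le> 2 * pi \<Longrightarrow> s \<le> t \<Longrightarrow> w \<in> path_image (part_circlepath z r s t) \<Longrightarrow> Im w \<le> 0"
proof -
  have im: "\<exists>x. s \<le> x \<and> x \<le> t \<and> Im w = r * sin x" if sw: "s \<le> t" "w \<in> path_image (part_circlepath z r s t)"
  proof -
    obtain y where y: "y \<in> {0..1}" "w = z + of_real r * exp (\<i> * of_real (linepath s t y))"
      using sw by (auto simp: path_image_def part_circlepath_def)
    have "linepath s t y \<in> closed_segment s t" using y(1) linepath_in_path by blast
    then have "s \<le> linepath s t y" "linepath s t y \<le> t"
      using that(1) by (auto simp: closed_segment_eq_real_ivl)
    then show ?thesis
      using y(2) assms(1) by (auto simp: Im_exp)
  qed
  show "Im w \<ge> 0" if "0 \<le> s" "t \<le> pi" "s \<le> t" "w \<in> path_image (part_circlepath z r s t)"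
    using im[OF that(3,4)] that assms(2) by (auto intro!: mult_nonneg_nonneg sin_ge_zero)
  show "Im w \<le> 0" if a: "- pi \<le> s" "t \<le> 0" "s \<le> t" "w \<in> path_image (part_circlepath z r s t)"
  proof -
    obtain x where x: "s \<le> x" "x \<le> t" "Im w = r * sin x" using im[OF a(3,4)] by blast
    have "sin (- x) \<ge> 0" using x that by (intro sin_ge_zero) auto
    then show ?thesis using x assms(2) by (simp add: mult_nonneg_nonpos)
  qed
  show "Im w \<le> 0" if a: "pi \<le> s" "t \<le> 2 * pi" "s \<le> t" "w \<in> path_image (part_circlepath z r s t)"
  proof -
    obtain x where x: "s \<le> x" "x \<le> t" "Im w = r * sin x" using im[OF a(3,4)] by blast
    have "sin (x - pi) \<ge> 0" using x a by (intro sin_ge_zero) auto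
    then have "sin x \<le> 0" by simp
    then show ?thesis using x assms(2) by (simp add: mult_nonneg_nonpos)
  qed
qed

lemma winding_number_full_circle:
  assumes "r > 0"
  shows "winding_number (part_circlepath z r \<theta> (\<theta> + 2 * pi)) z = 1"
proof -
  have z: "z \<notin> path_image (part_circlepath z r \<theta> (\<theta> + 2 * pi))"
    using path_image_circle_subset[of r z \<theta> "\<theta> + 2 * pi"] assms by auto
  have "((\<lambda>t. 1 / (z + of_real r * cis t - z) * of_real r * \<i> * cis t) has_integral (2 * pi * \<i>)) {\<theta>..\<theta> + 2 * pi}"
  proof -
    have "((\<lambda>t. \<i>) has_integral (2 * pi * \<i>)) {\<theta>..\<theta> + 2 * pi}"
      using has_integral_const_real[of \<i> \<theta> "\<theta> + 2 * pi"] by (simp add: scaleR_conv_of_real)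
    moreover have "1 / (z + of_real r * cis t - z) * of_real r * \<i> * cis t = \<i>" for t
      using assms by (simp add: field_simps)
    ultimately show ?thesis by (simp only:)
  qed
  then have "((\<lambda>w. 1 / (w - z)) has_contour_integral (2 * pi * \<i>)) (part_circlepath z r \<theta> (\<theta> + 2 * pi))"
    by (subst has_contour_integral_part_circlepath_iff) auto
  then have "contour_integral (part_circlepath z r \<theta> (\<theta> + 2 * pi)) (\<lambda>w. 1 / (w - z)) = 2 * pi * \<i>"
    by (rule contour_integral_unique)
  then show ?thesis
    using winding_number_valid_path[OF valid_path_part_circlepath z] by simp
qed

text \<open>In the plane punctured at \<open>a\<close>, \<open>p\<close> is homotopic to a small
  circle. Near \<open>a\<close> the map is close to its derivative, whose complex linear part
  dominates when the determinant is positive, so the image of the small circle is homotopic to a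
  rotated and scaled circle.\<close>

lemma winding_number_image_at:
  fixes f :: "complex \<Rightarrow> complex"
  assumes f: "continuous_on UNIV f" "inj f" "(f has_derivative A) (at a)"
    and det: "Re (A 1) * Im (A \<i>) - Re (A \<i>) * Im (A 1) > 0"
    and p: "path p" "a \<notin> path_image p" "pathfinish p = pathstart p" "winding_number p a = 1"
  shows "winding_number (f \<circ> p) (f a) = 1"
proof -
  \<comment> \<open>The Wirtinger derivatives of \<open>f\<close> at \<open>a\<close>, for which the
    determinant is |b|^2 - |c|^2.\<close>
  define b where "b = (A 1 - \<i> * A \<i>) / 2"
  define c where "c = (A 1 + \<i> * A \<i>) / 2"
  interpret A: bounded_linear A using f(3) by (rule has_derivative_bounded_linear)
  have A: "A v = b * v + c * cnj v" for v
  proof -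
    have "A v = A (Re v *\<^sub>R 1 + Im v *\<^sub>R \<i>)"
      by (rule arg_cong[of _ _ A]) (simp add: complex_eq_iff)
    also have "\<dots> = Re v *\<^sub>R A 1 + Im v *\<^sub>R A \<i>"
      by (simp only: A.add A.scaleR)
    finally have "A v = Re v *\<^sub>R A 1 + Im v *\<^sub>R A \<i>" .
    then show ?thesis
      by (simp add: b_def c_def complex_eq_iff field_simps)
  qed
  have "(cmod b)\<^sup>2 - (cmod c)\<^sup>2 = Re (A 1) * Im (A \<i>) - Re (A \<i>) * Im (A 1)"
    unfolding cmod_power2 b_def c_def by (simp add: power2_eq_square field_simps)
  then have "(cmod c)\<^sup>2 < (cmod b)\<^sup>2" using det by simp
  then have cb: "cmod c < cmod b" by (meson norm_ge_zero power2_less_imp_less)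
  \<comment> \<open>Half of the margin, so that \<open>e + cmod c\<close> is still below
    \<open>cmod b\<close>.\<close>
  define e where "e = (cmod b - cmod c) / 2"
  have e: "e > 0" using cb by (simp add: e_def)
  obtain d where d: "d > 0" "\<And>y. cmod (y - a) < d \<Longrightarrow> cmod (f y - f a - A (y - a)) \<le> e * cmod (y - a)"
    using f(3) e unfolding has_derivative_at_alt by blast
  define r where "r = d / 2"
  have r: "r > 0" "r < d" using d(1) by (auto simp: r_def)
  let ?c = "part_circlepath a r 0 (0 + 2 * pi)"
  \<comment> \<open>Starting at the angle of \<open>b\<close> makes \<open>?g\<close> equal, at
    every time, to the image of \<open>?c\<close> under z -> f(a) + b (z - a).\<close>
  let ?g = "part_circlepath (f a) (cmod b * r) (Arg b) (Arg b + 2 * pi)"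
  have ac: "a \<notin> path_image ?c"
    using path_image_circle_subset[of r a 0 "0 + 2 * pi"] r by auto
  have br: "cmod b * r > 0" using r cb by (metis mult_pos_pos norm_ge_zero order_le_less_trans)
  have g: "?g t = f a + b * (?c t - a)" "cmod (?c t - a) = r" for t
  proof -
    have "b = of_real (cmod b) * exp (\<i> * of_real (Arg b))"
      using Arg_eq[of b] br by (cases "b = 0") auto
    then have "b * (of_real r * exp (\<i> * of_real (linepath 0 (0 + 2 * pi) t)))
       = of_real (cmod b * r) * (exp (\<i> * of_real (Arg b)) * exp (\<i> * of_real (linepath 0 (0 + 2 * pi) t)))"
      by (metis (no_types, lifting) mult.assoc mult.left_commute of_real_mult)
    also have "exp (\<i> * of_real (Arg b)) * exp (\<i> * of_real (linepath 0 (0 + 2 * pi) t)) =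
        exp (\<i> * of_real (linepath (Arg b) (Arg b + 2 * pi) t))"
      by (simp add: exp_add[symmetric] linepath_def algebra_simps)
    finally show "?g t = f a + b * (?c t - a)" by (simp only: part_circlepath_def add_diff_cancel_left')
    show "cmod (?c t - a) = r" using r(1) by (simp add: part_circlepath_def norm_mult)
  qed
  have "homotopic_loops (- {f a}) ?g (f \<circ> ?c)"
  proof (rule homotopic_loops_nearby_explicit)
    show "path (f \<circ> ?c)"
      by (rule path_continuous_image) (auto intro: continuous_on_subset[OF f(1)])
    fix t x :: real and y assume "t \<in> {0..1}" "y \<notin> - {f a}"
    then have y: "y = f a" by simp
    have "cmod (f (?c t) - f a - A (?c t - a)) \<le> e * r"
      using d(2)[of "?c t"] g(2)[of t] r(2) by simp
    then have "cmod (f (?c t) - f a - b * (?c t - a)) \<le> e * r + cmod c * r"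
      using norm_triangle_ineq[of "f (?c t) - f a - A (?c t - a)" "c * cnj (?c t - a)"] g(2)[of t]
      unfolding A by (simp add: norm_mult algebra_simps del: complex_cnj_diff)
    also have "\<dots> = (e + cmod c) * r" by (simp add: algebra_simps)
    also have "\<dots> < cmod b * r"
      using r(1) cb by (intro mult_strict_right_mono) (auto simp: e_def field_simps)
    finally show "cmod ((f \<circ> ?c) t - ?g t) < cmod (?g t - y)"
      by (simp only: o_def g y add_diff_cancel_left' norm_mult diff_diff_eq)
  qed (simp_all add: pathstart_compose pathfinish_compose exp_add algebra_simps)
  then have 1: "winding_number (f \<circ> ?c) (f a) = 1"
    using winding_number_homotopic_loops winding_number_full_circle[OF br, of "f a" "Arg b"] by metis
  have "exp (\<i> * (2 * of_real pi)) = 1"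
    using exp_two_pi_i by (simp add: mult.commute mult.left_commute)
  then have "homotopic_loops (- {a}) p ?c"
    using winding_number_homotopic_loops_eq[OF p(1,2) _ ac p(3)] p(4) winding_number_full_circle[OF r(1), of a 0]
    by simp
  then have "homotopic_loops (- {f a}) (f \<circ> p) (f \<circ> ?c)"
  proof (rule homotopic_loops_continuous_image)
    show "continuous_on (- {a}) f" using f(1) by (rule continuous_on_subset) auto
    show "f \<in> - {a} \<rightarrow> - {f a}" using f(2) by (auto dest: injD)
  qed
  then show ?thesis using 1 winding_number_homotopic_loops by metis
qed

text \<open>Winding numbers decide homotopy in the whole punctured plane. The radial map
  \<open>h\<close> retracts it onto the punctured disk and carries the homotopy along.\<close>

lemma punctured_cball_homotopic:
  fixes a :: complex
  assumes p: "path_between (cball a r - {a}) x x p" and q: "path_between (cball a r - {a}) x x q"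
    and w: "winding_number p a = winding_number q a"
  shows "homotopic_paths (cball a r - {a}) p q"
proof -
  define h where "h z = a + of_real (min 1 (r / cmod (z - a))) * (z - a)" for z
  have pq: "path p" "path q" "a \<notin> path_image p" "a \<notin> path_image q"
    "pathstart p = x" "pathstart q = x" "pathfinish p = x" "pathfinish q = x"
    using p q by (auto simp: path_between_def)
  have hpq: "homotopic_paths (- {a}) p q"
    using winding_number_homotopic_paths_eq[OF pq(1,3,2,4)] pq w by simp
  have "x \<in> cball a r - {a}" using path_between_start[OF p] .
  then have r: "r > 0" by (auto simp: dist_norm) (metis dist_norm less_le_trans norm_minus_commute zero_less_dist_iff)
  have ch: "continuous_on (- {a}) h"
    unfolding h_def by (intro continuous_intros) auto
  have "h z \<in> cball a r - {a}" if "z \<noteq> a" for z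
  proof -
    have "cmod (h z - a) = min 1 (r / cmod (z - a)) * cmod (z - a)"
      using r by (simp add: h_def norm_mult)
    also have "\<dots> \<le> r"
      using that by (simp add: min_def field_simps)
    finally have "h z \<in> cball a r" by (simp add: dist_norm norm_minus_commute)
    moreover have "min 1 (r / cmod (z - a)) \<noteq> 0" using r that by (auto simp: min_def)
    then have "h z \<noteq> a" using that by (simp add: h_def)
    ultimately show ?thesis by simp
  qed
  then have "h \<in> - {a} \<rightarrow> cball a r - {a}" by blast
  then have hh: "homotopic_paths (cball a r - {a}) (h \<circ> p) (h \<circ> q)"
    by (rule homotopic_paths_continuous_image[OF hpq ch])
  have hid: "h z = z" if "z \<in> cball a r - {a}" for z
    using that by (simp add: h_def min_def dist_norm norm_minus_commute divide_simps)
  have hs: "homotopic_paths (cball a r - {a}) (h \<circ> s) s" if s: "path_between (cball a r - {a}) x x s" for s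
  proof (rule homotopic_paths_sym, rule homotopic_paths_eq)
    show "s t = (h \<circ> s) t" if "t \<in> {0..1}" for t
      using hid[OF path_between_in[OF s that]] by simp
  qed (use s in \<open>auto simp: path_between_def\<close>)
  show ?thesis
    using homotopic_paths_trans[OF homotopic_paths_trans[OF homotopic_paths_sym[OF hs[OF p]] hh] hs[OF q]] .
qed

text \<open>When the ends move during a homotopy, their tracks have to be attached. The claim is
  plain for the sides of the convex parameter square and is transported by \<open>H\<close>.\<close>

lemma hp_square:
  fixes H :: "real \<times> real \<Rightarrow> 'a::real_normed_vector"
  assumes H: "continuous_on ({0..1} \<times> {0..1}) H" "H ` ({0..1} \<times> {0..1}) \<subseteq> S"
  shows "homotopic_paths S (\<lambda>t. H (0, t))
    ((\<lambda>s. H (s, 0)) +++ ((\<lambda>t. H (1, t)) +++ reversepath (\<lambda>s. H (s, 1))))"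
proof -
  let ?Q = "{0..1::real} \<times> {0..1::real}"
  let ?a = "\<lambda>t::real. (0::real, t)" and ?b = "\<lambda>s::real. (s, 0::real)"
    and ?c = "\<lambda>t::real. (1::real, t)" and ?d = "\<lambda>s::real. (s, 1::real)"
  have p: "path_between ?Q (0, 0) (0, 1) ?a" "path_between ?Q (0, 0) (1, 0) ?b"
    "path_between ?Q (1, 0) (1, 1) ?c" "path_between ?Q (0, 1) (1, 1) ?d"
    by (auto simp: path_between_def path_def path_image_def pathstart_def pathfinish_def intro!: continuous_intros)
  have "convex ?Q" by (intro convex_Times) auto
  then have "homotopic_paths ?Q ?a (?b +++ (?c +++ reversepath ?d))"
    using path_between_join[OF p(2) path_between_join[OF p(3) path_between_reversepath[OF p(4)]]] p(1)
      convex_imp_simply_connected unfolding simply_connected_eq_homotopic_paths path_between_def by metis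
  then have "homotopic_paths S (H \<circ> ?a) (H \<circ> (?b +++ (?c +++ reversepath ?d)))"
    by (rule homotopic_paths_continuous_image[OF _ H(1)]) (use H(2) in auto)
  then show ?thesis
    by (simp add: path_compose_join path_compose_reversepath) (simp add: o_def)
qed

section \<open>The disk without a segment\<close>

abbreviation slit_disk :: "complex set" where
  "slit_disk \<equiv> cball 0 2 - closed_segment (- 1) 1"

lemma in_unit_segment: "z \<in> closed_segment (- 1) (1 :: complex) \<longleftrightarrow> Im z = 0 \<and> \<bar>Re z\<bar> \<le> 1"
proof -
  have "closed_segment (- 1) (1 :: complex) = closed_segment (of_real (- 1)) (of_real 1)" by simp
  also have "\<dots> = of_real ` closed_segment (- 1) (1::real)" by (rule closed_segment_of_real)
  also have "closed_segment (- 1) (1::real) = {- 1..1}" by (simp add: closed_segment_eq_real_ivl)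
  finally show ?thesis by (auto simp: image_iff complex_eq_iff abs_le_iff intro!: bexI[of _ "Re z"])
qed

lemma scale_not_in_unit_segment:
  assumes "z \<notin> closed_segment (- 1) (1 :: complex)" "r \<ge> 1"
  shows "of_real r * z \<notin> closed_segment (- 1) 1"
proof
  assume "of_real r * z \<in> closed_segment (- 1) 1"
  then have a: "r * Im z = 0" "r * \<bar>Re z\<bar> \<le> 1"
    using assms(2) by (auto simp: in_unit_segment abs_mult)
  have "\<bar>Re z\<bar> \<le> r * \<bar>Re z\<bar>" using assms(2) by (simp add: mult_le_cancel_right1)
  then show False using a assms by (auto simp: in_unit_segment)
qed

text \<open>The map \<open>\<rho>\<close> sends the plane without 0 onto the circle of radius 2,
  inside the slit disk, so homotopies about 0 can be moved there. Pushing the loops to that circle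
  moves their base point, hence \<open>hp_square\<close>.\<close>

lemma slit_disk_homotopic:
  assumes p: "path_between slit_disk x x p" and q: "path_between slit_disk x x q"
    and e: "e \<in> closed_segment (- 1) 1" and w: "winding_number p e = winding_number q e"
  shows "homotopic_paths slit_disk p q"
proof -
  define \<rho> where "\<rho> z = of_real (2 / cmod z) * z" for z :: complex
  have nz: "z \<noteq> 0" if "z \<in> slit_disk" for z using that by (auto simp: in_unit_segment)
  have pq: "path p" "path q" "path_image p \<subseteq> slit_disk" "path_image q \<subseteq> slit_disk"
    "pathstart p = x" "pathstart q = x" "pathfinish p = x" "pathfinish q = x"
    using p q by (auto simp: path_between_def)
  have w0: "winding_number s 0 = winding_number s e" if "path_between slit_disk x x s" for s
  proof (rule winding_number_eq[where S = "closed_segment (- 1) 1"])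
    have s: "path s" "pathfinish s = pathstart s" "path_image s \<subseteq> slit_disk"
      using that unfolding path_between_def by blast+
    show "path s" "pathfinish s = pathstart s" by (rule s)+
    show "closed_segment (- 1) 1 \<inter> path_image s = {}" using s(3) by blast
    show "0 \<in> closed_segment (- 1) (1::complex)" by (simp add: in_unit_segment)
  qed (use e in auto)
  have "0 \<notin> path_image p" "0 \<notin> path_image q" using pq nz by blast+
  then have "homotopic_paths (- {0}) p q"
    using winding_number_homotopic_paths_eq[of p 0 q] pq w w0[OF p] w0[OF q] by simp
  then have \<rho>pq: "homotopic_paths slit_disk (\<rho> \<circ> p) (\<rho> \<circ> q)"
  proof (rule homotopic_paths_continuous_image)
    show "continuous_on (- {0}) \<rho>" unfolding \<rho>_def by (intro continuous_intros) auto
    show "\<rho> \<in> - {0} \<rightarrow> slit_disk"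
    proof
      fix z :: complex assume "z \<in> - {0}"
      then have n: "cmod (\<rho> z) = 2" by (simp add: \<rho>_def norm_mult norm_divide)
      moreover have "\<rho> z \<notin> closed_segment (- 1) 1"
      proof
        assume "\<rho> z \<in> closed_segment (- 1) 1"
        then have "cmod (\<rho> z) \<le> 1" by (simp add: in_unit_segment cmod_eq_Re)
        then show False using n by simp
      qed
      ultimately show "\<rho> z \<in> slit_disk" by simp
    qed
  qed
  \<comment> \<open>The factor interpolates between 1 and \<open>2 / cmod z\<close>. It is at least
    1 on the slit disk, so the point moves outwards and never meets the segment.\<close>
  let ?H = "\<lambda>s (z :: complex). of_real (1 + s * (2 / cmod z - 1)) * z"
  let ?l = "\<lambda>s. ?H s x"
  have push: "homotopic_paths slit_disk s (?l +++ ((\<rho> \<circ> s) +++ reversepath ?l))"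
    if s: "path_between slit_disk x x s" for s
  proof -
    have st: "s t \<in> slit_disk" if "t \<in> {0..1}" for t
      using path_between_in[OF s that] .
    let ?G = "\<lambda>y. ?H (fst y) (s (snd y))"
    have "homotopic_paths slit_disk (\<lambda>t. ?G (0, t))
      ((\<lambda>u. ?G (u, 0)) +++ ((\<lambda>t. ?G (1, t)) +++ reversepath (\<lambda>u. ?G (u, 1))))"
    proof (rule hp_square)
      have "continuous_on {0..1} s" using s by (simp add: path_between_def path_def)
      then have "continuous_on ({0..1::real} \<times> {0..1}) (\<lambda>y. s (snd y))"
        by (rule continuous_on_compose2) (auto intro!: continuous_intros)
      then show "continuous_on ({0..1} \<times> {0..1}) ?G"
      proof (intro continuous_intros ballI)
        fix y :: "real \<times> real" assume "y \<in> {0..1} \<times> {0..1}"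
        then have "s (snd y) \<noteq> 0" using st nz by (metis mem_Times_iff)
        then show "cmod (s (snd y)) \<noteq> 0" by simp
      qed auto
      show "?G ` ({0..1} \<times> {0..1}) \<subseteq> slit_disk"
      proof clarify
        fix u t :: real assume ut: "u \<in> {0..1}" "t \<in> {0..1}"
        have z: "cmod (s t) \<le> 2" "s t \<noteq> 0" "s t \<notin> closed_segment (- 1) 1"
          using st[OF ut(2)] nz by auto
        have "2 / cmod (s t) \<ge> 1" using z by simp
        then have r: "1 + u * (2 / cmod (s t) - 1) \<ge> 1" using ut(1) by simp
        have "(1 + u * (2 / cmod (s t) - 1)) * cmod (s t) = (1 - u) * cmod (s t) + u * 2"
          using z by (simp add: field_simps)
        also have "\<dots> \<le> (1 - u) * 2 + u * 2"
          using z ut by (intro add_right_mono mult_left_mono) auto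
        finally have "cmod (?H u (s t)) \<le> 2"
          using r by (simp only: norm_mult norm_of_real) simp
        then show "?G (u, t) \<in> slit_disk"
          using scale_not_in_unit_segment[OF z(3) r] by simp
      qed
    qed
    moreover have "s 0 = x" "s 1 = x" using s by (auto simp: path_between_def pathstart_def pathfinish_def)
    ultimately show ?thesis by (simp add: \<rho>_def o_def)
  qed
  have im: "path_between slit_disk x (\<rho> x) ?l \<and> path_between slit_disk (\<rho> x) (\<rho> x) (\<rho> \<circ> p)"
  proof -
    have h: "path (?l +++ ((\<rho> \<circ> p) +++ reversepath ?l))" "path_image (?l +++ ((\<rho> \<circ> p) +++ reversepath ?l)) \<subseteq> slit_disk"
      using homotopic_paths_imp_path[OF push[OF p]] homotopic_paths_imp_subset[OF push[OF p]] by auto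
    have e: "pathstart ?l = x" "pathfinish ?l = \<rho> x" "pathstart (\<rho> \<circ> p) = \<rho> x" "pathfinish (\<rho> \<circ> p) = \<rho> x"
      using pq by (auto simp: pathstart_def pathfinish_def \<rho>_def o_def)
    then have "path ?l" "path (\<rho> \<circ> p)" using h(1) by auto
    moreover have "path_image ?l \<subseteq> slit_disk" "path_image (\<rho> \<circ> p) \<subseteq> slit_disk"
      using h(2) e by (auto simp: path_image_join)
    ultimately show ?thesis using e by (simp add: path_between_def)
  qed
  have "homotopic_paths slit_disk p (?l +++ ((\<rho> \<circ> p) +++ reversepath ?l))" by (rule push[OF p])
  also have "homotopic_paths slit_disk \<dots> (?l +++ ((\<rho> \<circ> q) +++ reversepath ?l))"
    using im by (intro hp_join_right[OF hp_join_left[OF \<rho>pq]]) blast+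
  also have "homotopic_paths slit_disk \<dots> q" by (rule homotopic_paths_sym[OF push[OF q]])
  finally show ?thesis .
qed

section \<open>The rotation of the twice punctured disk\<close>

lemma half_circles:
  assumes "Im z = 0" "r > 0" "sphere z r \<subseteq> S"
  shows "path_between (S \<inter> {w. Im w \<ge> 0}) (z + of_real r) (z - of_real r) (part_circlepath z r 0 pi)"
    "path_between (S \<inter> {w. Im w \<le> 0}) (z - of_real r) (z + of_real r) (part_circlepath z r pi (2 * pi))"
    "homotopic_paths S (part_circlepath z r 0 (2 * pi)) (part_circlepath z r 0 pi +++ part_circlepath z r pi (2 * pi))"
    "path_between S (z + of_real r) (z + of_real r) (part_circlepath z r 0 (2 * pi))"
proof -
  have e: "exp (\<i> * of_real pi) = - 1" "exp (\<i> * (2 * of_real pi)) = 1"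
    using exp_pi_i exp_two_pi_i by (simp_all add: mult.commute mult.left_commute)
  have im: "path_image (part_circlepath z r s t) \<subseteq> S" for s t
    using path_image_circle_subset[of r z s t] assms by auto
  show "path_between (S \<inter> {w. Im w \<ge> 0}) (z + of_real r) (z - of_real r) (part_circlepath z r 0 pi)"
    using im[of 0 pi] part_circlepath_Im_bounds(1)[of z r 0 pi] assms e by (auto simp: path_between_def)
  show "path_between (S \<inter> {w. Im w \<le> 0}) (z - of_real r) (z + of_real r) (part_circlepath z r pi (2 * pi))"
    using im[of pi "2 * pi"] part_circlepath_Im_bounds(3)[of z r pi "2 * pi"] assms e by (auto simp: path_between_def)
  show "homotopic_paths S (part_circlepath z r 0 (2 * pi)) (part_circlepath z r 0 pi +++ part_circlepath z r pi (2 * pi))"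
    by (rule hp_part_circlepath_split) (use im in auto)
  show "path_between S (z + of_real r) (z + of_real r) (part_circlepath z r 0 (2 * pi))"
    using im[of 0 "2 * pi"] e by (auto simp: path_between_def)
qed

lemma uminus_part_circlepath:
  "uminus \<circ> part_circlepath z r s t = part_circlepath (- z) r (s + pi) (t + pi)"
proof
  fix x
  have "linepath (s + pi) (t + pi) x = linepath s t x + pi"
    by (simp add: linepath_def algebra_simps)
  then have "exp (\<i> * of_real (linepath (s + pi) (t + pi) x)) = - exp (\<i> * of_real (linepath s t x))"
    by (simp add: exp_add distrib_left exp_pi_i')
  then show "(uminus \<circ> part_circlepath z r s t) x = part_circlepath (- z) r (s + pi) (t + pi) x"
    by (simp add: part_circlepath_def)
qed

section \<open>The twist map\<close>

lemma twist_profile_bounds: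
  assumes "twist_profile \<alpha>" "r \<ge> 0"
  shows "0 \<le> \<alpha> r" "\<alpha> r \<le> 1"
proof -
  have a: "antimono_on {0..} \<alpha>" "\<alpha> 0 = 1" "\<And>s. s \<ge> 2 \<Longrightarrow> \<alpha> s = 0"
    using assms(1) by (auto simp: twist_profile_def)
  have "\<alpha> (max r 2) \<le> \<alpha> r" "\<alpha> r \<le> \<alpha> 0"
    using a(1) assms(2) by (auto intro!: monotone_onD[OF a(1)])
  then show "0 \<le> \<alpha> r" "\<alpha> r \<le> 1" using a(2) a(3)[of "max r 2"] by auto
qed

lemma smooth_on_imp_continuous_on: "smooth_on S f \<Longrightarrow> continuous_on S f"
  unfolding smooth_on_def
  by (metis Ck_on.simps(1) continuous_on_cong continuous_on_subset)

lemma continuous_on_twist_map: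
  assumes "twist_profile \<alpha>"
  shows "continuous_on UNIV (twist_map \<alpha>)"
proof -
  have "continuous_on {0..} \<alpha>"
    using assms unfolding twist_profile_def by (intro smooth_on_imp_continuous_on) blast
  then have "continuous_on UNIV (\<lambda>z::complex. \<alpha> (cmod z))"
    by (rule continuous_on_compose2) (auto intro!: continuous_intros)
  then have "continuous_on UNIV (\<lambda>z. cis (\<alpha> (cmod z) * pi))"
    unfolding cis_conv_exp by (intro continuous_intros)
  then show ?thesis unfolding twist_map_def by (rule continuous_on_mult[OF continuous_on_id])
qed

lemma norm_twist_map [simp]: "cmod (twist_map \<alpha> z) = cmod z"
  by (simp add: twist_map_def norm_mult)

lemma twist_map_inner: "twist_profile \<alpha> \<Longrightarrow> cmod z \<le> 3 / 2 \<Longrightarrow> twist_map \<alpha> z = - z"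
  by (simp add: twist_map_def twist_profile_def)

lemma twist_map_outer: "twist_profile \<alpha> \<Longrightarrow> cmod z \<ge> 2 \<Longrightarrow> twist_map \<alpha> z = z"
  by (simp add: twist_map_def twist_profile_def)

lemma twist_map_minus: "twist_map \<alpha> (- z) = - twist_map \<alpha> z"
  by (simp add: twist_map_def)

lemma uminus_eq_one_iff: "- z = (1 :: complex) \<longleftrightarrow> z = - 1" "- z = (- 1 :: complex) \<longleftrightarrow> z = 1"
  by (metis minus_minus)+

definition unit_ends :: "nat \<Rightarrow> complex" where
  "unit_ends j = (if j = 1 then - 1 else 1)"

lemma unit_ends_image: "unit_ends ` {1..2} = {1, - 1}"
proof -
  have "{1..2::nat} = {1, 2}" by auto
  then show ?thesis by (auto simp: unit_ends_def)
qed

interpretation A: slit "cball 0 2" 2 unit_ends "- 2 * \<i>" "2 * \<i>" "- 2" 2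
proof
  show "strict_mono_on {1..2} (\<lambda>i. Re (unit_ends i))"
    by (auto simp: strict_mono_on_def unit_ends_def)
qed (auto simp: unit_ends_def norm_mult)

section \<open>Crossing words in the twice punctured disk\<close>

abbreviation twice_punctured :: "complex set" where
  "twice_punctured \<equiv> cball 0 2 - {1, - 1}"

lemma A_X: "A.X = twice_punctured"
  by (simp only: unit_ends_image)

lemma A_idx: "A.idx 2 = 2" "A.idx (3 / 2) = 2" "A.idx (1 / 2) = 1" "A.idx (- 1 / 2) = 1" "A.idx (- 3 / 2) = 0"
  "A.idx (- 2) = 0" "A.idx (- (1 / 2)) = 1" "A.idx (- (3 / 2)) = 0"
  by (rule A.idxI; auto simp: unit_ends_def)+

text \<open>With radius 1/2 the circle stays within distance 3/2 of the origin, where the twist is z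
  -> -z. The lollipop starts at 2, where the twist is the identity, so its image is a loop with the
  same base point.\<close>

definition circle_loop :: "real \<Rightarrow> complex" where
  "circle_loop = part_circlepath 1 (1 / 2) 0 (2 * pi)"

definition lollipop :: "real \<Rightarrow> complex" where
  "lollipop = linepath 2 (3 / 2) +++ (circle_loop +++ reversepath (linepath 2 (3 / 2)))"

definition outer_circle :: "real \<Rightarrow> complex" where
  "outer_circle = part_circlepath 0 2 0 (2 * pi)"

lemma closed_segment_2: "closed_segment 2 (3 / 2 :: complex) = of_real ` {3 / 2..2}"
proof -
  have "closed_segment 2 (3 / 2 :: complex) = closed_segment (of_real 2) (of_real (3 / 2))" by simp
  also have "\<dots> = of_real ` closed_segment 2 (3 / 2)" by (rule closed_segment_of_real)
  finally show ?thesis by (simp add: closed_segment_eq_real_ivl)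
qed

lemma sphere_1_half: "sphere 1 (1 / 2) \<subseteq> twice_punctured" "z \<in> sphere 1 (1 / 2) \<Longrightarrow> cmod z \<le> 3 / 2"
proof -
  show n: "cmod z \<le> 3 / 2" if "z \<in> sphere 1 (1 / 2)" for z :: complex
    using norm_triangle_ineq[of 1 "z - 1"] that by (simp add: dist_norm norm_minus_commute)
  show "sphere 1 (1 / 2) \<subseteq> twice_punctured"
  proof
    fix z :: complex assume z: "z \<in> sphere 1 (1 / 2)"
    have "dist 1 (- 1 :: complex) = 2" by (simp add: dist_norm)
    then have "z \<noteq> - 1" "z \<noteq> 1" using z by auto
    then show "z \<in> twice_punctured" using n[OF z] by simp
  qed
qed

lemma lollipop_parts:
  "path_between slit_disk 2 (3 / 2) (linepath 2 (3 / 2))"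
  "path_between twice_punctured 2 (3 / 2) (linepath 2 (3 / 2))"
  "path_between twice_punctured (3 / 2) (3 / 2) circle_loop"
  "path_between (cball 1 (1 / 2) - {1}) (3 / 2) (3 / 2) circle_loop"
  "path_between slit_disk 2 2 outer_circle"
proof -
  have "closed_segment 2 (3 / 2) \<subseteq> slit_disk"
    by (auto simp: closed_segment_2 in_unit_segment)
  then show l: "path_between slit_disk 2 (3 / 2) (linepath 2 (3 / 2))" by blast
  have 1: "(1::complex) \<in> closed_segment (- 1) 1" "(- 1::complex) \<in> closed_segment (- 1) 1" by auto
  then show "path_between twice_punctured 2 (3 / 2) (linepath 2 (3 / 2))"
    by (intro path_between_mono[OF l]) blast
  show "path_between twice_punctured (3 / 2) (3 / 2) circle_loop"
    using half_circles(4)[of 1 "1 / 2", OF _ _ sphere_1_half(1)] by (simp add: circle_loop_def)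
  have "sphere 1 (1 / 2) \<subseteq> cball 1 (1 / 2) - {1::complex}" by auto
  then show "path_between (cball 1 (1 / 2) - {1}) (3 / 2) (3 / 2) circle_loop"
    using half_circles(4)[of 1 "1 / 2"] by (simp add: circle_loop_def)
  have "sphere 0 2 \<subseteq> slit_disk"
    by (auto simp: in_unit_segment cmod_eq_Re)
  then show "path_between slit_disk 2 2 outer_circle"
    using half_circles(4)[of 0 2] by (simp add: outer_circle_def)
qed

lemma slit_disk_subset: "slit_disk \<subseteq> twice_punctured"
proof -
  have "(1::complex) \<in> closed_segment (- 1) 1" "(- 1::complex) \<in> closed_segment (- 1) 1" by auto
  then show ?thesis by blast
qed

lemma A_W_seg: "A.W (linepath 2 (3 / 2)) = 0"
  by (rule A.W_lower) (auto simp: closed_segment_2)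

lemma A_W_lollipop: "A.W lollipop = stair 2 - stair 1"
proof -
  note h = half_circles[of 1 "1 / 2" twice_punctured, OF _ _ sphere_1_half(1), simplified]
  have u: "path_between (A.X \<inter> {z. Im z \<ge> 0}) (3 / 2) (1 / 2) (part_circlepath 1 (1 / 2) 0 pi)"
    and l: "path_between (A.X \<inter> {z. Im z \<le> 0}) (1 / 2) (3 / 2) (part_circlepath 1 (1 / 2) pi (2 * pi))"
    unfolding A_X using h(1,2) by auto
  have u': "path_between A.X (3 / 2) (1 / 2) (part_circlepath 1 (1 / 2) 0 pi)"
    and l': "path_between A.X (1 / 2) (3 / 2) (part_circlepath 1 (1 / 2) pi (2 * pi))"
    by (rule path_between_mono[OF u], blast) (rule path_between_mono[OF l], blast)
  have "A.W circle_loop = A.W (part_circlepath 1 (1 / 2) 0 pi +++ part_circlepath 1 (1 / 2) pi (2 * pi))"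
    using h(3) unfolding circle_loop_def by (intro A.W_homotopic) (simp only: A_X)
  also have "\<dots> = stair 2 - stair 1"
    by (simp only: A.W_path_join[OF u' l'] A.W_path_upper[OF u] A.W_path_lower[OF l]) (simp add: A_idx)
  finally have c: "A.W circle_loop = stair 2 - stair 1" .
  note lp = lollipop_parts(2,3)[folded A_X]
  show ?thesis
    unfolding lollipop_def
    by (simp only: A.W_path_join[OF lp(1) path_between_join[OF lp(2) path_between_reversepath[OF lp(1)]]]
        A.W_path_join[OF lp(2) path_between_reversepath[OF lp(1)]] A.W_path_reverse[OF lp(1)] c A_W_seg) simp
qed

lemma A_W_outer_circle: "A.W outer_circle = stair 2"
proof -
  have s: "sphere 0 2 \<subseteq> twice_punctured" by auto
  note h = half_circles[of 0 2 twice_punctured, OF _ _ s, simplified]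
  have u: "path_between (A.X \<inter> {z. Im z \<ge> 0}) 2 (- 2) (part_circlepath 0 2 0 pi)"
    and l: "path_between (A.X \<inter> {z. Im z \<le> 0}) (- 2) 2 (part_circlepath 0 2 pi (2 * pi))"
    unfolding A_X using h(1,2) by auto
  have u': "path_between A.X 2 (- 2) (part_circlepath 0 2 0 pi)"
    and l': "path_between A.X (- 2) 2 (part_circlepath 0 2 pi (2 * pi))"
    by (rule path_between_mono[OF u], blast) (rule path_between_mono[OF l], blast)
  have "A.W outer_circle = A.W (part_circlepath 0 2 0 pi +++ part_circlepath 0 2 pi (2 * pi))"
    using h(3) unfolding outer_circle_def by (intro A.W_homotopic) (simp only: A_X)
  also have "\<dots> = stair 2"
    by (simp only: A.W_path_join[OF u' l'] A.W_path_upper[OF u] A.W_path_lower[OF l]) (simp add: A_idx)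
  finally show ?thesis .
qed

lemma twist_map_maps:
  assumes "twist_profile \<alpha>"
  shows "twist_map \<alpha> ` twice_punctured \<subseteq> twice_punctured"
proof (rule image_subsetI)
  fix z assume z: "z \<in> twice_punctured"
  have "twist_map \<alpha> z \<noteq> 1 \<and> twist_map \<alpha> z \<noteq> - 1"
  proof (cases "cmod z \<le> 3 / 2")
    case True
    then show ?thesis using twist_map_inner[OF assms True] z by (auto simp: uminus_eq_one_iff)
  next
    case False
    then have "cmod (twist_map \<alpha> z) \<noteq> 1" by simp
    then show ?thesis by (metis norm_minus_cancel norm_one)
  qed
  then show "twist_map \<alpha> z \<in> twice_punctured" using z by simp
qed

text \<open>The image of the stem swings through the upper half from 2 to -3/2, which contributes
  \<open>stair 2\<close>. The image of the circle is the circle about -1 started at -3/2, below the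
  axis; it rises through the middle gap and contributes \<open>stair 1\<close>. The stem is then run
  back.\<close>

lemma A_W_twist_lollipop:
  assumes "twist_profile \<alpha>"
  shows "A.W (twist_map \<alpha> \<circ> lollipop) = stair 2 + (stair 1 - stair 2)"
    "path_between twice_punctured 2 2 (twist_map \<alpha> \<circ> lollipop)"
proof -
  let ?h = "twist_map \<alpha>"
  have "path_between twice_punctured 2 2 lollipop"
    unfolding lollipop_def
    by (rule path_between_join[OF lollipop_parts(2) path_between_join[OF lollipop_parts(3)
            path_between_reversepath[OF lollipop_parts(2)]]])
  then have "path_between twice_punctured (?h 2) (?h 2) (?h \<circ> lollipop)"
    by (rule path_between_image[OF _ _ twist_map_maps[OF assms]])
      (rule continuous_on_subset[OF continuous_on_twist_map[OF assms]], simp)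
  moreover have h2: "?h 2 = 2" using twist_map_outer[OF assms, of 2] by simp
  ultimately show "path_between twice_punctured 2 2 (?h \<circ> lollipop)" by simp
  have h32: "?h (3 / 2) = - 3 / 2"
    using twist_map_inner[OF assms, of "3 / 2"] by (simp add: norm_divide)
  have sub: "path_between (twice_punctured \<inter> of_real ` {3 / 2..2}) 2 (3 / 2) (linepath 2 (3 / 2))"
    using lollipop_parts(2) by (auto simp: path_between_def closed_segment_2)
  have s: "path_between (A.X \<inter> {z. Im z \<ge> 0}) (?h 2) (?h (3 / 2)) (?h \<circ> linepath 2 (3 / 2))"
    unfolding A_X
  proof (rule path_between_image[OF sub])
    show "continuous_on (twice_punctured \<inter> of_real ` {3 / 2..2}) ?h"
      by (rule continuous_on_subset[OF continuous_on_twist_map[OF assms]]) simp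
    \<comment> \<open>The rotation angle lies between 0 and \<pi> because the profile has values in
      [0, 1].\<close>
    have "Im (?h (of_real x)) \<ge> 0" if "x \<in> {3 / 2..2}" for x
      using twist_profile_bounds[OF assms, of "\<bar>x\<bar>"] that
      by (auto simp: twist_map_def intro!: mult_nonneg_nonneg sin_ge_zero mult_left_le_one_le)
    then show "?h ` (twice_punctured \<inter> of_real ` {3 / 2..2}) \<subseteq> twice_punctured \<inter> {z. Im z \<ge> 0}"
      using twist_map_maps[OF assms] by blast
  qed
  then have s: "path_between (A.X \<inter> {z. Im z \<ge> 0}) 2 (- 3 / 2) (?h \<circ> linepath 2 (3 / 2))"
    by (simp only: h2 h32)
  have s': "path_between A.X 2 (- 3 / 2) (?h \<circ> linepath 2 (3 / 2))"
    by (rule path_between_mono[OF s]) blast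
  have "circle_loop t \<in> sphere 1 (1 / 2)" for t
    by (simp add: circle_loop_def part_circlepath_def dist_norm norm_mult)
  then have hc: "?h \<circ> circle_loop = uminus \<circ> circle_loop"
    using twist_map_inner[OF assms] sphere_1_half(2) by (auto simp: fun_eq_iff)
  note h = half_circles[of 1 "1 / 2" twice_punctured, OF _ _ sphere_1_half(1), simplified]
  have mu: "uminus ` (twice_punctured \<inter> {w. Im w \<ge> 0}) \<subseteq> twice_punctured \<inter> {w. Im w \<le> 0}"
    "uminus ` (twice_punctured \<inter> {w. Im w \<le> 0}) \<subseteq> twice_punctured \<inter> {w. Im w \<ge> 0}"
    "uminus ` twice_punctured \<subseteq> twice_punctured"
    by (auto simp: uminus_eq_one_iff)
  have cm: "continuous_on S (uminus :: complex \<Rightarrow> complex)" for S by (intro continuous_intros)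
  have l: "path_between (A.X \<inter> {z. Im z \<le> 0}) (- 3 / 2) (- 1 / 2) (uminus \<circ> part_circlepath 1 (1 / 2) 0 pi)"
    unfolding A_X using path_between_image[OF h(1) cm mu(1)] by simp
  have u: "path_between (A.X \<inter> {z. Im z \<ge> 0}) (- 1 / 2) (- 3 / 2) (uminus \<circ> part_circlepath 1 (1 / 2) pi (2 * pi))"
    unfolding A_X using path_between_image[OF h(2) cm mu(2)] by simp
  have u': "path_between A.X (- 1 / 2) (- 3 / 2) (uminus \<circ> part_circlepath 1 (1 / 2) pi (2 * pi))"
    and l': "path_between A.X (- 3 / 2) (- 1 / 2) (uminus \<circ> part_circlepath 1 (1 / 2) 0 pi)"
    by (rule path_between_mono[OF u], blast) (rule path_between_mono[OF l], blast)
  have "homotopic_paths A.X (uminus \<circ> circle_loop)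
      (uminus \<circ> (part_circlepath 1 (1 / 2) 0 pi +++ part_circlepath 1 (1 / 2) pi (2 * pi)))"
    unfolding circle_loop_def A_X
    by (rule homotopic_paths_continuous_image[OF h(3) cm]) (use mu(3) in blast)
  then have "A.W (uminus \<circ> circle_loop) = A.W ((uminus \<circ> part_circlepath 1 (1 / 2) 0 pi)
      +++ (uminus \<circ> part_circlepath 1 (1 / 2) pi (2 * pi)))"
    unfolding path_compose_join by (rule A.W_homotopic)
  also have "\<dots> = stair 1"
    by (simp only: A.W_path_join[OF l' u'] A.W_path_upper[OF u] A.W_path_lower[OF l]) (simp add: A_idx)
  finally have c: "A.W (?h \<circ> circle_loop) = stair 1" by (simp only: hc)
  have c': "path_between A.X (- 3 / 2) (- 3 / 2) (?h \<circ> circle_loop)"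
    unfolding hc A_X using path_between_image[OF lollipop_parts(3) cm mu(3)] by simp
  have "?h \<circ> lollipop = (?h \<circ> linepath 2 (3 / 2)) +++ ((?h \<circ> circle_loop) +++ reversepath (?h \<circ> linepath 2 (3 / 2)))"
    by (simp only: lollipop_def path_compose_join path_compose_reversepath)
  then show "A.W (?h \<circ> lollipop) = stair 2 + (stair 1 - stair 2)"
    by (simp only: A.W_path_join[OF s' path_between_join[OF c' path_between_reversepath[OF s']]]
        A.W_path_join[OF c' path_between_reversepath[OF s']] A.W_path_reverse[OF s'] c A.W_path_upper[OF s])
      (simp add: A_idx)
qed

lemma add_diff_cancel_cycle: "a + (b - a) + (a - b) = (a :: 'a :: group_add)"
proof -
  have "(b - a) + (a - b) = 0" by (metis add.right_inverse minus_diff_eq)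
  then show ?thesis by (simp only: add.assoc add_0_right)
qed

text \<open>The words of the two sides agree by \<open>add_diff_cancel_cycle\<close>, which settles
  \<open>e = 1\<close>. The twist commutes with z -> -z, which gives the other sign; both are needed
  because the image of the left end under an arbitrary \<open>f\<close> may be either of 1 and
  -1.\<close>

lemma twist_lollipop_homotopic:
  assumes "twist_profile \<alpha>" "e \<in> {1, - 1}"
  shows "homotopic_paths twice_punctured
    ((twist_map \<alpha> \<circ> ((*) e \<circ> lollipop)) +++ ((*) e \<circ> lollipop)) ((*) e \<circ> outer_circle)"
proof -
  let ?h = "twist_map \<alpha>"
  have l: "path_between A.X 2 2 lollipop"
    unfolding lollipop_def A_X
    by (rule path_between_join[OF lollipop_parts(2) path_between_join[OF lollipop_parts(3)
            path_between_reversepath[OF lollipop_parts(2)]]])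
  note h = A_W_twist_lollipop[OF assms(1), folded A_X]
  have o: "path_between A.X 2 2 outer_circle"
    by (rule path_between_mono[OF lollipop_parts(5)]) (simp only: A_X slit_disk_subset)
  have "A.W ((?h \<circ> lollipop) +++ lollipop) = A.W outer_circle"
    by (simp only: A.W_path_join[OF h(2) l] h(1) A_W_lollipop A_W_outer_circle add_diff_cancel_cycle)
  then have 1: "homotopic_paths twice_punctured ((?h \<circ> lollipop) +++ lollipop) outer_circle"
    using A.homotopic_iff_W[OF path_between_join[OF h(2) l] o] by (simp only: A_X)
  have "homotopic_paths twice_punctured ((*) e \<circ> ((?h \<circ> lollipop) +++ lollipop)) ((*) e \<circ> outer_circle)"
  proof (rule homotopic_paths_continuous_image[OF 1])
    show "continuous_on twice_punctured ((*) e)" by (intro continuous_intros)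
    show "(*) e \<in> twice_punctured \<rightarrow> twice_punctured" using assms(2) by (auto simp: uminus_eq_one_iff)
  qed
  moreover have "?h \<circ> ((*) e \<circ> lollipop) = (*) e \<circ> (?h \<circ> lollipop)"
    using assms(2) by (auto simp: fun_eq_iff twist_map_minus)
  ultimately show ?thesis by (simp only: path_compose_join)
qed

lemma winding_number_slit_disk:
  assumes "path_between slit_disk x x s" "c \<in> closed_segment (- 1) 1" "d \<in> closed_segment (- 1) 1"
  shows "winding_number s c = winding_number s d"
proof (rule winding_number_eq[where S = "closed_segment (- 1) 1"])
  have s: "path s" "pathfinish s = pathstart s" "path_image s \<subseteq> slit_disk"
    using assms(1) unfolding path_between_def by blast+
  show "path s" "pathfinish s = pathstart s" by (rule s)+
  show "closed_segment (- 1) 1 \<inter> path_image s = {}" using s(3) by blast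
qed (use assms in auto)

lemma rotated_lollipop_parts:
  assumes "e \<in> {1, - 1}"
  shows "path_between slit_disk (2 * e) (3 / 2 * e) ((*) e \<circ> linepath 2 (3 / 2))"
    "path_between (cball e (1 / 2) - {e}) (3 / 2 * e) (3 / 2 * e) ((*) e \<circ> circle_loop)"
    "path_between slit_disk (2 * e) (2 * e) ((*) e \<circ> outer_circle)"
    "winding_number ((*) e \<circ> circle_loop) e = 1"
    "winding_number ((*) e \<circ> outer_circle) e = 1"
    "(*) e \<circ> lollipop = ((*) e \<circ> linepath 2 (3 / 2)) +++ (((*) e \<circ> circle_loop) +++ reversepath ((*) e \<circ> linepath 2 (3 / 2)))"
proof -
  have c: "continuous_on S ((*) e)" for S by (intro continuous_intros)
  have s: "(*) e ` slit_disk \<subseteq> slit_disk"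
    using assms by (auto simp: in_unit_segment)
  have b: "(*) e ` (cball 1 (1 / 2) - {1}) \<subseteq> cball e (1 / 2) - {e}"
    using assms by (auto simp: dist_norm norm_minus_commute)
  show "path_between slit_disk (2 * e) (3 / 2 * e) ((*) e \<circ> linepath 2 (3 / 2))"
    using path_between_image[OF lollipop_parts(1) c s] by (simp add: mult.commute)
  show "path_between (cball e (1 / 2) - {e}) (3 / 2 * e) (3 / 2 * e) ((*) e \<circ> circle_loop)"
    using path_between_image[OF lollipop_parts(4) c b] by (simp add: mult.commute)
  show oc: "path_between slit_disk (2 * e) (2 * e) ((*) e \<circ> outer_circle)"
    using path_between_image[OF lollipop_parts(5) c s] by (simp add: mult.commute)
  have f: "(*) (1::complex) \<circ> p = p" "(*) (- 1 :: complex) \<circ> p = uminus \<circ> p" for p :: "real \<Rightarrow> complex"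
    by (auto simp: fun_eq_iff)
  show "winding_number ((*) e \<circ> circle_loop) e = 1"
    using assms winding_number_full_circle[of "1 / 2" 1 0] winding_number_full_circle[of "1 / 2" "- 1" pi]
    unfolding circle_loop_def by (elim insertE) (simp_all add: f uminus_part_circlepath add.commute)
  have "winding_number ((*) e \<circ> outer_circle) 0 = 1"
    using assms winding_number_full_circle[of 2 0 0] winding_number_full_circle[of 2 0 pi]
    unfolding outer_circle_def by (elim insertE) (simp_all add: f uminus_part_circlepath add.commute)
  moreover have "e \<in> closed_segment (- 1) 1" "0 \<in> closed_segment (- 1) (1::complex)"
    using assms by (auto simp: in_unit_segment)
  ultimately show "winding_number ((*) e \<circ> outer_circle) e = 1"
    using winding_number_slit_disk[OF oc] by metis
  show "(*) e \<circ> lollipop = ((*) e \<circ> linepath 2 (3 / 2)) +++ (((*) e \<circ> circle_loop) +++ reversepath ((*) e \<circ> linepath 2 (3 / 2)))"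
    by (simp only: lollipop_def path_compose_join path_compose_reversepath)
qed

section \<open>Standard generators\<close>

lemma path_between_part_circlepath:
  assumes "r \<ge> 0"
  shows "path_between (sphere z r) (z + rcis r s) (z + rcis r t) (part_circlepath z r s t)"
  using path_image_circle_subset[OF assms] by (auto simp: path_between_def rcis_def cis_conv_exp)

lemma path_between_Int_axis:
  "path_between S a b p \<Longrightarrow> (\<And>z. z \<in> path_image p \<Longrightarrow> P z) \<Longrightarrow> path_between (S \<inter> {z. P z}) a b p"
  unfolding path_between_def by blast

lemma interior_disk: "interior disk = ball 0 1"
  by (simp add: disk_def interior_cball)

locale marked_disk =
  fixes n :: nat and k :: "nat \<Rightarrow> complex"
  assumes points: "\<forall>i\<in>{1..n}. k i \<in> interior disk \<and> Im (k i) = 0"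
    and increasing: "strict_mono_on {1..n} (\<lambda>i. Re (k i))"

sublocale marked_disk \<subseteq> slit disk n k base_pt \<i> "- 1" 1
proof
  fix i assume "i \<in> {1..n}"
  then have i: "k i \<in> ball 0 1" "Im (k i) = 0" using points by (auto simp: interior_disk)
  then have "\<bar>Re (k i)\<bar> < 1" by (simp add: cmod_eq_Re)
  then show "k i \<in> disk" "Im (k i) = 0" "Re (- 1) < Re (k i)" "Re (k i) < Re 1"
    using i by (auto simp: disk_def)
qed (use increasing in \<open>auto simp: disk_def base_pt_def\<close>)

context marked_disk
begin

lemma k_Re: "i \<in> {1..n} \<Longrightarrow> k i = of_real (Re (k i))"
  using k_in(2) by (simp add: complex_eq_iff)

lemma k_inj: "i \<in> {1..n} \<Longrightarrow> j \<in> {1..n} \<Longrightarrow> k i = k j \<Longrightarrow> i = j"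
  using k_less by (metis less_irrefl linorder_neqE_nat)

lemma W_conj:
  assumes "path_between X base_pt x v" "path_between X x x c"
  shows "path_between X base_pt base_pt (v +++ (c +++ reversepath v))"
    "W (v +++ (c +++ reversepath v)) = W v + W c - W v"
proof -
  note r = path_between_reversepath[OF assms(1)]
  show "path_between X base_pt base_pt (v +++ (c +++ reversepath v))"
    by (rule path_between_join[OF assms(1) path_between_join[OF assms(2) r]])
  show "W (v +++ (c +++ reversepath v)) = W v + W c - W v"
    by (simp only: W_path_join[OF assms(1) path_between_join[OF assms(2) r]] W_path_join[OF assms(2) r]
        W_path_reverse[OF assms(1)]) (simp add: add_diff_eq)
qed

definition admissible :: "nat \<Rightarrow> real \<Rightarrow> bool" where
  "admissible i \<epsilon> \<longleftrightarrow> 0 < \<epsilon> \<and> cball (k i) \<epsilon> \<subseteq> interior disk \<and> cball (k i) \<epsilon> \<inter> K = {k i}"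

lemma admissible_small:
  assumes "i \<in> {1..n}"
  obtains e where "e > 0" "\<And>\<epsilon>. 0 < \<epsilon> \<Longrightarrow> \<epsilon> \<le> e \<Longrightarrow> admissible i \<epsilon>"
proof -
  have "open (interior disk - (K - {k i}))"
    by (intro open_Diff finite_imp_closed) auto
  moreover have "k i \<in> interior disk - (K - {k i})" using assms points by blast
  ultimately obtain e where e: "e > 0" "cball (k i) e \<subseteq> interior disk - (K - {k i})"
    unfolding open_contains_cball by blast
  have "admissible i \<epsilon>" if "0 < \<epsilon>" "\<epsilon> \<le> e" for \<epsilon>
  proof -
    have "cball (k i) \<epsilon> \<subseteq> interior disk - (K - {k i})" using e(2) that by (meson subset_cball subset_trans)
    moreover have "k i \<in> cball (k i) \<epsilon>" "k i \<in> K" using that assms by auto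
    ultimately show ?thesis unfolding admissible_def using that(1) by blast
  qed
  then show ?thesis using that e(1) by blast
qed

definition entry_angle :: "nat \<Rightarrow> real" where
  "entry_angle i = Arg (base_pt - k i)"

definition entry_pt :: "nat \<Rightarrow> real \<Rightarrow> complex" where
  "entry_pt i \<epsilon> = k i + rcis \<epsilon> (entry_angle i)"

definition stem :: "nat \<Rightarrow> real \<Rightarrow> real \<Rightarrow> complex" where
  "stem i \<epsilon> = linepath base_pt (entry_pt i \<epsilon>)"

definition small_circle :: "nat \<Rightarrow> real \<Rightarrow> real \<Rightarrow> complex" where
  "small_circle i \<epsilon> = part_circlepath (k i) \<epsilon> (entry_angle i) (entry_angle i + 2 * pi)"

lemma segment_loop_eq: "segment_loop (k i) \<epsilon> = stem i \<epsilon> +++ (small_circle i \<epsilon> +++ reversepath (stem i \<epsilon>))"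
  by (simp add: segment_loop_def stem_def small_circle_def entry_pt_def entry_angle_def Let_def)

context
  fixes i :: nat and \<epsilon> :: real
  assumes i: "i \<in> {1..n}" and adm: "admissible i \<epsilon>"
begin

lemma entry_angle: "- pi < entry_angle i" "entry_angle i < 0"
proof -
  have "Im (base_pt - k i) < 0" using k_in(2)[OF i] by (simp add: base_pt_def)
  then show "- pi < entry_angle i" "entry_angle i < 0"
    by (simp_all add: entry_angle_def mpi_less_Arg Arg_neg_iff)
qed

lemma eps_pos: "\<epsilon> > 0"
  using adm by (simp add: admissible_def)

lemma sphere_in_X: "sphere (k i) \<epsilon> \<subseteq> X"
proof
  fix z assume z: "z \<in> sphere (k i) \<epsilon>"
  then have "z \<in> cball (k i) \<epsilon>" "z \<noteq> k i" using eps_pos by auto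
  then show "z \<in> X" using adm interior_subset unfolding admissible_def by blast
qed

lemma Im_entry_pt: "Im (entry_pt i \<epsilon>) < 0"
proof -
  have "sin (- entry_angle i) > 0" using entry_angle by (intro sin_gt_zero) auto
  then have "sin (entry_angle i) < 0" by simp
  then show ?thesis using eps_pos k_in(2)[OF i] by (simp add: entry_pt_def mult_pos_neg)
qed

lemma entry_pt_sphere: "entry_pt i \<epsilon> \<in> sphere (k i) \<epsilon>"
  using eps_pos by (simp add: entry_pt_def dist_norm)

lemma stem: "path_between (disk \<inter> {z. Im z < 0}) base_pt (entry_pt i \<epsilon>) (stem i \<epsilon>)"
  unfolding stem_def
proof (rule path_between_linepath, rule closed_segment_subset)
  show "base_pt \<in> disk \<inter> {z. Im z < 0}" using bp by simp
  show "entry_pt i \<epsilon> \<in> disk \<inter> {z. Im z < 0}" using entry_pt_sphere sphere_in_X Im_entry_pt by blast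
  show "convex (disk \<inter> {z. Im z < 0})" by (intro convex_Int convex_D convex_halfspace_Im_lt)
qed

lemma lower_open_subset: "disk \<inter> {z. Im z < 0} \<subseteq> X"
  using Im_K by fastforce

lemma stem_X: "path_between X base_pt (entry_pt i \<epsilon>) (stem i \<epsilon>)"
  by (rule path_between_mono[OF stem lower_open_subset])

lemma W_stem: "W (stem i \<epsilon>) = 0"
proof (rule W_lower)
  fix z assume "z \<in> path_image (stem i \<epsilon>)"
  then show "Im z \<le> 0" using stem unfolding path_between_def by auto
qed

lemma small_circle: "path_between (sphere (k i) \<epsilon>) (entry_pt i \<epsilon>) (entry_pt i \<epsilon>) (small_circle i \<epsilon>)"
proof -
  have "rcis \<epsilon> (entry_angle i + 2 * pi) = rcis \<epsilon> (entry_angle i)"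
    by (simp add: rcis_def cis.ctr)
  then show ?thesis
    using path_between_part_circlepath[of \<epsilon> "k i" "entry_angle i" "entry_angle i + 2 * pi"] eps_pos
    by (simp add: small_circle_def entry_pt_def)
qed

lemma small_circle_X: "path_between X (entry_pt i \<epsilon>) (entry_pt i \<epsilon>) (small_circle i \<epsilon>)"
  by (rule path_between_mono[OF small_circle sphere_in_X])

text \<open>Admissibility keeps every other puncture at a distance greater than \<epsilon>, so these
  points lie in the two gaps next to \<open>k i\<close>.\<close>

lemma idx_near: "idx (k i + of_real \<epsilon>) = i" "idx (k i - of_real \<epsilon>) = i - 1"
proof -
  have far: "\<epsilon> < \<bar>Re (k j) - Re (k i)\<bar>" if j: "j \<in> {1..n}" "j \<noteq> i" for j
  proof -
    have "k j \<noteq> k i" using k_inj[OF j(1) i] j(2) by blast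
    moreover have "k j \<in> K" using j by blast
    ultimately have "k j \<notin> cball (k i) \<epsilon>" using adm unfolding admissible_def by blast
    then have "\<epsilon> < cmod (k i - k j)" by (simp add: dist_norm)
    also have "cmod (k i - k j) = \<bar>Re (k j) - Re (k i)\<bar>"
      using k_in(2)[OF j(1)] k_in(2)[OF i] by (simp add: cmod_eq_Re)
    finally show ?thesis .
  qed
  show "idx (k i + of_real \<epsilon>) = i"
  proof (rule idxI)
    show "i \<le> n" using i by simp
    show "Re (k j) < Re (k i + of_real \<epsilon>)" if "j \<in> {1..i}" for j
      using k_le[of j i] that i eps_pos by auto
    show "Re (k i + of_real \<epsilon>) \<le> Re (k j)" if "j \<in> {Suc i..n}" for j
      using far[of j] k_less[of i j] that i by auto
  qed
  show "idx (k i - of_real \<epsilon>) = i - 1"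
  proof (rule idxI)
    show "i - 1 \<le> n" using i by auto
    show "Re (k j) < Re (k i - of_real \<epsilon>)" if "j \<in> {1..i - 1}" for j
    proof -
      have "j < i" "j \<in> {1..n}" using that i by auto
      then show ?thesis using far[of j] k_less[of j i] i by auto
    qed
    show "Re (k i - of_real \<epsilon>) \<le> Re (k j)" if "j \<in> {Suc (i - 1)..n}" for j
      using k_le[of i j] that i eps_pos by auto
  qed
qed

text \<open>The circle starts below the axis, at an angle between -\<pi> and 0. Cut at the angles 0
  and \<pi>, it leaves only the upper half circle, from gap \<open>i\<close> to gap
  \<open>i - 1\<close>, with a nontrivial word.\<close>

lemma W_small_circle: "W (small_circle i \<epsilon>) = fg_gen i"
proof -
  let ?t = "entry_angle i"
  let ?c1 = "part_circlepath (k i) \<epsilon> ?t 0" and ?c2 = "part_circlepath (k i) \<epsilon> 0 pi"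
    and ?c3 = "part_circlepath (k i) \<epsilon> pi (?t + 2 * pi)" and ?c4 = "part_circlepath (k i) \<epsilon> 0 (?t + 2 * pi)"
  have e: "\<epsilon> \<ge> 0" using eps_pos by simp
  note pb = path_between_mono[OF path_between_part_circlepath[OF e, of "k i"] sphere_in_X]
  note im = subset_trans[OF path_image_circle_subset[OF e] sphere_in_X]
  have "homotopic_paths X (small_circle i \<epsilon>) (?c1 +++ ?c4)"
    unfolding small_circle_def by (rule hp_part_circlepath_split[OF _ _ im]) (use entry_angle in auto)
  then have "W (small_circle i \<epsilon>) = W ?c1 + W ?c4"
    using W_homotopic W_path_join[OF pb pb] by metis
  moreover have "homotopic_paths X ?c4 (?c2 +++ ?c3)"
    by (rule hp_part_circlepath_split[OF _ _ im]) (use entry_angle in auto)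
  then have "W ?c4 = W ?c2 + W ?c3"
    using W_homotopic W_path_join[OF pb pb] by metis
  moreover have "W ?c1 = 0"
    by (rule W_lower, rule part_circlepath_Im_bounds(2)[OF k_in(2)[OF i] e, of ?t 0]) (use entry_angle in auto)
  moreover have "W ?c3 = 0"
    by (rule W_lower, rule part_circlepath_Im_bounds(3)[OF k_in(2)[OF i] e, of pi "?t + 2 * pi"]) (use entry_angle in auto)
  moreover have "path_between (X \<inter> {z. Im z \<ge> 0}) (k i + rcis \<epsilon> 0) (k i + rcis \<epsilon> pi) ?c2"
    by (rule path_between_Int_axis[OF pb], rule part_circlepath_Im_bounds(1)[OF k_in(2)[OF i] e, of 0 pi]) auto
  then have "W ?c2 = stair i - stair (i - 1)"
    using W_path_upper k_in(2)[OF i] idx_near by (simp add: rcis_def)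
  moreover have "stair i - stair (i - 1) = fg_gen i"
    using i by (cases i) auto
  ultimately show ?thesis by simp
qed

lemma segment_loop_path: "path_between X base_pt base_pt (segment_loop (k i) \<epsilon>)"
  unfolding segment_loop_eq
  by (rule path_between_join[OF stem_X path_between_join[OF small_circle_X path_between_reversepath[OF stem_X]]])

lemma W_segment_loop: "W (segment_loop (k i) \<epsilon>) = fg_gen i"
  unfolding segment_loop_eq by (simp only: W_conj(2)[OF stem_X small_circle_X] W_stem W_small_circle) simp

text \<open>Consequently the loop meets the axis at most on the small circle, which is how loops
  around other points are seen to avoid the segment of a half-twist.\<close>

lemma segment_loop_image: "path_image (segment_loop (k i) \<epsilon>) \<subseteq> {z. Im z < 0} \<union> sphere (k i) \<epsilon>"
  using path_between_join[OF path_between_mono[OF stem] path_between_join[OF path_between_mono[OF small_circle]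
        path_between_reversepath[OF path_between_mono[OF stem]]], of "{z. Im z < 0} \<union> sphere (k i) \<epsilon>"]
  unfolding segment_loop_eq path_between_def by blast

end

text \<open>The choice made inside \<open>std_gen\<close>, repeated verbatim so that both are the
  same real number.\<close>

definition std_radius :: "nat \<Rightarrow> real" where
  "std_radius i = (SOME \<epsilon>. 0 < \<epsilon> \<and> cball (k i) \<epsilon> \<subseteq> interior disk \<and> cball (k i) \<epsilon> \<inter> K = {k i})"

definition std_loop :: "nat \<Rightarrow> real \<Rightarrow> complex" where
  "std_loop i = segment_loop (k i) (std_radius i)"

lemma admissible_std_radius:
  assumes "i \<in> {1..n}"
  shows "admissible i (std_radius i)"
proof -
  obtain e where "e > 0" "\<And>\<epsilon>. 0 < \<epsilon> \<Longrightarrow> \<epsilon> \<le> e \<Longrightarrow> admissible i \<epsilon>"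
    using admissible_small[OF assms] by blast
  then have "admissible i e" by simp
  then show ?thesis unfolding admissible_def std_radius_def by (rule someI)
qed

lemma std_loop: "i \<in> {1..n} \<Longrightarrow> path_between X base_pt base_pt (std_loop i)"
  unfolding std_loop_def by (rule segment_loop_path[OF _ admissible_std_radius])

lemma W_std_loop: "i \<in> {1..n} \<Longrightarrow> W (std_loop i) = fg_gen i"
  unfolding std_loop_def by (rule W_segment_loop[OF _ admissible_std_radius])

lemma std_gen_eq: "std_gen K (k i) = homotopy_class X (std_loop i)"
  unfolding std_gen_def std_loop_def std_radius_def ..

lemma std_gen_inj: "inj_on (\<lambda>i. std_gen K (k i)) {1..n}"
proof (rule inj_onI)
  fix i j assume ij: "i \<in> {1..n}" "j \<in> {1..n}" "std_gen K (k i) = std_gen K (k j)"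
  then have "homotopic_paths X (std_loop i) (std_loop j)"
    using homotopy_class_eq_iff[OF std_loop[OF ij(1)]] by (simp only: std_gen_eq)
  then have "fg_gen i = fg_gen j" using W_homotopic W_std_loop ij by metis
  then show "i = j" by (simp add: fg_gen_inject)
qed

end

section \<open>The action of a half-twist\<close>

lemma plane_diffeo_facts:
  assumes "plane_diffeo f"
  shows "bij f" "continuous_on UNIV f" "continuous_on UNIV (inv_into UNIV f)" "f differentiable (at z)"
proof -
  show "bij f" using assms by (simp add: plane_diffeo_def)
  have s: "smooth_on UNIV f" "smooth_on UNIV (inv_into UNIV f)" using assms by (auto simp: plane_diffeo_def)
  show "continuous_on UNIV f" "continuous_on UNIV (inv_into UNIV f)"
    using s by (auto intro: smooth_on_imp_continuous_on)
  obtain T g where "UNIV \<subseteq> T" "\<forall>m. Ck_on m g T" "\<forall>x\<in>UNIV. g x = f x"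
    using s(1) unfolding smooth_on_def by blast
  then have "T = UNIV" "g = f" "Ck_on (Suc 0) g T" by auto
  then show "f differentiable (at z)" by simp
qed

text \<open>Removing an end point leaves a segment connected, while removing any other point of
  [-1, 1] disconnects it.\<close>

lemma homeo_segment_end:
  fixes f :: "complex \<Rightarrow> complex"
  assumes "continuous_on UNIV f" "inj f" "f ` closed_segment a b = closed_segment (- 1) 1"
  shows "f a \<in> {1, - 1}"
proof (rule ccontr)
  assume n: "f a \<notin> {1, - 1}"
  have fa: "f a \<in> closed_segment (- 1) 1" using assms(3) by blast
  have "convex (closed_segment a b - {a})"
  proof (cases "a = b")
    case False
    have "closed_segment a b - {a} = (\<lambda>t. a + of_real t * (b - a)) ` {0<..1}"
      using False by (force simp: closed_segment_def image_iff algebra_simps scaleR_conv_of_real)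
    moreover have "convex ((\<lambda>t. a + of_real t * (b - a)) ` {0<..1})"
    proof -
      have "(\<lambda>t. a + of_real t * (b - a)) ` {0<..1} = (\<lambda>z. a + z) ` (\<lambda>t. t *\<^sub>R (b - a)) ` {0<..1}"
        by (simp add: image_image scaleR_conv_of_real)
      then show ?thesis
        by (simp add: convex_translation convex_linear_image linear_scaleR_left del: image_image)
    qed
    ultimately show ?thesis by simp
  qed simp
  then have "connected (f ` (closed_segment a b - {a}))"
    using assms(1) by (intro connected_continuous_image convex_connected) (auto intro: continuous_on_subset)
  also have "f ` (closed_segment a b - {a}) = closed_segment (- 1) 1 - {f a}"
    using assms(2,3) by (metis image_insert image_is_empty image_set_diff image_empty)
  finally have "connected (Re ` (closed_segment (- 1) 1 - {f a}))"
    by (intro connected_continuous_image) (auto intro!: continuous_intros)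
  then have iv: "is_interval (Re ` (closed_segment (- 1) 1 - {f a}))"
    by (simp add: is_interval_connected_1)
  have fa': "Im (f a) = 0" "- 1 \<le> Re (f a)" "Re (f a) \<le> 1"
    using fa by (auto simp: in_unit_segment)
  have "Re (- 1) \<in> Re ` (closed_segment (- 1) 1 - {f a})" "Re 1 \<in> Re ` (closed_segment (- 1) 1 - {f a})"
    using n by (intro imageI; auto)+
  then have m: "- 1 \<in> Re ` (closed_segment (- 1) 1 - {f a})" "1 \<in> Re ` (closed_segment (- 1) 1 - {f a})"
    by simp_all
  \<comment> \<open>An interval containing -1 and 1 contains everything between them, even the
    coordinate of the point that was removed.\<close>
  have "Re (f a) \<in> Re ` (closed_segment (- 1) 1 - {f a})"
    using iv m fa'(2,3) unfolding is_interval_1 by blast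
  then obtain z where "z \<in> closed_segment (- 1) 1" "z \<noteq> f a" "Re z = Re (f a)" by force
  then show False using fa' by (auto simp: in_unit_segment complex_eq_iff)
qed

text \<open>The witnesses \<open>U\<close>, \<open>f\<close> and \<open>\<alpha>\<close> are kept
  arbitrary: the half-twist is an unspecified choice, so the computation has to hold for all of
  them.\<close>

locale half_twist = marked_disk +
  fixes i :: nat and U :: "complex set" and f :: "complex \<Rightarrow> complex" and \<alpha> :: "real \<Rightarrow> real"
  assumes i: "i \<in> {1..<n}"
    and U: "open U" "closed_segment (k i) (k (Suc i)) \<subseteq> U" "closure U \<subseteq> interior disk"
      "closure U \<inter> K = {k i, k (Suc i)}"
    and diffeo: "plane_diffeo f" and orient: "orientation_preserving f"
    and f_seg: "f ` closed_segment (k i) (k (Suc i)) = closed_segment (- 1) 1" and f_U: "f ` U = ball 0 2"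
    and profile: "twist_profile \<alpha>"
begin

definition "\<sigma> = closed_segment (k i) (k (Suc i))"
definition "g = inv_into UNIV f"
text \<open>Either 1 or -1, since the condition on \<open>f\<close> does not say which end of the
  segment goes where. The argument carries this sign along.\<close>

definition "e = f (k i)"
abbreviation "h \<equiv> twist_map \<alpha>"
definition "\<beta> z = g (h (f z))"

lemma i1: "i \<in> {1..n}" and i2: "Suc i \<in> {1..n}"
  using i by auto

lemma fg [simp]: "f (g z) = z" and gf [simp]: "g (f z) = z"
  using plane_diffeo_facts(1)[OF diffeo] by (simp_all add: g_def bij_is_surj surj_f_inv_f bij_is_inj)

lemma inj_f: "inj f" and cont_f: "continuous_on S f" and cont_g: "continuous_on S g"
  using plane_diffeo_facts(1-3)[OF diffeo] by (auto simp: g_def bij_is_inj intro: continuous_on_subset)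

lemma cont_h: "continuous_on S h"
  by (rule continuous_on_subset[OF continuous_on_twist_map[OF profile]]) simp

lemma cont_\<beta>: "continuous_on S \<beta>"
  unfolding \<beta>_def
  by (intro continuous_on_compose2[OF cont_g[of UNIV]] continuous_on_compose2[OF cont_h[of UNIV]] cont_f) auto

lemma f_eq_iff: "f x = f y \<longleftrightarrow> x = y"
  using inj_f by (simp add: inj_eq)

lemma e: "e \<in> {1, - 1}" and f_k2: "f (k (Suc i)) = - e"
proof -
  show 1: "e \<in> {1, - 1}"
    unfolding e_def by (rule homeo_segment_end[OF cont_f inj_f f_seg])
  have "f (k (Suc i)) \<in> {1, - 1}"
    by (rule homeo_segment_end[OF cont_f inj_f]) (use f_seg in \<open>simp add: closed_segment_commute\<close>)
  moreover have "k i \<noteq> k (Suc i)" using k_less[OF i1 i2] by auto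
  then have "f (k (Suc i)) \<noteq> e" by (simp add: e_def f_eq_iff)
  ultimately show "f (k (Suc i)) = - e" using 1 by auto
qed

lemma f_\<sigma>: "f z \<in> closed_segment (- 1) 1 \<longleftrightarrow> z \<in> \<sigma>"
  unfolding \<sigma>_def f_seg[symmetric] by (rule inj_image_mem_iff[OF inj_f])

lemma in_U_iff: "z \<in> U \<longleftrightarrow> cmod (f z) < 2"
proof -
  have "z \<in> U \<longleftrightarrow> f z \<in> f ` U" by (simp only: inj_image_mem_iff[OF inj_f])
  then show ?thesis by (simp add: f_U)
qed

lemma g_cball: "g ` cball 0 2 \<subseteq> closure U"
proof -
  have "g ` ball 0 2 = U" unfolding f_U[symmetric] by (simp add: image_image)
  then have "g ` ball 0 2 \<subseteq> closure U" using closure_subset by simp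
  then have "g ` closure (ball 0 2) \<subseteq> closure U"
    by (rule image_closure_subset[OF cont_g closed_closure])
  then show ?thesis by simp
qed

lemma interior_subset_disk: "interior disk \<subseteq> disk"
  by (rule interior_subset)

lemma ends_f: "f z \<in> {1, - 1} \<longleftrightarrow> z \<in> {k i, k (Suc i)}"
proof -
  have "{1, - 1} = {f (k i), f (k (Suc i))}" using e f_k2 by (auto simp: e_def[symmetric])
  then show ?thesis using f_eq_iff by auto
qed

lemma g_twice_punctured: "g ` twice_punctured \<subseteq> X"
proof (rule image_subsetI)
  fix z assume z: "z \<in> twice_punctured"
  then have "g z \<in> closure U" using g_cball by blast
  moreover have "g z \<notin> {k i, k (Suc i)}" using ends_f[of "g z"] z by auto
  ultimately show "g z \<in> X" using U(3,4) interior_subset_disk by blast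
qed

lemma g_slit_disk: "g ` slit_disk \<subseteq> X - \<sigma>"
proof -
  have "g ` slit_disk \<subseteq> X" using g_twice_punctured slit_disk_subset by blast
  moreover have "g z \<notin> \<sigma>" if "z \<in> slit_disk" for z
    using f_\<sigma>[of "g z"] that by simp
  ultimately show ?thesis by blast
qed

lemma \<beta>_outside: "z \<notin> U \<Longrightarrow> \<beta> z = z"
  using twist_map_outer[OF profile, of "f z"] in_U_iff[of z] by (simp add: \<beta>_def not_less)

lemma \<beta>_U: "z \<in> U \<Longrightarrow> \<beta> z \<in> U"
  by (simp add: \<beta>_def in_U_iff)

lemma \<beta>_ends: "\<beta> (k i) = k (Suc i)" "\<beta> (k (Suc i)) = k i"
proof -
  have "h (f (k i)) = f (k (Suc i))" "h (f (k (Suc i))) = f (k i)"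
    using twist_map_inner[OF profile, of e] twist_map_inner[OF profile, of "- e"] e f_k2
    by (auto simp: e_def[symmetric])
  then show "\<beta> (k i) = k (Suc i)" "\<beta> (k (Suc i)) = k i" by (simp_all add: \<beta>_def)
qed

lemma \<beta>_X: "\<beta> ` X \<subseteq> X"
proof (rule image_subsetI)
  fix z assume z: "z \<in> X"
  show "\<beta> z \<in> X"
  proof (cases "z \<in> U")
    case True
    have "f z \<in> cball 0 2" using True in_U_iff by simp
    moreover have "f z \<notin> {1, - 1}" using ends_f[of z] z i1 i2 by blast
    ultimately have "h (f z) \<in> twice_punctured" using twist_map_maps[OF profile] by blast
    then show ?thesis using g_twice_punctured by (auto simp only: \<beta>_def)
  qed (use z \<beta>_outside in simp)
qed

lemma base_pt_not_U: "base_pt \<notin> U"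
proof
  assume "base_pt \<in> U"
  then have "base_pt \<in> ball 0 1" using U(3) closure_subset[of U] by (auto simp: interior_disk)
  then show False by (simp add: base_pt_def)
qed

lemma \<beta>_base_pt: "\<beta> base_pt = base_pt"
  by (rule \<beta>_outside[OF base_pt_not_U])

lemma \<beta>_path: "path_between X x y p \<Longrightarrow> path_between X (\<beta> x) (\<beta> y) (\<beta> \<circ> p)"
  by (rule path_between_image[OF _ cont_\<beta> \<beta>_X])

text \<open>In the coordinate \<open>f\<close>, a path off \<open>\<sigma>\<close> can be pushed radially out of \<open>ball 0 2\<close>, where the twist
  is the identity.\<close>

lemma \<beta>_fixes_path:
  assumes p: "path_between (X - \<sigma>) x y p" and "x \<notin> U" "y \<notin> U"
  shows "homotopic_paths X (\<beta> \<circ> p) p"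
proof -
  \<comment> \<open>Pushes radially to norm at least 2 and fixes whatever is already there, in
    particular the images of both end points.\<close>
  define P where "P z = of_real (max 1 (2 / cmod z)) * z" for z :: complex
  have "0 \<in> closed_segment (- 1) (1 :: complex)" by (simp add: in_unit_segment)
  then have nz: "f z \<noteq> 0" if "z \<in> X - \<sigma>" for z
    using f_\<sigma>[of z] that by (metis DiffD2)
  let ?q = "f \<circ> p" and ?Y = "f ` (X - \<sigma>)"
  have q: "path_between ?Y (f x) (f y) ?q" by (rule path_between_image[OF p cont_f]) simp
  have P_out: "P z = z" if "cmod z \<ge> 2" for z
    using that by (simp add: P_def max_def divide_simps)
  have P2: "cmod (P z) \<ge> 2" if "z \<noteq> 0" for z
    using that by (auto simp: P_def norm_mult max_def divide_simps)
  have contP: "continuous_on ?Y P"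
    unfolding P_def
  proof (intro continuous_intros ballI)
    fix z assume "z \<in> ?Y"
    then obtain x where "x \<in> X - \<sigma>" "z = f x" by blast
    then show "cmod z \<noteq> 0" using nz by simp
  qed
  have Pq: "path (P \<circ> ?q)"
    using path_between_image[OF q contP subset_refl] by (simp only: path_between_def)
  have xy: "cmod (f x) \<ge> 2" "cmod (f y) \<ge> 2" using assms(2,3) in_U_iff by (auto simp: not_less)
  have seg: "closed_segment (?q t) ((P \<circ> ?q) t) \<subseteq> ?Y" if t: "t \<in> {0..1}" for t
  proof (cases "cmod (?q t) \<ge> 2")
    case True
    then show ?thesis using P_out path_between_in[OF q t] by simp
  next
    case False
    have pt: "p t \<in> X - \<sigma>" using path_between_in[OF p t] .
    have ns: "?q t \<notin> closed_segment (- 1) 1" using f_\<sigma>[of "p t"] pt by simp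
    have n0: "?q t \<noteq> 0" using nz[OF pt] by simp
    show ?thesis
    proof
      fix w assume "w \<in> closed_segment (?q t) ((P \<circ> ?q) t)"
      then obtain s where s: "0 \<le> s" "s \<le> 1" "w = (1 - s) *\<^sub>R ?q t + s *\<^sub>R P (?q t)"
        by (auto simp: closed_segment_def)
      define r where "r = 1 + s * (2 / cmod (?q t) - 1)"
      have m: "2 / cmod (?q t) \<ge> 1" using False n0 by simp
      then have w: "w = of_real r * ?q t"
        using s(3) by (simp add: P_def r_def max_absorb2 scaleR_conv_of_real algebra_simps)
      have r: "r \<ge> 1" using m s by (simp add: r_def)
      have "r * cmod (?q t) = (1 - s) * cmod (?q t) + s * 2"
        using n0 by (simp add: r_def field_simps)
      also have "\<dots> \<le> (1 - s) * 2 + s * 2"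
        using False s by (intro add_right_mono mult_left_mono) auto
      finally have "cmod w \<le> 2" using r by (simp add: w norm_mult)
      then have "w \<in> slit_disk"
        using scale_not_in_unit_segment[OF ns r] by (simp add: w)
      then have "g w \<in> X - \<sigma>" using g_slit_disk by blast
      then have "f (g w) \<in> ?Y" by blast
      then show "w \<in> ?Y" by simp
    qed
  qed
  have ends: "pathstart (P \<circ> ?q) = pathstart ?q" "pathfinish (P \<circ> ?q) = pathfinish ?q"
    using P_out[OF xy(1)] P_out[OF xy(2)] p by (simp_all add: path_between_def pathstart_compose pathfinish_compose)
  have "homotopic_paths ?Y ?q (P \<circ> ?q)"
    by (rule homotopic_paths_linear) (use q Pq ends seg in \<open>auto simp: path_between_def\<close>)
  then have "homotopic_paths X (g \<circ> ?q) (g \<circ> (P \<circ> ?q))"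
    by (rule homotopic_paths_continuous_image[OF _ cont_g]) auto
  moreover have "g \<circ> ?q = p" by auto
  ultimately have hp: "homotopic_paths X p (g \<circ> (P \<circ> ?q))" by simp
  have "homotopic_paths X (\<beta> \<circ> p) (\<beta> \<circ> (g \<circ> (P \<circ> ?q)))"
    by (rule homotopic_paths_continuous_image[OF hp cont_\<beta>]) (use \<beta>_X in blast)
  \<comment> \<open>The pushed path lies where the twist is the identity, so \<beta> leaves it
    unchanged pointwise.\<close>
  also have "homotopic_paths X \<dots> (g \<circ> (P \<circ> ?q))"
  proof (rule homotopic_paths_sym, rule homotopic_paths_eq)
    show "path (g \<circ> (P \<circ> ?q))" using homotopic_paths_imp_path[OF hp] by simp
    show "path_image (g \<circ> (P \<circ> ?q)) \<subseteq> X" using homotopic_paths_imp_subset[OF hp] by simp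
    fix t :: real assume t: "t \<in> {0..1}"
    have "f (p t) \<noteq> 0" using nz path_between_in[OF p t] by blast
    then have "h (P (f (p t))) = P (f (p t))" using twist_map_outer[OF profile P2] by blast
    then show "(g \<circ> (P \<circ> ?q)) t = (\<beta> \<circ> (g \<circ> (P \<circ> ?q))) t" by (simp add: \<beta>_def)
  qed
  also have "homotopic_paths X \<dots> p" by (rule homotopic_paths_sym[OF hp])
  finally show ?thesis .
qed

lemma W_\<beta>_fixed:
  assumes "path_between (X - \<sigma>) x y p" "x \<notin> U" "y \<notin> U"
  shows "W (\<beta> \<circ> p) = W p"
  by (rule W_homotopic[OF \<beta>_fixes_path[OF assms]])

lemma \<sigma>_axis: "z \<in> \<sigma> \<Longrightarrow> Im z = 0 \<and> Re (k i) \<le> Re z \<and> Re z \<le> Re (k (Suc i))"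
proof -
  assume "z \<in> \<sigma>"
  then obtain s where s: "0 \<le> s" "s \<le> 1" "z = (1 - s) *\<^sub>R k i + s *\<^sub>R k (Suc i)"
    by (auto simp: \<sigma>_def closed_segment_def)
  have l: "Re (k i) < Re (k (Suc i))" using k_less[OF i1 i2] by simp
  have "Re z = Re (k i) + s * (Re (k (Suc i)) - Re (k i))" "Re z = Re (k (Suc i)) - (1 - s) * (Re (k (Suc i)) - Re (k i))"
    unfolding s(3) by (simp_all add: algebra_simps)
  moreover have "0 \<le> s * (Re (k (Suc i)) - Re (k i))" "0 \<le> (1 - s) * (Re (k (Suc i)) - Re (k i))"
    using s(1,2) l by (auto intro!: mult_nonneg_nonneg)
  moreover have "Im z = 0"
    unfolding s(3) using k_in(2)[OF i1] k_in(2)[OF i2] by simp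
  ultimately show ?thesis by linarith
qed

text \<open>The loop can meet the axis only at its two points near \<open>k j\<close>, which lie in
  the gaps \<open>j - 1\<close> and \<open>j\<close>. Between its ends the segment \<sigma> lies in
  gap \<open>i\<close>, which is neither of these, so the loop avoids \<sigma> and
  \<open>W_\<beta>_fixed\<close> applies.\<close>

lemma W_\<beta>_other:
  assumes j: "j \<in> {1..n}" "j \<noteq> i" "j \<noteq> Suc i"
  shows "W (\<beta> \<circ> std_loop j) = fg_gen j"
proof -
  note adm = admissible_std_radius[OF j(1)]
  have "path_image (std_loop j) \<inter> \<sigma> = {}"
  proof -
    have "z \<notin> \<sigma>" if z: "z \<in> sphere (k j) (std_radius j)" for z
    proof
      assume "z \<in> \<sigma>"
      then have s: "Im z = 0" "Re (k i) \<le> Re z" "Re z \<le> Re (k (Suc i))" using \<sigma>_axis by auto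
      have pos: "std_radius j > 0" by (rule eps_pos[OF j(1) adm])
      have d: "\<bar>Re z - Re (k j)\<bar> = std_radius j"
        using z s(1) k_in(2)[OF j(1)] by (simp add: dist_norm cmod_eq_Re abs_minus_commute)
      then have "z = k j + of_real (std_radius j) \<or> z = k j - of_real (std_radius j)"
        using s(1) k_in(2)[OF j(1)] by (auto simp: complex_eq_iff abs_if split: if_splits)
      then have "idx z \<in> {j - 1, j}"
        using idx_near[OF j(1) adm] by blast
      moreover have "z \<in> X" using sphere_in_X[OF j(1) adm] z by blast
      then have "z \<noteq> k i" "z \<noteq> k (Suc i)" using i1 i2 by blast+
      then have "Re (k i) < Re z" "Re z < Re (k (Suc i))"
        using s k_in(2)[OF i1] k_in(2)[OF i2] by (auto simp: complex_eq_iff)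
      have "idx z = i"
      proof (rule idxI)
        show "i \<le> n" using i by simp
        show "Re (k l) < Re z" if "l \<in> {1..i}" for l
          using k_le[of l i] that i \<open>Re (k i) < Re z\<close> by auto
        show "Re z \<le> Re (k l)" if "l \<in> {Suc i..n}" for l
          using k_le[of "Suc i" l] that i \<open>Re z < Re (k (Suc i))\<close> by auto
      qed
      ultimately show False using j by auto
    qed
    then show ?thesis
      using segment_loop_image[OF j(1) adm] \<sigma>_axis unfolding std_loop_def by fastforce
  qed
  then have "path_between (X - \<sigma>) base_pt base_pt (std_loop j)"
    using std_loop[OF j(1)] unfolding path_between_def by blast
  then show ?thesis using W_\<beta>_fixed base_pt_not_U W_std_loop[OF j(1)] by metis
qed

text \<open>The image condition places the small circle in the disk of radius 1/2 about
  \<open>e\<close>, where it is compared with \<open>circle_loop\<close>; the condition on \<sigma>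
  leaves room in \<open>U\<close> for a thin loop around both ends.\<close>

lemma small_radius:
  obtains \<epsilon> where "admissible i \<epsilon>" "f ` cball (k i) \<epsilon> \<subseteq> ball e (1 / 2)" "(\<Union>x\<in>\<sigma>. cball x \<epsilon>) \<subseteq> U"
    "admissible (Suc i) \<epsilon>"
proof -
  obtain e1 where e1: "e1 > 0" "\<And>\<epsilon>. 0 < \<epsilon> \<Longrightarrow> \<epsilon> \<le> e1 \<Longrightarrow> admissible i \<epsilon>"
    using admissible_small[OF i1] by blast
  obtain e4 where e4: "e4 > 0" "\<And>\<epsilon>. 0 < \<epsilon> \<Longrightarrow> \<epsilon> \<le> e4 \<Longrightarrow> admissible (Suc i) \<epsilon>"
    using admissible_small[OF i2] by blast
  have "open (f -` ball e (1 / 2))" using cont_f[of UNIV] by (simp add: open_vimage)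
  moreover have "k i \<in> f -` ball e (1 / 2)" by (simp add: e_def)
  ultimately obtain e2 where e2: "e2 > 0" "cball (k i) e2 \<subseteq> f -` ball e (1 / 2)"
    unfolding open_contains_cball by blast
  obtain e3 where e3: "e3 > 0" "(\<Union>x\<in>\<sigma>. cball x e3) \<subseteq> U"
    using compact_subset_open_imp_cball_epsilon_subset[of \<sigma> U] U(1,2) unfolding \<sigma>_def by auto
  define \<epsilon> where "\<epsilon> = min (min e1 e4) (min e2 e3)"
  have \<epsilon>: "0 < \<epsilon>" "\<epsilon> \<le> e1" "\<epsilon> \<le> e2" "\<epsilon> \<le> e3" "\<epsilon> \<le> e4" using e1 e2 e3 e4 by (auto simp: \<epsilon>_def)
  have "cball (k i) \<epsilon> \<subseteq> cball (k i) e2" "\<And>x. cball x \<epsilon> \<subseteq> cball x e3" using \<epsilon> by auto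
  then show ?thesis
    using e1(2)[OF \<epsilon>(1,2)] e4(2)[OF \<epsilon>(1,5)] e2(2) e3(2) by (intro that[of \<epsilon>]) blast+
qed

text \<open>Here the orientation of \<open>f\<close> enters, through its Jacobian determinant at
  \<open>k i\<close>.\<close>

lemma winding_f:
  assumes "path_between (UNIV - {k i}) x x p" "winding_number p (k i) = 1"
  shows "winding_number (f \<circ> p) e = 1"
  unfolding e_def
proof (rule winding_number_image_at[OF cont_f inj_f])
  let ?A = "frechet_derivative f (at (k i))"
  show "(f has_derivative ?A) (at (k i))"
    using plane_diffeo_facts(4)[OF diffeo] by (simp add: frechet_derivative_works)
  show "0 < Re (?A 1) * Im (?A \<i>) - Re (?A \<i>) * Im (?A 1)"
    using orient by (simp add: orientation_preserving_def jacobian_det_def Let_def)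
qed (use assms in \<open>auto simp: path_between_def\<close>)

end

section \<open>The images of the two generators at the ends of the segment\<close>

context half_twist
begin

text \<open>A path \<open>v\<close> off \<sigma>, from the base point to the edge of
  \<open>U\<close>, is chosen so that conjugating by it turns the lollipop into the loop around
  \<open>k i\<close> and the outer circle into the loop around both ends. The twist fixes
  \<open>v\<close>, so the relation of \<open>twist_lollipop_homotopic\<close> becomes an equation
  for the unknown image. The second image follows from a loop that the twist fixes.\<close>

lemma W_\<beta>_first_two:
  "W (\<beta> \<circ> std_loop i) = fg_gen (Suc i)"
  "W (\<beta> \<circ> std_loop (Suc i)) = fg_gen (Suc i) + fg_gen i - fg_gen (Suc i)"
proof -
  obtain \<epsilon> where \<epsilon>: "admissible i \<epsilon>" "f ` cball (k i) \<epsilon> \<subseteq> ball e (1 / 2)" "(\<Union>x\<in>\<sigma>. cball x \<epsilon>) \<subseteq> U"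
    "admissible (Suc i) \<epsilon>"
    by (rule small_radius)
  note pos = eps_pos[OF i1 \<epsilon>(1)]
  let ?a = "k i" and ?b = "k (Suc i)" and ?x = "entry_pt i \<epsilon>"
  let ?T = "stem i \<epsilon>" and ?c = "small_circle i \<epsilon>"
  let ?y = "f ?x" and ?z = "3 / 2 * e" and ?w = "2 * e"
  have x_im: "Im ?x < 0" by (rule Im_entry_pt[OF i1 \<epsilon>(1)])
  have x_sph: "?x \<in> sphere ?a \<epsilon>" by (rule entry_pt_sphere[OF i1 \<epsilon>(1)])
  have x\<sigma>: "?x \<notin> \<sigma>" using \<sigma>_axis x_im by force
  have T: "path_between (X - \<sigma>) base_pt ?x ?T"
    by (rule path_between_mono[OF stem[OF i1 \<epsilon>(1)]])
      (use lower_open_subset[OF i1 \<epsilon>(1)] \<sigma>_axis in fastforce)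
  have T_X: "path_between X base_pt ?x ?T" by (rule path_between_mono[OF T]) blast
  have y_ball: "?y \<in> ball e (1 / 2)" using \<epsilon>(2) x_sph sphere_cball by blast
  have y_ns: "?y \<notin> closed_segment (- 1) 1" using x\<sigma> f_\<sigma> by simp

  text \<open>The segment \<open>d\<close> leads from \<open>f x\<close> to the real axis beyond \<open>e\<close>.\<close>
  let ?d = "linepath ?y ?z" and ?s = "(*) e \<circ> linepath 2 (3 / 2)" and ?C = "(*) e \<circ> circle_loop"
    and ?O = "(*) e \<circ> outer_circle" and ?L = "(*) e \<circ> lollipop"
  note rl = rotated_lollipop_parts[OF e]
  have d_seg: "closed_segment ?y ?z \<subseteq> cball e (1 / 2) - closed_segment (- 1) 1"
  proof
    fix w assume w: "w \<in> closed_segment ?y ?z"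
    have "?z \<in> cball e (1 / 2)" using e by (auto simp: dist_norm)
    then have "closed_segment ?y ?z \<subseteq> cball e (1 / 2)"
      using y_ball by (intro closed_segment_subset) auto
    moreover have "w \<notin> closed_segment (- 1) 1"
    proof
      assume ws: "w \<in> closed_segment (- 1) 1"
      obtain s where s: "0 \<le> s" "s \<le> 1" "w = (1 - s) *\<^sub>R ?y + s *\<^sub>R ?z"
        using w by (auto simp: closed_segment_def)
      \<comment> \<open>Multiplying by \<open>Re e\<close> measures positions in the direction of
        \<open>e\<close> and treats both signs at once: the slit has coordinates at most 1, the end
        point \<open>3 / 2 * e\<close> has 3/2, and if \<open>f x\<close> is on the axis its
        coordinate exceeds 1.\<close>
      have ee: "Im e = 0" "Re e * Re e = 1" "\<bar>Re e\<bar> = 1" using e by auto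
      have im: "(1 - s) * Im ?y = 0" using ws s(3) ee by (simp add: in_unit_segment)
      have wle: "Re e * Re w \<le> 1"
      proof -
        have "Re e * Re w \<le> \<bar>Re e * Re w\<bar>" by simp
        also have "\<dots> = \<bar>Re w\<bar>" using ee by (simp add: abs_mult)
        finally show ?thesis using ws by (simp add: in_unit_segment)
      qed
      have "Re e * Re w = (1 - s) * (Re e * Re ?y) + s * (3 / 2) * (Re e * Re e)"
        unfolding s(3) by (simp add: algebra_simps)
      then have rw: "Re e * Re w = (1 - s) * (Re e * Re ?y) + s * (3 / 2)" using ee by simp
      show False
      proof (cases "s = 1")
        case True
        then show ?thesis using rw wle by simp
      next
        case False
        then have iy: "Im ?y = 0" using im by simp
        then have "\<bar>Re ?y\<bar> > 1" using y_ns by (simp add: in_unit_segment)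
        moreover have "\<bar>Re ?y - Re e\<bar> < 1 / 2"
          using y_ball abs_Re_le_cmod[of "?y - e"] by (simp add: dist_norm norm_minus_commute)
        ultimately have "Re e * Re ?y > 1" using e by (auto simp: abs_if split: if_splits)
        then have "(1 - s) * 1 < (1 - s) * (Re e * Re ?y)"
          using False s by (intro mult_strict_left_mono) auto
        then show ?thesis using rw wle s by simp
      qed
    qed
    ultimately show "w \<in> cball e (1 / 2) - closed_segment (- 1) 1" using w by blast
  qed
  have eseg: "e \<in> closed_segment (- 1) 1" using e by (auto simp: in_unit_segment)
  have cb2: "cball e (1 / 2) \<subseteq> cball 0 2"
  proof
    fix w assume "w \<in> cball e (1 / 2)"
    then show "w \<in> cball 0 2"
      using norm_triangle_ineq[of e "w - e"] e by (auto simp: dist_norm norm_minus_commute)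
  qed
  have d1: "path_between (cball e (1 / 2) - {e}) ?y ?z ?d"
    by (rule path_between_linepath) (use d_seg eseg in blast)
  have d2: "path_between slit_disk ?y ?z ?d"
    by (rule path_between_linepath) (use d_seg cb2 in blast)

  have gim: "path_between X (g x) (g y) (g \<circ> p)" if "path_between twice_punctured x y p" for x y p
    by (rule path_between_image[OF that cont_g g_twice_punctured])
  have gim': "path_between (X - \<sigma>) (g x) (g y) (g \<circ> p)" if "path_between slit_disk x y p" for x y p
    by (rule path_between_image[OF that cont_g g_slit_disk])
  have C2: "path_between twice_punctured ?z ?z ?C"
  proof (rule path_between_mono[OF rl(2)])
    have "- e \<notin> cball e (1 / 2)" using e by (auto simp: dist_norm)
    then show "cball e (1 / 2) - {e} \<subseteq> twice_punctured" using cb2 e by auto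
  qed
  have gx: "g ?y = ?x" by simp
  note sd = path_between_mono[OF _ slit_disk_subset]
  have gd: "path_between X ?x (g ?z) (g \<circ> ?d)" using gim[OF sd[OF d2]] gx by simp
  have gs: "path_between X (g ?w) (g ?z) (g \<circ> ?s)" by (rule gim[OF sd[OF rl(1)]])
  have gC: "path_between X (g ?z) (g ?z) (g \<circ> ?C)" by (rule gim[OF C2])
  have gO: "path_between X (g ?w) (g ?w) (g \<circ> ?O)" by (rule gim[OF sd[OF rl(3)]])
  have gL_eq: "g \<circ> ?L = (g \<circ> ?s) +++ ((g \<circ> ?C) +++ reversepath (g \<circ> ?s))"
    by (simp only: rl(6) path_compose_join path_compose_reversepath)
  have gL: "path_between X (g ?w) (g ?w) (g \<circ> ?L)"
    unfolding gL_eq by (rule path_between_join[OF gs path_between_join[OF gC path_between_reversepath[OF gs]]])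
  have W_gL: "W (g \<circ> ?L) = W (g \<circ> ?s) + W (g \<circ> ?C) - W (g \<circ> ?s)"
    unfolding gL_eq
    by (simp only: W_path_join[OF gs path_between_join[OF gC path_between_reversepath[OF gs]]]
        W_path_join[OF gC path_between_reversepath[OF gs]] W_path_reverse[OF gs]) (simp add: add_diff_eq)

  text \<open>\<open>v\<close> is the stem continued to a point outside \<open>U\<close>.\<close>
  define v where "v = ?T +++ ((g \<circ> ?d) +++ reversepath (g \<circ> ?s))"
  have v: "path_between (X - \<sigma>) base_pt (g ?w) v"
  proof -
    have "path_between (X - \<sigma>) ?x (g ?z) (g \<circ> ?d)" using gim'[OF d2] gx by simp
    then show ?thesis
      unfolding v_def by (rule path_between_join[OF T path_between_join[OF _ path_between_reversepath[OF gim'[OF rl(1)]]]])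
  qed
  have v_X: "path_between X base_pt (g ?w) v" by (rule path_between_mono[OF v]) blast
  have w_out: "g ?w \<notin> U" using in_U_iff[of "g ?w"] e by (auto simp: norm_mult)
  have W_v: "W v = W (g \<circ> ?d) - W (g \<circ> ?s)"
    unfolding v_def
    by (simp only: W_path_join[OF T_X path_between_join[OF gd path_between_reversepath[OF gs]]]
        W_path_join[OF gd path_between_reversepath[OF gs]] W_path_reverse[OF gs] W_stem[OF i1 \<epsilon>(1)]) simp

  have small_sub: "sphere ?a \<epsilon> \<subseteq> UNIV - {?a}" using pos by auto
  have c_pb: "path_between (UNIV - {?a}) ?x ?x ?c"
    by (rule path_between_mono[OF small_circle[OF i1 \<epsilon>(1)] small_sub])
  have wc: "winding_number ?c ?a = 1"
    unfolding small_circle_def by (rule winding_number_full_circle[OF pos])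
  have fc: "path_between (cball e (1 / 2) - {e}) ?y ?y (f \<circ> ?c)"
  proof (rule path_between_image[OF small_circle[OF i1 \<epsilon>(1)] cont_f])
    show "f ` sphere ?a \<epsilon> \<subseteq> cball e (1 / 2) - {e}"
    proof (rule image_subsetI)
      fix z assume z: "z \<in> sphere ?a \<epsilon>"
      then have "f z \<in> ball e (1 / 2)" using \<epsilon>(2) sphere_cball by blast
      moreover have "f z \<noteq> e" using z pos by (auto simp: e_def f_eq_iff)
      ultimately show "f z \<in> cball e (1 / 2) - {e}" by simp
    qed
  qed
  have wn_conj: "winding_number (p +++ (q +++ reversepath p)) e = winding_number q e"
    if "path_between (UNIV - {e}) x y p" "path_between (UNIV - {e}) y y q" for x y p q
  proof -
    have *: "path p" "path q" "e \<notin> path_image p" "e \<notin> path_image q" "pathfinish p = y" "pathstart q = y" "pathfinish q = y"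
      using that by (auto simp: path_between_def)
    then have "winding_number (q +++ reversepath p) e = winding_number q e - winding_number p e"
      by (simp add: winding_number_join winding_number_reversepath)
    then show ?thesis
      using * by (simp add: winding_number_join path_image_join)
  qed
  \<comment> \<open>Both loops wind once about \<open>e\<close>, one by \<open>winding_f\<close> and
    the other by construction.\<close>
  have "homotopic_paths (cball e (1 / 2) - {e}) (f \<circ> ?c) (?d +++ (?C +++ reversepath ?d))"
  proof (rule punctured_cball_homotopic[OF fc])
    show "path_between (cball e (1 / 2) - {e}) ?y ?y (?d +++ (?C +++ reversepath ?d))"
      by (rule path_between_join[OF d1 path_between_join[OF rl(2) path_between_reversepath[OF d1]]])
    have "winding_number (?d +++ (?C +++ reversepath ?d)) e = winding_number ?C e"
      by (rule wn_conj[OF path_between_mono[OF d1] path_between_mono[OF rl(2)]]) auto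
    then show "winding_number (f \<circ> ?c) e = winding_number (?d +++ (?C +++ reversepath ?d)) e"
      using winding_f[OF c_pb wc] rl(4) by simp
  qed
  then have "homotopic_paths X (g \<circ> (f \<circ> ?c)) (g \<circ> (?d +++ (?C +++ reversepath ?d)))"
  proof (rule homotopic_paths_continuous_image[OF _ cont_g])
    have "- e \<notin> cball e (1 / 2)" using e by (auto simp: dist_norm)
    then have "cball e (1 / 2) - {e} \<subseteq> twice_punctured" using cb2 e by auto
    then show "g \<in> cball e (1 / 2) - {e} \<rightarrow> X" using g_twice_punctured by blast
  qed
  moreover have "g \<circ> (f \<circ> ?c) = ?c" by auto
  ultimately have "W ?c = W (g \<circ> (?d +++ (?C +++ reversepath ?d)))" using W_homotopic by metis
  also have "g \<circ> (?d +++ (?C +++ reversepath ?d)) = (g \<circ> ?d) +++ ((g \<circ> ?C) +++ reversepath (g \<circ> ?d))"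
    by (simp only: path_compose_join path_compose_reversepath)
  also have "W \<dots> = W (g \<circ> ?d) + W (g \<circ> ?C) - W (g \<circ> ?d)"
    by (simp only: W_path_join[OF gd path_between_join[OF gC path_between_reversepath[OF gd]]]
        W_path_join[OF gC path_between_reversepath[OF gd]] W_path_reverse[OF gd]) (simp add: add_diff_eq)
  finally have W_c: "fg_gen i = W (g \<circ> ?d) + W (g \<circ> ?C) - W (g \<circ> ?d)"
    using W_small_circle[OF i1 \<epsilon>(1)] by simp

  \<comment> \<open>The stem has a trivial word, and the part of \<open>v\<close> that runs back
    along the lollipop stem cancels; what is left is the conjugate computed in
    \<open>W_c\<close>.\<close>
  have conj1: "W (v +++ ((g \<circ> ?L) +++ reversepath v)) = fg_gen i"
  proof -
    have "W (v +++ ((g \<circ> ?L) +++ reversepath v)) = W v + W (g \<circ> ?L) - W v"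
      by (rule W_conj(2)[OF v_X gL])
    then show ?thesis unfolding W_v W_gL W_c
      by (simp add: add_diff_eq diff_diff_eq2) (simp add: add.assoc[symmetric])
  qed

  text \<open>A thin loop \<open>Q\<close> around \<open>\<sigma>\<close>.\<close>
  let ?N = "{y + z |y z. y \<in> \<sigma> \<and> z \<in> cball 0 \<epsilon>}"
  have N_U: "?N \<subseteq> U"
  proof
    fix w assume "w \<in> ?N"
    then obtain y z where yz: "y \<in> \<sigma>" "z \<in> cball 0 \<epsilon>" "w = y + z" by blast
    then have "w \<in> cball y \<epsilon>" by (simp add: dist_norm)
    then show "w \<in> U" using \<epsilon>(3) yz(1) by blast
  qed
  have N_conv: "convex {y + z |y z. y \<in> \<sigma> \<and> z \<in> cball 0 \<epsilon>}"
  proof -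
    have "{y + z |y z. y \<in> \<sigma> \<and> z \<in> cball 0 \<epsilon>} = (\<Union>y\<in>\<sigma>. \<Union>z\<in>cball 0 \<epsilon>. {y + z})" by blast
    then show ?thesis using convex_sums[of \<sigma> "cball 0 \<epsilon>"] by (simp add: \<sigma>_def)
  qed
  have N_I: "y + z \<in> ?N" if "y \<in> \<sigma>" "cmod z \<le> \<epsilon>" for y z using that by auto
  have ab: "?a \<in> \<sigma>" "?b \<in> \<sigma>" by (auto simp: \<sigma>_def)
  let ?r = "?b + of_real \<epsilon>" and ?l = "?a - of_real \<epsilon>" and ?t = "?a + \<i> * of_real \<epsilon>"
  have pts: "?x \<in> ?N" "?r \<in> ?N" "?l \<in> ?N" "?t \<in> ?N"
  proof -
    have "cmod (?x - ?a) \<le> \<epsilon>" using x_sph by (simp add: dist_norm norm_minus_commute)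
    then have "?a + (?x - ?a) \<in> ?N" by (rule N_I[OF ab(1)])
    then show "?x \<in> ?N" by simp
    show "?r \<in> ?N" using N_I[OF ab(2), of "of_real \<epsilon>"] pos by simp
    show "?l \<in> ?N" using N_I[OF ab(1), of "- of_real \<epsilon>"] pos by simp
    show "?t \<in> ?N" using N_I[OF ab(1), of "\<i> * of_real \<epsilon>"] pos by (simp add: norm_mult)
  qed
  let ?M = "?N - \<sigma>"
  have rl_im: "Im ?r = 0" "Im ?l = 0" "Im ?t > 0" "?r \<notin> \<sigma>" "?l \<notin> \<sigma>"
    using k_in(2)[OF i1] k_in(2)[OF i2] pos \<sigma>_axis[of ?r] \<sigma>_axis[of ?l] by auto
  have seg_lo: "path_between (?M \<inter> {z. Im z \<le> 0}) p q (linepath p q)"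
    if "p \<in> ?N" "q \<in> ?N" "Im p < 0" "Im q = 0" "q \<notin> \<sigma>" for p q
  proof (rule path_between_linepath, rule subsetI)
    fix w assume w: "w \<in> closed_segment p q"
    then obtain s where s: "0 \<le> s" "s \<le> 1" "w = (1 - s) *\<^sub>R p + s *\<^sub>R q" by (auto simp: closed_segment_def)
    have "w \<in> ?N" using closed_segment_subset[OF that(1,2) N_conv] w by blast
    moreover have "Im w \<le> 0" using s that by (simp add: mult_nonneg_nonpos)
    moreover have "w \<notin> \<sigma>"
    proof
      assume "w \<in> \<sigma>"
      then have "(1 - s) * Im p = 0" using \<sigma>_axis[of w] s that by simp
      then have "s = 1" using that by simp
      then show False using s \<open>w \<in> \<sigma>\<close> that by simp
    qed
    ultimately show "w \<in> ?M \<inter> {z. Im z \<le> 0}" by blast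
  qed
  have seg_up: "path_between (?M \<inter> {z. Im z \<ge> 0}) p q (linepath p q)"
    if "p \<in> ?N" "q \<in> ?N" "Im p > 0" "Im q = 0" "q \<notin> \<sigma>" for p q
  proof (rule path_between_linepath, rule subsetI)
    fix w assume w: "w \<in> closed_segment p q"
    then obtain s where s: "0 \<le> s" "s \<le> 1" "w = (1 - s) *\<^sub>R p + s *\<^sub>R q" by (auto simp: closed_segment_def)
    have "w \<in> ?N" using closed_segment_subset[OF that(1,2) N_conv] w by blast
    moreover have "Im w \<ge> 0" using s that by simp
    moreover have "w \<notin> \<sigma>"
    proof
      assume "w \<in> \<sigma>"
      then have "(1 - s) * Im p = 0" using \<sigma>_axis[of w] s that by simp
      then have "s = 1" using that by simp
      then show False using s \<open>w \<in> \<sigma>\<close> that by simp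
    qed
    ultimately show "w \<in> ?M \<inter> {z. Im z \<ge> 0}" by blast
  qed
  \<comment> \<open>The loop passes below to a point right of both ends, over the top to a point
    left of both, and back below. Only \<open>q2\<close> crosses the axis, from gap
    \<open>i + 1\<close> to gap \<open>i - 1\<close>.\<close>
  define q1 where "q1 = linepath ?x ?r"
  define q2 where "q2 = reversepath (linepath ?t ?r) +++ linepath ?t ?l"
  define q3 where "q3 = reversepath (linepath ?x ?l)"
  have q1: "path_between (?M \<inter> {z. Im z \<le> 0}) ?x ?r q1"
    unfolding q1_def by (rule seg_lo[OF pts(1,2) x_im rl_im(1,4)])
  have q3: "path_between (?M \<inter> {z. Im z \<le> 0}) ?l ?x q3"
    unfolding q3_def by (rule path_between_reversepath[OF seg_lo[OF pts(1,3) x_im rl_im(2,5)]])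
  have q2: "path_between (?M \<inter> {z. Im z \<ge> 0}) ?r ?l q2"
    unfolding q2_def
    by (rule path_between_join[OF path_between_reversepath[OF seg_up[OF pts(4,2) rl_im(3,1,4)]] seg_up[OF pts(4,3) rl_im(3,2,5)]])
  define Q where "Q = q1 +++ (q2 +++ q3)"
  have Q: "path_between ?M ?x ?x Q"
    unfolding Q_def
    by (rule path_between_join[OF path_between_mono[OF q1] path_between_join[OF path_between_mono[OF q2] path_between_mono[OF q3]]]) blast+
  have M_X: "?M \<subseteq> X - \<sigma>"
  proof -
    have "z \<in> X" if z: "z \<in> U - \<sigma>" for z
    proof -
      have zc: "z \<in> closure U" using z closure_subset by blast
      then have "z \<in> disk" using U(3) interior_subset_disk by blast
      moreover have "z \<notin> K"
      proof
        assume "z \<in> K"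
        then have "z \<in> {?a, ?b}" using zc U(4) by blast
        then show False using z ab by blast
      qed
      ultimately show ?thesis by blast
    qed
    then have "U - \<sigma> \<subseteq> X" by blast
    then show ?thesis using N_U by blast
  qed
  have MX: "?M \<inter> H \<subseteq> X \<inter> H" "?M \<inter> H \<subseteq> X" for H using M_X by blast+
  have W_Q: "W Q = fg_gen (Suc i) + fg_gen i"
  proof -
    have "W q1 = 0" "W q3 = 0"
      using W_path_lower path_between_mono[OF q1 MX(1)] path_between_mono[OF q3 MX(1)] by blast+
    moreover have "W q2 = stair (idx ?r) - stair (idx ?l)"
      using W_path_upper[OF path_between_mono[OF q2 MX(1)]] rl_im by simp
    moreover have "idx ?r = Suc i" "idx ?l = i - 1"
      using idx_near(1)[OF i2 \<epsilon>(4)] idx_near(2)[OF i1 \<epsilon>(1)] by auto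
    moreover have "W Q = W q1 + (W q2 + W q3)"
      unfolding Q_def
      by (simp only: W_path_join[OF path_between_mono[OF q1 MX(2)] path_between_join[OF path_between_mono[OF q2 MX(2)] path_between_mono[OF q3 MX(2)]]]
          W_path_join[OF path_between_mono[OF q2 MX(2)] path_between_mono[OF q3 MX(2)]])
    moreover have "stair (Suc i) - stair (i - 1) = fg_gen (Suc i) + fg_gen i"
      using i by (cases i) (auto simp: add.assoc[symmetric])
    ultimately show ?thesis by simp
  qed
  have wn_Q: "winding_number Q ?a = 1"
  proof -
    \<comment> \<open>The winding number of the polygonal loop comes from crossing words once more:
      in the plane punctured at \<open>k i\<close> alone it has the word of the small circle, hence
      it is homotopic to that circle.\<close>
    interpret P: slit UNIV 1 "\<lambda>_. ?a" "?a - \<i>" "?a + \<i>" "?a - 1" "?a + 1"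
      by unfold_locales (use k_in(2)[OF i1] in \<open>auto simp: strict_mono_on_def\<close>)
    have PX: "P.X = UNIV - {?a}" by auto
    have idr: "P.idx w = 1" if "Re w > Re ?a" for w by (rule P.idxI) (use that in auto)
    have idl: "P.idx w = 0" if "Re w \<le> Re ?a" for w by (rule P.idxI) (use that in auto)
    have MP: "?M \<inter> H \<subseteq> P.X \<inter> H" "?M \<inter> H \<subseteq> P.X" "?M \<subseteq> P.X" for H unfolding PX using ab by blast+
    have Re_r: "Re ?r > Re ?a" using k_less[OF i1 i2] pos by simp
    have "P.W q1 = 0" "P.W q3 = 0"
      using P.W_path_lower path_between_mono[OF q1 MP(1)] path_between_mono[OF q3 MP(1)] by blast+
    moreover have "P.W q2 = stair 1 - stair 0"
      using P.W_path_upper[OF path_between_mono[OF q2 MP(1)]] rl_im idr[OF Re_r] idl[of ?l] pos by simp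
    moreover have "P.W Q = P.W q1 + (P.W q2 + P.W q3)"
      unfolding Q_def
      by (simp only: P.W_path_join[OF path_between_mono[OF q1 MP(2)] path_between_join[OF path_between_mono[OF q2 MP(2)] path_between_mono[OF q3 MP(2)]]]
          P.W_path_join[OF path_between_mono[OF q2 MP(2)] path_between_mono[OF q3 MP(2)]])
    ultimately have PQ: "P.W Q = stair 1" by simp
    \<comment> \<open>The computation of \<open>W_small_circle\<close>, repeated for the single
      puncture.\<close>
    have "P.W ?c = stair 1"
    proof -
      let ?th = "entry_angle i"
      let ?c1 = "part_circlepath ?a \<epsilon> ?th 0" and ?c2 = "part_circlepath ?a \<epsilon> 0 pi"
        and ?c3 = "part_circlepath ?a \<epsilon> pi (?th + 2 * pi)" and ?c4 = "part_circlepath ?a \<epsilon> 0 (?th + 2 * pi)"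
      have ep: "\<epsilon> \<ge> 0" using pos by simp
      have sX: "sphere ?a \<epsilon> \<subseteq> P.X" unfolding PX by (rule small_sub)
      note en = entry_angle[OF i1 \<epsilon>(1)]
      note pb = path_between_mono[OF path_between_part_circlepath[OF ep, of ?a] sX]
      note im = subset_trans[OF path_image_circle_subset[OF ep] sX]
      have "homotopic_paths P.X ?c (?c1 +++ ?c4)"
        unfolding small_circle_def by (rule hp_part_circlepath_split[OF _ _ im]) (use en in auto)
      then have "P.W ?c = P.W ?c1 + P.W ?c4"
        using P.W_homotopic P.W_path_join[OF pb pb] by metis
      moreover have "homotopic_paths P.X ?c4 (?c2 +++ ?c3)"
        by (rule hp_part_circlepath_split[OF _ _ im]) (use en in auto)
      then have "P.W ?c4 = P.W ?c2 + P.W ?c3"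
        using P.W_homotopic P.W_path_join[OF pb pb] by metis
      moreover have "P.W ?c1 = 0"
        by (rule P.W_lower, rule part_circlepath_Im_bounds(2)[OF k_in(2)[OF i1] ep, of ?th 0]) (use en in auto)
      moreover have "P.W ?c3 = 0"
        by (rule P.W_lower, rule part_circlepath_Im_bounds(3)[OF k_in(2)[OF i1] ep, of pi "?th + 2 * pi"]) (use en in auto)
      moreover have "path_between (P.X \<inter> {z. Im z \<ge> 0}) (?a + rcis \<epsilon> 0) (?a + rcis \<epsilon> pi) ?c2"
        by (rule path_between_Int_axis[OF pb], rule part_circlepath_Im_bounds(1)[OF k_in(2)[OF i1] ep, of 0 pi]) auto
      then have "P.W ?c2 = stair 1 - stair 0"
        using P.W_path_upper k_in(2)[OF i1] idr[of "?a + of_real \<epsilon>"] idl[of "?a - of_real \<epsilon>"] pos by (simp add: rcis_def)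
      ultimately show ?thesis by simp
    qed
    then have "homotopic_paths P.X Q ?c"
      using P.homotopic_iff_W[OF path_between_mono[OF Q MP(3)]] c_pb PQ unfolding PX by metis
    then have "homotopic_paths (- {?a}) Q ?c" by (simp add: PX Compl_eq_Diff_UNIV)
    then show ?thesis using winding_number_homotopic_paths wc by metis
  qed

  have O1: "path_between slit_disk ?y ?y (((?d +++ reversepath ?s) +++ ?O) +++ reversepath (?d +++ reversepath ?s))"
    and O2: "path_between slit_disk ?y ?w (?d +++ reversepath ?s)"
  proof -
    show "path_between slit_disk ?y ?w (?d +++ reversepath ?s)"
      by (rule path_between_join[OF d2 path_between_reversepath[OF rl(1)]])
    then show "path_between slit_disk ?y ?y (((?d +++ reversepath ?s) +++ ?O) +++ reversepath (?d +++ reversepath ?s))"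
      using rl(3) by (meson path_between_join path_between_reversepath)
  qed
  let ?D = "?d +++ reversepath ?s"
  have O3: "path_between slit_disk ?y ?y (?D +++ (?O +++ reversepath ?D))"
    by (rule path_between_join[OF O2 path_between_join[OF rl(3) path_between_reversepath[OF O2]]])
  have fQ: "path_between slit_disk ?y ?y (f \<circ> Q)"
  proof (rule path_between_image[OF Q cont_f])
    show "f ` ?M \<subseteq> slit_disk"
    proof (rule image_subsetI)
      fix z assume z: "z \<in> ?M"
      then have "cmod (f z) < 2" using N_U in_U_iff by blast
      moreover have "f z \<notin> closed_segment (- 1) 1" using z f_\<sigma> by blast
      ultimately show "f z \<in> slit_disk" by simp
    qed
  qed
  have se: "slit_disk \<subseteq> UNIV - {e}" using eseg by blast
  \<comment> \<open>Both loops avoid the slit and wind once about \<open>e\<close>, which determines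
    their class in the slit disk.\<close>
  have "homotopic_paths slit_disk (f \<circ> Q) (?D +++ (?O +++ reversepath ?D))"
  proof (rule slit_disk_homotopic[OF fQ O3 eseg])
    have "winding_number (?D +++ (?O +++ reversepath ?D)) e = 1"
      using wn_conj[OF path_between_mono[OF O2 se] path_between_mono[OF rl(3) se]] rl(5) by simp
    moreover have "winding_number (f \<circ> Q) e = 1"
      by (rule winding_f[OF path_between_mono[OF Q] wn_Q]) (use ab in blast)
    ultimately show "winding_number (f \<circ> Q) e = winding_number (?D +++ (?O +++ reversepath ?D)) e" by simp
  qed
  then have "homotopic_paths X (g \<circ> (f \<circ> Q)) (g \<circ> (?D +++ (?O +++ reversepath ?D)))"
    by (rule homotopic_paths_continuous_image[OF _ cont_g]) (use g_slit_disk in blast)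
  moreover have "g \<circ> (f \<circ> Q) = Q" by auto
  ultimately have "W Q = W (g \<circ> (?D +++ (?O +++ reversepath ?D)))" using W_homotopic by metis
  also have "g \<circ> (?D +++ (?O +++ reversepath ?D)) =
      ((g \<circ> ?d) +++ reversepath (g \<circ> ?s)) +++ ((g \<circ> ?O) +++ reversepath ((g \<circ> ?d) +++ reversepath (g \<circ> ?s)))"
    by (simp only: path_compose_join path_compose_reversepath)
  also have "W \<dots> = W v + W (g \<circ> ?O) - W v"
  proof -
    let ?e = "(g \<circ> ?d) +++ reversepath (g \<circ> ?s)"
    have e': "path_between X ?x (g ?w) ?e" by (rule path_between_join[OF gd path_between_reversepath[OF gs]])
    have "W ?e = W v" unfolding W_v
      by (simp only: W_path_join[OF gd path_between_reversepath[OF gs]] W_path_reverse[OF gs]) simp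
    then show ?thesis
      by (simp only: W_path_join[OF e' path_between_join[OF gO path_between_reversepath[OF e']]]
          W_path_join[OF gO path_between_reversepath[OF e']] W_path_reverse[OF e']) (simp add: add_diff_eq)
  qed
  finally have W_vO: "W v + W (g \<circ> ?O) - W v = fg_gen (Suc i) + fg_gen i" using W_Q by simp

  have hL: "path_between twice_punctured ?w ?w (h \<circ> ?L)"
  proof -
    have "path_between twice_punctured ?w ?w ?L"
      unfolding rl(6)
      by (rule path_between_join[OF sd[OF rl(1)] path_between_join[OF C2 path_between_reversepath[OF sd[OF rl(1)]]]])
    then have "path_between twice_punctured (h ?w) (h ?w) (h \<circ> ?L)"
      by (rule path_between_image[OF _ cont_h twist_map_maps[OF profile]])
    moreover have "h ?w = ?w" using e by (intro twist_map_outer[OF profile]) (auto simp: norm_mult)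
    ultimately show ?thesis by simp
  qed
  have ghL: "path_between X (g ?w) (g ?w) (g \<circ> (h \<circ> ?L))" by (rule gim[OF hL])
  have "homotopic_paths X (g \<circ> ((h \<circ> ?L) +++ ?L)) (g \<circ> ?O)"
    by (rule homotopic_paths_continuous_image[OF twist_lollipop_homotopic[OF profile e] cont_g])
      (use g_twice_punctured in blast)
  then have "W ((g \<circ> (h \<circ> ?L)) +++ (g \<circ> ?L)) = W (g \<circ> ?O)"
    unfolding path_compose_join by (rule W_homotopic)
  then have twist: "W (g \<circ> (h \<circ> ?L)) + W (g \<circ> ?L) = W (g \<circ> ?O)"
    by (simp only: W_path_join[OF ghL gL])

  have "homotopic_paths X (std_loop i) (v +++ ((g \<circ> ?L) +++ reversepath v))"
    using homotopic_iff_W[OF std_loop[OF i1] W_conj(1)[OF v_X gL]] conj1 W_std_loop[OF i1] by simp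
  then have "homotopic_paths X (\<beta> \<circ> std_loop i) (\<beta> \<circ> (v +++ ((g \<circ> ?L) +++ reversepath v)))"
    by (rule homotopic_paths_continuous_image[OF _ cont_\<beta>]) (use \<beta>_X in blast)
  then have "W (\<beta> \<circ> std_loop i) = W ((\<beta> \<circ> v) +++ ((\<beta> \<circ> (g \<circ> ?L)) +++ reversepath (\<beta> \<circ> v)))"
    unfolding path_compose_join path_compose_reversepath by (rule W_homotopic)
  also have "\<beta> \<circ> (g \<circ> ?L) = g \<circ> (h \<circ> ?L)" by (auto simp: \<beta>_def)
  also have "W ((\<beta> \<circ> v) +++ ((g \<circ> (h \<circ> ?L)) +++ reversepath (\<beta> \<circ> v))) = W (\<beta> \<circ> v) + W (g \<circ> (h \<circ> ?L)) - W (\<beta> \<circ> v)"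
  proof (rule W_conj(2)[OF _ ghL])
    show "path_between X base_pt (g ?w) (\<beta> \<circ> v)"
      using \<beta>_path[OF v_X] \<beta>_base_pt \<beta>_outside[OF w_out] by simp
  qed
  also have "W (\<beta> \<circ> v) = W v" by (rule W_\<beta>_fixed[OF v base_pt_not_U w_out])
  finally have W\<beta>: "W (\<beta> \<circ> std_loop i) = W v + W (g \<circ> (h \<circ> ?L)) - W v" .
  have "W v + W (g \<circ> ?L) - W v = fg_gen i"
    using conj1 W_conj(2)[OF v_X gL] by simp
  \<comment> \<open>Both conjugations use the same \<open>v\<close>, so multiplying them leaves the
    conjugate of the product, which the model identifies with the outer circle.\<close>
  then have "W (\<beta> \<circ> std_loop i) + fg_gen i = (W v + W (g \<circ> (h \<circ> ?L)) - W v) + (W v + W (g \<circ> ?L) - W v)"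
    using W\<beta> by simp
  also have "\<dots> = W v + (W (g \<circ> (h \<circ> ?L)) + W (g \<circ> ?L)) - W v"
    by (simp add: add_diff_eq add.assoc[symmetric])
  also have "\<dots> = fg_gen (Suc i) + fg_gen i" using twist W_vO by simp
  finally show first: "W (\<beta> \<circ> std_loop i) = fg_gen (Suc i)" by simp

  text \<open>The loop around both points avoids \<open>\<sigma>\<close>, so its class is fixed.\<close>
  let ?Z = "?T +++ (Q +++ reversepath ?T)"
  have Z: "path_between (X - \<sigma>) base_pt base_pt ?Z"
    by (rule path_between_join[OF T path_between_join[OF path_between_mono[OF Q M_X] path_between_reversepath[OF T]]])
  have Q_X: "path_between X ?x ?x Q" by (rule path_between_mono[OF Q]) (use M_X in blast)
  have W_Z: "W ?Z = fg_gen (Suc i) + fg_gen i"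
    using W_conj(2)[OF T_X Q_X] W_stem[OF i1 \<epsilon>(1)] W_Q by simp
  let ?word = "[(Suc i, True), (i, True)]"
  have "W (\<beta> \<circ> ?Z) = fg_eval (\<lambda>i. W (\<beta> \<circ> std_loop i)) ?word"
  proof (rule W_image_eq_fg_eval[OF std_loop W_std_loop cont_\<beta> \<beta>_X \<beta>_base_pt])
    show "path_between X base_pt base_pt ?Z" by (rule path_between_mono[OF Z]) blast
    show "W ?Z = fg_class ?word"
      unfolding W_Z using fg_class_append[of "[(Suc i, True)]" "[(i, True)]"] by (simp add: fg_class_letter)
    show "fst ` set ?word \<subseteq> {1..n}" using i1 i2 by auto
  qed
  then have "W (\<beta> \<circ> std_loop (Suc i)) + fg_gen (Suc i) = fg_gen (Suc i) + fg_gen i"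
    using W_\<beta>_fixed[OF Z base_pt_not_U base_pt_not_U] W_Z first by simp
  then show "W (\<beta> \<circ> std_loop (Suc i)) = fg_gen (Suc i) + fg_gen i - fg_gen (Suc i)"
    by (simp add: eq_diff_eq)
qed

end

section \<open>Smoothness of the twist\<close>

lemma Ck_on_imp_continuous_on: "Ck_on m f S \<Longrightarrow> continuous_on S f"
  by (cases m) (auto intro!: continuous_at_imp_continuous_on differentiable_imp_continuous_within)

lemma Ck_on_SucD: "Ck_on (Suc m) f S \<Longrightarrow> Ck_on m f S"
proof (induction m arbitrary: f)
  case 0
  show ?case using Ck_on_imp_continuous_on[OF 0] by simp
next
  case (Suc m)
  have d: "\<forall>x\<in>S. f differentiable (at x)" "\<And>v. Ck_on (Suc m) (\<lambda>x. frechet_derivative f (at x) v) S"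
    using Suc.prems by (simp_all only: Ck_on.simps) auto
  show ?case
    unfolding Ck_on.simps(2)[of m f] using d(1) Suc.IH[OF d(2)] by blast
qed

lemma Ck_on_subset: "Ck_on m f T \<Longrightarrow> S \<subseteq> T \<Longrightarrow> Ck_on m f S"
  by (induction m arbitrary: f) (auto intro: continuous_on_subset)

lemma Ck_on_cong:
  assumes "open S" "Ck_on m f S" "\<And>x. x \<in> S \<Longrightarrow> f x = g x"
  shows "Ck_on m g S"
  using assms(2,3)
proof (induction m arbitrary: f g)
  case 0
  then show ?case by (simp cong: continuous_on_cong)
next
  case (Suc m)
  have d: "(g has_derivative frechet_derivative f (at x)) (at x)" if "x \<in> S" for x
  proof (rule has_derivative_transform_within_open[OF _ assms(1) that])
    show "(f has_derivative frechet_derivative f (at x)) (at x)"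
      using Suc.prems(1) that by (simp add: frechet_derivative_works)
  qed (use Suc.prems in auto)
  have "Ck_on m (\<lambda>x. frechet_derivative g (at x) v) S" for v
  proof (rule Suc.IH)
    show "Ck_on m (\<lambda>x. frechet_derivative f (at x) v) S" using Suc.prems(1) by simp
    show "frechet_derivative f (at x) v = frechet_derivative g (at x) v" if "x \<in> S" for x
      using frechet_derivative_at[OF d[OF that]] by simp
  qed
  then show ?case using d by (auto simp: differentiable_def)
qed

text \<open>Replaces the chosen \<open>frechet_derivative\<close> by any explicit derivative; the
  two agree on the open set, and \<open>Ck_on_cong\<close> transfers the rest.\<close>

lemma Ck_on_SucI:
  assumes "open S" "\<And>x. x \<in> S \<Longrightarrow> (f has_derivative f' x) (at x)" "\<And>v. Ck_on m (\<lambda>x. f' x v) S"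
  shows "Ck_on (Suc m) f S"
proof -
  have "Ck_on m (\<lambda>x. frechet_derivative f (at x) v) S" for v
  proof (rule Ck_on_cong[OF assms(1) assms(3)[of v]])
    show "f' x v = frechet_derivative f (at x) v" if "x \<in> S" for x
      using frechet_derivative_at[OF assms(2)[OF that]] by simp
  qed
  then show ?thesis using assms(2) by (auto simp: differentiable_def)
qed

lemma Ck_on_SucE:
  assumes "Ck_on (Suc m) f S"
  shows "\<exists>f'. (\<forall>x\<in>S. (f has_derivative f' x) (at x)) \<and> (\<forall>v. Ck_on m (\<lambda>x. f' x v) S)"
  using assms by (intro exI[of _ "\<lambda>x. frechet_derivative f (at x)"]) (auto simp: frechet_derivative_works)

lemma Ck_on_local:
  assumes "\<And>x. x \<in> S \<Longrightarrow> \<exists>T. open T \<and> x \<in> T \<and> Ck_on m f T"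
  shows "Ck_on m f S"
  using assms
proof (induction m arbitrary: f)
  case 0
  have "isCont f x" if "x \<in> S" for x
    using 0[OF that] by (auto simp: continuous_on_eq_continuous_at)
  then show ?case by (simp add: continuous_at_imp_continuous_on)
next
  case (Suc m)
  have "f differentiable (at x)" if "x \<in> S" for x using Suc.prems[OF that] by auto
  moreover have "Ck_on m (\<lambda>x. frechet_derivative f (at x) v) S" for v
    by (rule Suc.IH) (use Suc.prems in fastforce)
  ultimately show ?case by simp
qed

lemma Ck_on_const: "Ck_on m (\<lambda>_. c) S"
proof (induction m arbitrary: c)
  case (Suc m)
  have "frechet_derivative (\<lambda>_. c) (at x) = (\<lambda>_. 0)" for x
    by (rule frechet_derivative_at[symmetric]) simp
  then show ?case using Suc by simp
qed simp

lemma Ck_on_bounded_linear: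
  assumes "bounded_linear L"
  shows "Ck_on m L S"
proof (cases m)
  case 0
  then show ?thesis using assms by (simp add: linear_continuous_on)
next
  case (Suc m')
  have d: "(L has_derivative L) (at x)" for x
    using assms by (simp add: bounded_linear_imp_has_derivative)
  then have "frechet_derivative L (at x) = L" for x by (rule frechet_derivative_at[symmetric])
  then show ?thesis unfolding Suc using d Ck_on_const by (auto simp: differentiable_def)
qed

lemma Ck_on_linear_comp:
  assumes "bounded_linear L" "open S" "Ck_on m f S"
  shows "Ck_on m (\<lambda>x. L (f x)) S"
  using assms(3)
proof (induction m arbitrary: f)
  case 0
  then show ?case
    using assms(1) by (auto intro: bounded_linear.continuous_on)
next
  case (Suc m)
  obtain f' where f': "\<And>x. x \<in> S \<Longrightarrow> (f has_derivative f' x) (at x)" "\<And>v. Ck_on m (\<lambda>x. f' x v) S"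
    using Ck_on_SucE[OF Suc.prems] by blast
  show ?case
    by (rule Ck_on_SucI[OF assms(2) bounded_linear.has_derivative[OF assms(1) f'(1)] Suc.IH[OF f'(2)]])
qed

lemma Ck_on_add:
  assumes "open S" "Ck_on m f S" "Ck_on m g S"
  shows "Ck_on m (\<lambda>x. f x + g x) S"
  using assms(2,3)
proof (induction m arbitrary: f g)
  case 0
  then show ?case by (auto intro: continuous_intros)
next
  case (Suc m)
  obtain f' where f': "\<And>x. x \<in> S \<Longrightarrow> (f has_derivative f' x) (at x)" "\<And>v. Ck_on m (\<lambda>x. f' x v) S"
    using Ck_on_SucE[OF Suc.prems(1)] by blast
  obtain g' where g': "\<And>x. x \<in> S \<Longrightarrow> (g has_derivative g' x) (at x)" "\<And>v. Ck_on m (\<lambda>x. g' x v) S"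
    using Ck_on_SucE[OF Suc.prems(2)] by blast
  show ?case
    by (rule Ck_on_SucI[OF assms(1) has_derivative_add[OF f'(1) g'(1)] Suc.IH[OF f'(2) g'(2)]])
qed

lemma Ck_on_sum:
  assumes "open S" "\<And>b. b \<in> B \<Longrightarrow> Ck_on m (f b) S"
  shows "Ck_on m (\<lambda>x. \<Sum>b\<in>B. f b x) S"
  using assms(2)
  by (induction B rule: infinite_finite_induct) (auto intro: Ck_on_add[OF assms(1)] Ck_on_const)

lemma Ck_on_bilinear:
  assumes "bounded_bilinear h" "open S" "Ck_on m f S" "Ck_on m g S"
  shows "Ck_on m (\<lambda>x. h (f x) (g x)) S"
  using assms(3,4)
proof (induction m arbitrary: f g)
  case 0
  then show ?case using assms(1) by (auto intro: bounded_bilinear.continuous_on)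
next
  case (Suc m)
  obtain f' where f': "\<And>x. x \<in> S \<Longrightarrow> (f has_derivative f' x) (at x)" "\<And>v. Ck_on m (\<lambda>x. f' x v) S"
    using Ck_on_SucE[OF Suc.prems(1)] by blast
  obtain g' where g': "\<And>x. x \<in> S \<Longrightarrow> (g has_derivative g' x) (at x)" "\<And>v. Ck_on m (\<lambda>x. g' x v) S"
    using Ck_on_SucE[OF Suc.prems(2)] by blast
  show ?case
    by (rule Ck_on_SucI[OF assms(2) bounded_bilinear.FDERIV[OF assms(1) f'(1) g'(1)]
          Ck_on_add[OF assms(2) Suc.IH[OF Ck_on_SucD[OF Suc.prems(1)] g'(2)] Suc.IH[OF f'(2) Ck_on_SucD[OF Suc.prems(2)]]]])
qed

lemmas Ck_on_mult = Ck_on_bilinear[OF bounded_bilinear_mult]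
lemmas Ck_on_scaleR = Ck_on_bilinear[OF bounded_bilinear_scaleR]
lemmas Ck_on_inner = Ck_on_bilinear[OF bounded_bilinear_inner]

text \<open>\<open>Ck_on\<close> controls derivatives in fixed directions, but the chain rule
  produces the derivative of \<open>g\<close> in the moving direction \<open>f' x v\<close>.
  Expanding that direction in the basis gives a sum of products of functions already
  controlled.\<close>

lemma Ck_on_compose:
  fixes f :: "'a::euclidean_space \<Rightarrow> 'b::euclidean_space" and g :: "'b \<Rightarrow> 'c::euclidean_space"
  assumes "open S" "open T" "Ck_on m f S" "Ck_on m g T" "f ` S \<subseteq> T"
  shows "Ck_on m (\<lambda>x. g (f x)) S"
  using assms(3,4,5)
proof (induction m arbitrary: f g)
  case 0
  then show ?case by (auto intro: continuous_on_compose2)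
next
  case (Suc m)
  obtain f' where f': "\<And>x. x \<in> S \<Longrightarrow> (f has_derivative f' x) (at x)" "\<And>v. Ck_on m (\<lambda>x. f' x v) S"
    using Ck_on_SucE[OF Suc.prems(1)] by blast
  obtain g' where g': "\<And>x. x \<in> T \<Longrightarrow> (g has_derivative g' x) (at x)" "\<And>v. Ck_on m (\<lambda>x. g' x v) T"
    using Ck_on_SucE[OF Suc.prems(2)] by blast
  have d: "((\<lambda>x. g (f x)) has_derivative (\<lambda>v. g' (f x) (f' x v))) (at x)" if "x \<in> S" for x
    using diff_chain_at[OF f'(1)[OF that] g'(1)] that Suc.prems(3) by (auto simp: o_def)
  have "Ck_on m (\<lambda>x. g' (f x) (f' x v)) S" for v
  proof (rule Ck_on_cong[OF assms(1)])
    show "Ck_on m (\<lambda>x. \<Sum>b\<in>Basis. (f' x v \<bullet> b) *\<^sub>R g' (f x) b) S"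
      by (intro Ck_on_sum Ck_on_scaleR assms(1) Suc.IH[OF Ck_on_SucD[OF Suc.prems(1)] g'(2) Suc.prems(3)]
          Ck_on_linear_comp[OF bounded_linear_inner_left assms(1) f'(2)])
    fix x assume "x \<in> S"
    then have "bounded_linear (g' (f x))"
      using g'(1) Suc.prems(3) by (blast intro: has_derivative_bounded_linear)
    then have l: "linear (g' (f x))" by (rule bounded_linear.linear)
    have "g' (f x) (f' x v) = g' (f x) (\<Sum>b\<in>Basis. (f' x v \<bullet> b) *\<^sub>R b)"
      by (simp only: euclidean_representation)
    also have "\<dots> = (\<Sum>b\<in>Basis. (f' x v \<bullet> b) *\<^sub>R g' (f x) b)"
      by (simp only: linear_sum[OF l] linear_scale[OF l])
    finally show "(\<Sum>b\<in>Basis. (f' x v \<bullet> b) *\<^sub>R g' (f x) b) = g' (f x) (f' x v)" by simp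
  qed
  then show ?case using Ck_on_SucI[OF assms(1) d] by blast
qed

lemma Ck_on_real_SucI:
  fixes f :: "real \<Rightarrow> 'b::euclidean_space"
  assumes "open S" "\<And>x. x \<in> S \<Longrightarrow> (f has_vector_derivative f' x) (at x)" "Ck_on m f' S"
  shows "Ck_on (Suc m) f S"
proof (rule Ck_on_SucI[OF assms(1)])
  show "(f has_derivative (\<lambda>v. v *\<^sub>R f' x)) (at x)" if "x \<in> S" for x
    using assms(2)[OF that] by (simp add: has_vector_derivative_def)
  show "Ck_on m (\<lambda>x. v *\<^sub>R f' x) S" for v
    by (rule Ck_on_linear_comp[OF bounded_linear_scaleR_right assms(1,3)])
qed

lemma Ck_on_real_SucI':
  fixes f :: "real \<Rightarrow> real"
  assumes "open S" "\<And>x. x \<in> S \<Longrightarrow> (f has_real_derivative f' x) (at x)" "Ck_on m f' S"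
  shows "Ck_on (Suc m) f S"
  using assms by (intro Ck_on_real_SucI[OF assms(1) _ assms(3)])
    (auto simp: has_real_derivative_iff_has_vector_derivative)

lemma Ck_on_cis: "Ck_on m cis S"
proof (rule Ck_on_subset[of m cis UNIV])
  show "Ck_on m cis UNIV"
  proof (induction m)
    case 0
    then show ?case by (auto simp: cis_conv_exp intro!: continuous_intros)
  next
    case (Suc m)
    have "(cis has_vector_derivative \<i> * cis x) (at x)" for x
      unfolding has_vector_derivative_def
      by (auto intro!: derivative_eq_intros simp: scaleR_conv_of_real fun_eq_iff)
    then show ?case
      by (intro Ck_on_real_SucI[OF open_UNIV _ Ck_on_linear_comp[OF bounded_linear_mult_right open_UNIV Suc]])
  qed
qed simp

text \<open>Each is the derivative of the other, so one induction has to carry both.\<close>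

lemma Ck_on_sinh_cosh: "Ck_on m (sinh :: real \<Rightarrow> real) UNIV \<and> Ck_on m (cosh :: real \<Rightarrow> real) UNIV"
proof (induction m)
  case 0
  then show ?case by (auto intro!: continuous_intros)
next
  case (Suc m)
  then show ?case
    by (auto intro!: Ck_on_real_SucI'[of UNIV] derivative_eq_intros simp del: Ck_on.simps)
qed

text \<open>The derivative is a product of copies of \<open>inverse\<close> itself, which closes the
  induction.\<close>

lemma Ck_on_inverse: "Ck_on m (inverse :: real \<Rightarrow> real) (- {0})"
proof (induction m)
  case 0
  then show ?case by (auto intro!: continuous_intros)
next
  case (Suc m)
  have o: "open (- {0::real})" by auto
  show ?case
  proof (rule Ck_on_real_SucI'[OF o])
    show "(inverse has_real_derivative (- 1) * (inverse x * inverse x)) (at x)" if "x \<in> - {0}" for x :: real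
      using that by (auto intro!: derivative_eq_intros)
    show "Ck_on m (\<lambda>x::real. (- 1) * (inverse x * inverse x)) (- {0})"
      by (intro Ck_on_mult o Ck_on_const Suc)
  qed
qed

lemma Ck_on_inverse_comp:
  fixes f :: "'a::euclidean_space \<Rightarrow> real"
  assumes "open S" "Ck_on m f S" "\<And>x. x \<in> S \<Longrightarrow> f x \<noteq> 0"
  shows "Ck_on m (\<lambda>x. inverse (f x)) S"
  by (rule Ck_on_compose[OF assms(1) _ assms(2) Ck_on_inverse]) (use assms(3) in auto)

lemma Ck_on_sqrt: "Ck_on m sqrt {0<..}"
proof (induction m)
  case 0
  then show ?case by (auto intro!: continuous_intros)
next
  case (Suc m)
  have o: "open {0::real<..}" by auto
  show ?case
  proof (rule Ck_on_real_SucI'[OF o])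
    show "(sqrt has_real_derivative inverse (sqrt x) * (1 / 2)) (at x)" if "x \<in> {0<..}" for x
      using DERIV_real_sqrt[of x] that by simp
    show "Ck_on m (\<lambda>x. inverse (sqrt x) * (1 / 2)) {0<..}"
      by (intro Ck_on_mult o Ck_on_const Ck_on_inverse_comp Suc) auto
  qed
qed

lemma Ck_on_arsinh: "Ck_on m (arsinh :: real \<Rightarrow> real) UNIV"
proof (cases m)
  case 0
  then show ?thesis by (auto intro!: continuous_intros)
next
  case (Suc m')
  have p: "x\<^sup>2 + 1 > 0" for x :: real by (meson add_nonneg_pos zero_le_power2 zero_less_one)
  have "Ck_on m' (\<lambda>x::real. x * x + 1) UNIV"
    by (intro Ck_on_add Ck_on_mult Ck_on_const Ck_on_bounded_linear[OF bounded_linear_ident]) auto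
  then have "Ck_on m' (\<lambda>x::real. sqrt (x\<^sup>2 + 1)) UNIV"
    using p by (intro Ck_on_compose[OF _ _ _ Ck_on_sqrt]) (auto simp: power2_eq_square)
  then have "Ck_on m' (\<lambda>x::real. inverse (sqrt (x\<^sup>2 + 1))) UNIV"
    by (rule Ck_on_inverse_comp[rotated]) (use p in \<open>auto simp: less_imp_neq[symmetric]\<close>)
  moreover have "(arsinh has_real_derivative inverse (sqrt (x\<^sup>2 + 1))) (at x)" for x :: real
    using arsinh_real_has_field_derivative[of x UNIV] by (simp add: divide_inverse)
  ultimately show ?thesis unfolding Suc by (intro Ck_on_real_SucI'[of UNIV]) auto
qed

lemma Ck_on_norm: "Ck_on m (cmod) (- {0})"
proof -
  have o: "open (- {0::complex})" by auto
  have "Ck_on m (\<lambda>z::complex. z \<bullet> z) (- {0})"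
    by (intro Ck_on_inner o Ck_on_bounded_linear[OF bounded_linear_ident])
  then have "Ck_on m (\<lambda>z::complex. sqrt (z \<bullet> z)) (- {0})"
    by (intro Ck_on_compose[OF o _ _ Ck_on_sqrt]) auto
  then show ?thesis by (rule Ck_on_cong[OF o]) (simp add: norm_eq_sqrt_inner)
qed

section \<open>Flat functions and the smoothness of the twist\<close>

definition flat :: "nat \<Rightarrow> real \<Rightarrow> real" where
  "flat k x = (if x > 0 then inverse x ^ k * exp (- inverse x) else 0)"

lemma flat_tendsto_0: "(flat k \<longlongrightarrow> 0) (at 0)"
proof -
  have "((\<lambda>x. inverse x ^ k / exp (inverse x)) \<longlongrightarrow> (0::real)) (at_right 0)"
    by (rule filterlim_compose[OF tendsto_power_div_exp_0 filterlim_inverse_at_top_right])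
  moreover have "\<forall>\<^sub>F x in at_right 0. inverse x ^ k / exp (inverse x) = flat k x"
    by (auto simp: flat_def exp_minus divide_inverse eventually_at_filter)
  ultimately have "(flat k \<longlongrightarrow> 0) (at_right 0)" by (rule Lim_transform_eventually)
  moreover have "\<forall>\<^sub>F x in at_left 0. 0 = flat k x"
    by (auto simp: flat_def eventually_at_filter)
  then have "(flat k \<longlongrightarrow> 0) (at_left 0)" by (rule Lim_transform_eventually[OF tendsto_const])
  ultimately show ?thesis by (rule filterlim_split_at[rotated])
qed

lemma DERIV_flat: "(flat k has_real_derivative flat (k + 2) x - real k * flat (k + 1) x) (at x)"
proof -
  consider "x > 0" | "x < 0" | "x = 0" by linarith
  then show ?thesis
  proof cases
    case 1
    have "((\<lambda>x. inverse x ^ k * exp (- inverse x)) has_real_derivative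
        flat (k + 2) x - real k * flat (k + 1) x) (at x)"
      using 1 by (cases k)
        (auto intro!: derivative_eq_intros simp: flat_def power2_eq_square algebra_simps,
          metis One_nat_def power_eq_if)
    then show ?thesis
      by (rule has_field_derivative_transform_within_open[of _ _ _ "{0<..}"]) (use 1 in \<open>auto simp: flat_def\<close>)
  next
    case 2
    have "((\<lambda>x. 0) has_real_derivative flat (k + 2) x - real k * flat (k + 1) x) (at x)"
      using 2 by (simp add: flat_def)
    then show ?thesis
      by (rule has_field_derivative_transform_within_open[of _ _ _ "{..<0}"]) (use 2 in \<open>auto simp: flat_def\<close>)
  next
    case 3
    \<comment> \<open>The difference quotient at 0 is again a member of the family, so its limit is
      \<open>flat_tendsto_0\<close>; at \<open>y = 0\<close> both sides are 0 because division by 0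
      gives 0.\<close>
    have "(\<lambda>y. (flat k y - flat k 0) / (y - 0)) = flat (k + 1)"
      by (auto simp: flat_def fun_eq_iff field_simps)
    then show ?thesis
      using flat_tendsto_0[of "k + 1"] 3 by (simp add: has_field_derivative_iff) (simp add: flat_def)
  qed
qed

text \<open>The powers of 1/x are in the family in order to make it closed under differentiation up
  to linear combinations; the case of interest is exp(-1/x), with \<open>k = 0\<close>.\<close>

lemma Ck_on_flat: "Ck_on m (flat k) UNIV"
proof (induction m arbitrary: k)
  case 0
  then show ?case
    using DERIV_flat by (auto intro!: continuous_at_imp_continuous_on DERIV_isCont)
next
  case (Suc m)
  have "Ck_on m (\<lambda>x. flat (k + 2) x + (- real k) * flat (k + 1) x) UNIV"
    by (intro Ck_on_add Ck_on_mult Ck_on_const Suc) auto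
  then show ?case
    by (intro Ck_on_real_SucI'[OF open_UNIV DERIV_flat]) simp
qed

lemma flat0_mono: "x \<le> y \<Longrightarrow> flat 0 x \<le> flat 0 y"
  by (auto simp: flat_def)

lemma flat0_nonneg: "flat 0 x \<ge> 0" and flat0_pos: "x > 0 \<Longrightarrow> flat 0 x > 0" and flat0_zero: "x \<le> 0 \<Longrightarrow> flat 0 x = 0"
  by (auto simp: flat_def)

lemma ex_twist_profile: "\<exists>\<alpha>. twist_profile \<alpha>"
proof
  \<comment> \<open>The usual smooth step a / (a + b): \<open>a\<close> vanishes from 2 on,
    \<open>b\<close> vanishes up to 3/2, and they are never zero together.\<close>
  define a where "a r = flat 0 (2 - r)" for r
  define b where "b r = flat 0 (r - 3 / 2)" for r
  let ?\<alpha> = "\<lambda>r. a r * inverse (a r + b r)"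
  have pos: "a r + b r > 0" for r
  proof (cases "r < 2")
    case True
    then show ?thesis using flat0_pos[of "2 - r"] flat0_nonneg[of "r - 3 / 2"] by (simp add: a_def b_def)
  next
    case False
    then show ?thesis using flat0_pos[of "r - 3 / 2"] flat0_nonneg[of "2 - r"] by (simp add: a_def b_def)
  qed
  have "Ck_on m (\<lambda>r::real. r * (- 1) + 2) UNIV" "Ck_on m (\<lambda>r::real. r + - (3 / 2)) UNIV" for m
    by (intro Ck_on_add Ck_on_mult Ck_on_const Ck_on_bounded_linear[OF bounded_linear_ident] open_UNIV)+
  then have "Ck_on m a UNIV" "Ck_on m b UNIV" for m
    using Ck_on_compose[OF open_UNIV open_UNIV _ Ck_on_flat[of m 0]] unfolding a_def b_def by fastforce+
  then have ck: "Ck_on m ?\<alpha> UNIV" for m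
    using pos by (intro Ck_on_mult Ck_on_inverse_comp Ck_on_add open_UNIV) (auto simp: less_imp_neq[symmetric])
  have "?\<alpha> s \<le> ?\<alpha> r" if "r \<le> s" for r s
  proof -
    have "a s \<le> a r" "b r \<le> b s" "0 \<le> a s" "0 \<le> b r"
      using that by (auto simp: a_def b_def flat0_nonneg intro!: flat0_mono)
    then have "a s * b r \<le> a r * b s" by (intro mult_mono) auto
    then have "a s * (a r + b r) \<le> a r * (a s + b s)" by (simp add: algebra_simps)
    then show ?thesis using pos[of r] pos[of s] by (simp add: divide_inverse[symmetric] frac_le_eq divide_le_cancel field_simps)
  qed
  then have "antimono_on {0..} ?\<alpha>" by (auto simp: monotone_on_def)
  moreover have "?\<alpha> r = 1" if "r \<le> 3 / 2" for r
    using that pos[of r] by (simp add: b_def flat0_zero)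
  moreover have "?\<alpha> r = 0" if "r \<ge> 2" for r
    using that by (simp add: a_def flat0_zero)
  moreover have "smooth_on {0..} ?\<alpha>"
    unfolding smooth_on_def using ck by (intro exI[of _ UNIV] exI[of _ ?\<alpha>]) auto
  ultimately show "twist_profile ?\<alpha>" by (auto simp: twist_profile_def)
qed

lemma smooth_on_UNIV: "smooth_on UNIV f \<longleftrightarrow> (\<forall>m. Ck_on m f UNIV)"
proof
  assume "smooth_on UNIV f"
  then obtain T g where "UNIV \<subseteq> T" "\<forall>m. Ck_on m g T" "\<forall>x\<in>UNIV. g x = f x"
    unfolding smooth_on_def by blast
  then have "T = UNIV" "g = f" by auto
  then show "\<forall>m. Ck_on m f UNIV" using \<open>\<forall>m. Ck_on m g T\<close> by simp
next
  assume "\<forall>m. Ck_on m f UNIV"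
  then show "smooth_on UNIV f"
    unfolding smooth_on_def by (intro exI[of _ UNIV] exI[of _ f]) auto
qed

lemma smooth_on_subset: "smooth_on T f \<Longrightarrow> S \<subseteq> T \<Longrightarrow> smooth_on S f"
  unfolding smooth_on_def by (meson subset_eq)

lemma smooth_on_cong: "smooth_on S f \<Longrightarrow> (\<And>x. x \<in> S \<Longrightarrow> f x = g x) \<Longrightarrow> smooth_on S g"
  unfolding smooth_on_def by metis

lemma smooth_on_compose:
  assumes "smooth_on S f" "smooth_on T g" "f ` S \<subseteq> T"
  shows "smooth_on S (\<lambda>x. g (f x))"
proof -
  obtain S' f' where f': "open S'" "S \<subseteq> S'" "\<And>m. Ck_on m f' S'" "\<And>x. x \<in> S \<Longrightarrow> f' x = f x"
    using assms(1) unfolding smooth_on_def by blast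
  obtain T' g' where g': "open T'" "T \<subseteq> T'" "\<And>m. Ck_on m g' T'" "\<And>x. x \<in> T \<Longrightarrow> g' x = g x"
    using assms(2) unfolding smooth_on_def by blast
  let ?R = "S' \<inter> f' -` T'"
  have o: "open ?R"
    using continuous_open_preimage[OF Ck_on_imp_continuous_on[OF f'(3)[of 0]] f'(1) g'(1)] .
  have "Ck_on m (\<lambda>x. g' (f' x)) ?R" for m
    by (rule Ck_on_compose[OF o g'(1) Ck_on_subset[OF f'(3)] g'(3)]) auto
  moreover have "S \<subseteq> ?R" using f' g' assms(3) by force
  moreover have "g' (f' x) = g (f x)" if "x \<in> S" for x using f' g' assms(3) that by force
  ultimately show ?thesis unfolding smooth_on_def using o by blast
qed

text \<open>The modulus is not smooth at 0, but there the profile is constant and the twist is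
  linear; away from 0 all ingredients are smooth. A general constant \<open>c\<close> also covers
  the inverse twist, with the profile negated.\<close>

lemma smooth_twist_map:
  assumes "smooth_on {0..} \<alpha>" "\<And>r. r \<in> {0..3 / 2} \<Longrightarrow> \<alpha> r = c"
  shows "smooth_on UNIV (twist_map \<alpha>)"
  unfolding smooth_on_UNIV
proof (intro allI Ck_on_local)
  fix m and z :: complex
  obtain T a where a: "open T" "{0..} \<subseteq> T" "\<And>m. Ck_on m a T" "\<And>x. x \<in> {0..} \<Longrightarrow> a x = \<alpha> x"
    using assms(1) unfolding smooth_on_def by blast
  show "\<exists>T. open T \<and> z \<in> T \<and> Ck_on m (twist_map \<alpha>) T"
  proof (cases "cmod z < 3 / 2")
    case True
    have "Ck_on m (\<lambda>z. z * cis (c * pi)) (ball 0 (3 / 2))"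
      by (rule Ck_on_bounded_linear[OF bounded_linear_mult_left])
    then have "Ck_on m (twist_map \<alpha>) (ball 0 (3 / 2))"
      by (rule Ck_on_cong[OF open_ball]) (use assms(2) in \<open>auto simp: twist_map_def\<close>)
    then show ?thesis using True by (intro exI[of _ "ball 0 (3 / 2)"]) auto
  next
    case False
    have o: "open (- {0::complex})" by auto
    have "Ck_on m (\<lambda>z. a (cmod z)) (- {0})"
      by (rule Ck_on_compose[OF o a(1) Ck_on_norm a(3)]) (auto intro!: subsetD[OF a(2)])
    then have "Ck_on m (\<lambda>z. a (cmod z) * pi) (- {0})" by (intro Ck_on_mult o Ck_on_const)
    then have "Ck_on m (\<lambda>z. cis (a (cmod z) * pi)) (- {0})"
      by (rule Ck_on_compose[OF o open_UNIV _ Ck_on_cis]) auto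
    then have "Ck_on m (\<lambda>z. z * cis (a (cmod z) * pi)) (- {0})"
      by (intro Ck_on_mult o Ck_on_bounded_linear[OF bounded_linear_ident])
    then have "Ck_on m (twist_map \<alpha>) (- {0})"
      by (rule Ck_on_cong[OF o]) (use a(4) in \<open>auto simp: twist_map_def\<close>)
    then show ?thesis using False o by (intro exI[of _ "- {0}"]) auto
  qed
qed

section \<open>Existence of half-twists\<close>

text \<open>Since \<open>Defs.half_twist\<close> is a \<open>SOME\<close>, some \<open>f\<close> has to be exhibited: a diffeomorphism of the plane that takes the real segment with midpoint \<open>m\<close>
  and half-length \<open>w\<close> to \<open>[-1, 1]\<close> and whose preimage of \<open>ball 0 2\<close> is thin for large \<open>c\<close> and \<open>C\<close>.\<close>

context
  fixes m w c C :: real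
  assumes w: "w > 0" and c: "c > 0" and C: "C > 0"
begin

text \<open>A linear map would pull the disk of radius 2 back to a set twice as long as the segment.
  The hyperbolic sine keeps the ends of the segment at -1 and 1 and is so steep beyond them that the
  value 2 is reached after a short distance.\<close>

definition squeeze :: "complex \<Rightarrow> complex" where
  "squeeze z = of_real (sinh ((Re z - m) * (c / w)) / sinh c) + of_real (C * Im z) * \<i>"

definition unsqueeze :: "complex \<Rightarrow> complex" where
  "unsqueeze z = of_real (m + w / c * arsinh (sinh c * Re z)) + of_real (Im z / C) * \<i>"

lemma sinh_c: "sinh c > 0"
  using c by simp

lemma unsqueeze_squeeze: "unsqueeze (squeeze z) = z"
  using sinh_c w c C by (simp add: squeeze_def unsqueeze_def complex_eq_iff arsinh_sinh_real)

lemma squeeze_unsqueeze: "squeeze (unsqueeze z) = z"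
  using sinh_c w c C by (simp add: squeeze_def unsqueeze_def complex_eq_iff sinh_arsinh_real)

lemma bij_squeeze: "bij squeeze"
  by (rule bij_betw_byWitness[of _ unsqueeze]) (auto simp: unsqueeze_squeeze squeeze_unsqueeze)

lemma inv_squeeze: "inv_into UNIV squeeze = unsqueeze"
  using inv_equality[of unsqueeze squeeze] unsqueeze_squeeze squeeze_unsqueeze by blast

lemma smooth_squeeze: "smooth_on UNIV squeeze"
  unfolding smooth_on_UNIV
proof
  fix q
  have "Ck_on q (\<lambda>z. Re z * (c / w) + (- m * (c / w))) UNIV"
    by (intro Ck_on_add Ck_on_mult Ck_on_const Ck_on_bounded_linear[OF bounded_linear_Re] open_UNIV)
  then have "Ck_on q (\<lambda>z. sinh (Re z * (c / w) + (- m * (c / w)))) UNIV"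
    by (rule Ck_on_compose[OF open_UNIV open_UNIV _ conjunct1[OF Ck_on_sinh_cosh]]) simp
  then have "Ck_on q (\<lambda>z. sinh (Re z * (c / w) + (- m * (c / w))) * inverse (sinh c)) UNIV"
    by (intro Ck_on_mult Ck_on_const open_UNIV)
  then have re: "Ck_on q (\<lambda>z. complex_of_real (sinh (Re z * (c / w) + (- m * (c / w))) * inverse (sinh c))) UNIV"
    by (rule Ck_on_linear_comp[OF bounded_linear_of_real open_UNIV])
  have im: "Ck_on q (\<lambda>z. complex_of_real (Im z)) UNIV"
    by (rule Ck_on_linear_comp[OF bounded_linear_of_real open_UNIV Ck_on_bounded_linear[OF bounded_linear_Im]])
  have "Ck_on q (\<lambda>z. complex_of_real (sinh (Re z * (c / w) + (- m * (c / w))) * inverse (sinh c)) + of_real (Im z) * (of_real C * \<i>)) UNIV"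
    by (rule Ck_on_add[OF open_UNIV re Ck_on_mult[OF open_UNIV im Ck_on_const]])
  moreover have "(\<lambda>z. complex_of_real (sinh (Re z * (c / w) + (- m * (c / w))) * inverse (sinh c)) + of_real (Im z) * (of_real C * \<i>)) = squeeze"
    by (simp add: squeeze_def fun_eq_iff divide_inverse algebra_simps)
  ultimately show "Ck_on q squeeze UNIV" by simp
qed

lemma smooth_unsqueeze: "smooth_on UNIV unsqueeze"
  unfolding smooth_on_UNIV
proof
  fix q
  have "Ck_on q (\<lambda>z. Re z * sinh c) UNIV"
    by (intro Ck_on_mult Ck_on_const Ck_on_bounded_linear[OF bounded_linear_Re] open_UNIV)
  then have "Ck_on q (\<lambda>z. arsinh (Re z * sinh c)) UNIV"
    by (rule Ck_on_compose[OF open_UNIV open_UNIV _ Ck_on_arsinh]) simp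
  then have "Ck_on q (\<lambda>z. arsinh (Re z * sinh c) * (w / c) + m) UNIV"
    by (intro Ck_on_add Ck_on_mult Ck_on_const open_UNIV)
  then have re: "Ck_on q (\<lambda>z. complex_of_real (arsinh (Re z * sinh c) * (w / c) + m)) UNIV"
    by (rule Ck_on_linear_comp[OF bounded_linear_of_real open_UNIV])
  have im: "Ck_on q (\<lambda>z. complex_of_real (Im z)) UNIV"
    by (rule Ck_on_linear_comp[OF bounded_linear_of_real open_UNIV Ck_on_bounded_linear[OF bounded_linear_Im]])
  have "Ck_on q (\<lambda>z. complex_of_real (arsinh (Re z * sinh c) * (w / c) + m) + of_real (Im z) * (of_real (inverse C) * \<i>)) UNIV"
    by (rule Ck_on_add[OF open_UNIV re Ck_on_mult[OF open_UNIV im Ck_on_const]])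
  moreover have "(\<lambda>z. complex_of_real (arsinh (Re z * sinh c) * (w / c) + m) + of_real (Im z) * (of_real (inverse C) * \<i>)) = unsqueeze"
    by (simp add: unsqueeze_def fun_eq_iff divide_inverse mult_ac add_ac)
  ultimately show "Ck_on q unsqueeze UNIV" by simp
qed

lemma plane_diffeo_squeeze: "plane_diffeo squeeze"
  unfolding plane_diffeo_def inv_squeeze using bij_squeeze smooth_squeeze smooth_unsqueeze by blast

lemma orientation_preserving_squeeze: "orientation_preserving squeeze"
  unfolding orientation_preserving_def
proof
  fix z
  define s where "s = cosh ((Re z - m) * (c / w)) * (c / w) / sinh c"
  have s: "s > 0" unfolding s_def using sinh_c c w by simp
  have 1: "((\<lambda>z. (Re z - m) * (c / w)) has_derivative (\<lambda>h. Re h * (c / w))) (at z)"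
    using w by (auto intro!: derivative_eq_intros)
  have "((\<lambda>z. sinh ((Re z - m) * (c / w))) has_derivative (\<lambda>h. Re h * (c / w) * cosh ((Re z - m) * (c / w)))) (at z)"
    by (rule DERIV_compose_FDERIV[OF _ 1]) (auto intro!: derivative_eq_intros)
  then have "((\<lambda>z. sinh ((Re z - m) * (c / w)) / sinh c) has_derivative
      (\<lambda>h. Re h * (c / w) * cosh ((Re z - m) * (c / w)) / sinh c)) (at z)"
    by (rule bounded_linear.has_derivative[OF bounded_linear_divide])
  then have re: "((\<lambda>z. complex_of_real (sinh ((Re z - m) * (c / w)) / sinh c)) has_derivative
      (\<lambda>h. of_real (Re h * (c / w) * cosh ((Re z - m) * (c / w)) / sinh c))) (at z)"
    by (rule has_derivative_of_real)
  have im: "((\<lambda>z. of_real (C * Im z) * \<i>) has_derivative (\<lambda>h. of_real (C * Im h) * \<i>)) (at z)"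
    by (auto intro!: derivative_eq_intros)
  have "(squeeze has_derivative (\<lambda>h. of_real (Re h * (c / w) * cosh ((Re z - m) * (c / w)) / sinh c) + of_real (C * Im h) * \<i>)) (at z)"
    unfolding squeeze_def[abs_def] by (rule has_derivative_add[OF re im])
  then have "frechet_derivative squeeze (at z) = (\<lambda>h. of_real (Re h * (c / w) * cosh ((Re z - m) * (c / w)) / sinh c) + of_real (C * Im h) * \<i>)"
    by (rule frechet_derivative_at[symmetric])
  also have "\<dots> = (\<lambda>h. of_real (s * Re h) + of_real (C * Im h) * \<i>)"
    by (simp add: s_def mult_ac fun_eq_iff)
  finally have d: "frechet_derivative squeeze (at z) = (\<lambda>h. of_real (s * Re h) + of_real (C * Im h) * \<i>)" .
  show "0 < jacobian_det squeeze z"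
    unfolding jacobian_det_def d Let_def using s C by simp
qed

lemma squeeze_segment:
  assumes "a = of_real (m - w)" "b = of_real (m + w)"
  shows "squeeze ` closed_segment a b = closed_segment (- 1) 1"
proof -
  have seg: "z \<in> closed_segment a b \<longleftrightarrow> Im z = 0 \<and> m - w \<le> Re z \<and> Re z \<le> m + w" for z
  proof -
    have "closed_segment a b = of_real ` closed_segment (m - w) (m + w)"
      unfolding assms by (rule closed_segment_of_real)
    also have "closed_segment (m - w) (m + w) = {m - w..m + w}"
      using w by (simp add: closed_segment_eq_real_ivl)
    finally show ?thesis by (auto simp: image_iff complex_eq_iff intro!: bexI[of _ "Re z"])
  qed
  have key: "\<bar>sinh (t * (c / w)) / sinh c\<bar> \<le> 1 \<longleftrightarrow> - w \<le> t \<and> t \<le> w" for t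
  proof -
    have "\<bar>sinh (t * (c / w)) / sinh c\<bar> \<le> 1 \<longleftrightarrow> - sinh c \<le> sinh (t * (c / w)) \<and> sinh (t * (c / w)) \<le> sinh c"
      using sinh_c by (auto simp: abs_le_iff field_simps)
    also have "\<dots> \<longleftrightarrow> sinh (- c) \<le> sinh (t * (c / w)) \<and> sinh (t * (c / w)) \<le> sinh c" by simp
    also have "\<dots> \<longleftrightarrow> - c \<le> t * (c / w) \<and> t * (c / w) \<le> c" by (simp only: sinh_real_le_iff)
    also have "\<dots> \<longleftrightarrow> - w \<le> t \<and> t \<le> w"
    proof -
      have q: "c / w > 0" "c = w * (c / w)" "- c = (- w) * (c / w)" using c w by auto
      have "- c \<le> t * (c / w) \<longleftrightarrow> (- w) * (c / w) \<le> t * (c / w)"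
        "t * (c / w) \<le> c \<longleftrightarrow> t * (c / w) \<le> w * (c / w)" using q by simp_all
      then show ?thesis by (simp only: mult_le_cancel_right_pos[OF q(1)])
    qed
    finally show ?thesis .
  qed
  have iff: "squeeze z \<in> closed_segment (- 1) 1 \<longleftrightarrow> z \<in> closed_segment a b" for z
    using key[of "Re z - m"] C by (auto simp: in_unit_segment seg squeeze_def)
  show ?thesis
  proof (intro equalityI subsetI)
    fix y assume "y \<in> closed_segment (- 1) (1::complex)"
    then have "unsqueeze y \<in> closed_segment a b" using iff[of "unsqueeze y"] by (simp add: squeeze_unsqueeze)
    then show "y \<in> squeeze ` closed_segment a b"
      by (intro image_eqI[of _ _ "unsqueeze y"]) (simp_all add: squeeze_unsqueeze)
  qed (use iff in auto)
qed

lemma squeeze_preimage_bounds: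
  assumes "cmod (squeeze z) \<le> 2" "\<eta> > 0" "c * \<eta> \<ge> 3"
  shows "\<bar>Re z - m\<bar> \<le> w * (1 + \<eta>)" "\<bar>Im z\<bar> \<le> 2 / C"
proof -
  have "\<bar>Re (squeeze z)\<bar> \<le> 2" "\<bar>Im (squeeze z)\<bar> \<le> 2"
    using assms(1) abs_Re_le_cmod abs_Im_le_cmod order_trans by blast+
  then have re: "\<bar>sinh ((Re z - m) * (c / w))\<bar> / sinh c \<le> 2" and im: "C * \<bar>Im z\<bar> \<le> 2"
    using sinh_c C by (auto simp: squeeze_def abs_mult)
  show "\<bar>Im z\<bar> \<le> 2 / C" using im C by (simp add: field_simps)
  \<comment> \<open>The bound 3 enters here: exp 3 is at least 4, so the hyperbolic cosine is at
    least 2. By the addition formula \<open>sinh (c + c * \<eta>)\<close> then exceeds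
    \<open>2 * sinh c\<close>.\<close>
  have ch: "cosh (c * \<eta>) \<ge> 2"
  proof -
    have "exp (c * \<eta>) \<ge> 1 + c * \<eta>" by (rule exp_ge_add_one_self)
    then have "exp (c * \<eta>) / 2 \<ge> 2" using assms(3) by linarith
    moreover have "cosh (c * \<eta>) = exp (c * \<eta>) / 2 + exp (- (c * \<eta>)) / 2"
      by (simp add: cosh_def scaleR_conv_of_real add_divide_distrib)
    moreover have "exp (- (c * \<eta>)) \<ge> 0" by simp
    ultimately show ?thesis by linarith
  qed
  have "\<bar>sinh ((Re z - m) * (c / w))\<bar> \<le> sinh c * 2" using re sinh_c by (simp add: field_simps)
  also have "\<dots> \<le> sinh c * cosh (c * \<eta>)" using ch sinh_c by simp
  also have "\<dots> \<le> sinh c * cosh (c * \<eta>) + cosh c * sinh (c * \<eta>)"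
    using c assms(2) by (simp add: less_imp_le)
  also have "\<dots> = sinh (c + c * \<eta>)" by (simp add: sinh_add)
  finally have "sinh \<bar>(Re z - m) * (c / w)\<bar> \<le> sinh (c + c * \<eta>)" by (simp only: sinh_real_abs)
  then have "\<bar>(Re z - m) * (c / w)\<bar> \<le> c + c * \<eta>" by (simp only: sinh_real_le_iff)
  moreover have q: "c / w > 0" using c w by simp
  moreover have "\<bar>(Re z - m) * (c / w)\<bar> = \<bar>Re z - m\<bar> * (c / w)"
    using q by (simp only: abs_mult abs_of_pos)
  moreover have "c + c * \<eta> = (w * (1 + \<eta>)) * (c / w)"
    using w by (simp add: field_simps)
  ultimately have "\<bar>Re z - m\<bar> * (c / w) \<le> (w * (1 + \<eta>)) * (c / w)" by simp
  then show "\<bar>Re z - m\<bar> \<le> w * (1 + \<eta>)"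
    by (simp only: mult_le_cancel_right_pos[OF q])
qed

end

context marked_disk
begin

lemma ex_half_twist_diffeo:
  assumes i: "i \<in> {1..<n}"
  shows "\<exists>\<beta>. half_twist_diffeo K (linepath (k i) (k (Suc i))) \<beta>"
proof -
  let ?a = "k i" and ?b = "k (Suc i)"
  have i1: "i \<in> {1..n}" and i2: "Suc i \<in> {1..n}" using i by auto
  obtain e1 where e1: "e1 > 0" "\<And>\<epsilon>. 0 < \<epsilon> \<Longrightarrow> \<epsilon> \<le> e1 \<Longrightarrow> admissible i \<epsilon>"
    using admissible_small[OF i1] by blast
  obtain e2 where e2: "e2 > 0" "\<And>\<epsilon>. 0 < \<epsilon> \<Longrightarrow> \<epsilon> \<le> e2 \<Longrightarrow> admissible (Suc i) \<epsilon>"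
    using admissible_small[OF i2] by blast
  define \<epsilon> where "\<epsilon> = min e1 e2"
  have \<epsilon>: "\<epsilon> > 0" and adm1: "admissible i \<epsilon>" and adm2: "admissible (Suc i) \<epsilon>"
    using e1 e2 by (auto simp: \<epsilon>_def)
  have ab: "Re ?a < Re ?b" using k_less[OF i1 i2] by simp
  define m where "m = (Re ?a + Re ?b) / 2"
  define w where "w = (Re ?b - Re ?a) / 2"
  have w: "w > 0" using ab by (simp add: w_def)
  have mw: "m - w = Re ?a" "m + w = Re ?b" by (simp_all add: m_def w_def field_simps)
  \<comment> \<open>The relative overshoot that lets the neighbourhood extend at most \<epsilon>
    beyond each end of the segment.\<close>
  define \<eta> where "\<eta> = \<epsilon> / w"
  have \<eta>: "\<eta> > 0" "w * (1 + \<eta>) = w + \<epsilon>" using w \<epsilon> by (auto simp: \<eta>_def field_simps)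
  define c where "c = 3 / \<eta>"
  have c: "c > 0" "c * \<eta> \<ge> 3" using \<eta>(1) by (auto simp: c_def)
  \<comment> \<open>Bounds the real parts in the neighbourhood; it is below 1 because the
    \<epsilon>-balls about both ends lie in the open disk.\<close>
  define r where "r = max \<bar>Re ?a - \<epsilon>\<bar> \<bar>Re ?b + \<epsilon>\<bar>"
  have inball: "\<bar>Re z\<bar> < 1" if "z \<in> interior disk" for z
    using that abs_Re_le_cmod[of z] by (auto simp: interior_disk)
  have "?a - of_real \<epsilon> \<in> cball ?a \<epsilon>" "?b + of_real \<epsilon> \<in> cball ?b \<epsilon>"
    using \<epsilon> by (auto simp: dist_norm)
  then have "?a - of_real \<epsilon> \<in> interior disk" "?b + of_real \<epsilon> \<in> interior disk"
    using adm1 adm2 unfolding admissible_def by blast+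
  then have r: "r < 1" using inball[of "?a - of_real \<epsilon>"] inball[of "?b + of_real \<epsilon>"] by (simp add: r_def)
  \<comment> \<open>Makes the imaginary parts at most \<open>(1 - r) / 2\<close>, so that moduli
    stay below \<open>r + (1 - r) / 2\<close>, which is less than 1.\<close>
  define C where "C = 4 / (1 - r)"
  have C: "C > 0" "2 / C = (1 - r) / 2" using r by (auto simp: C_def)
  let ?f = "squeeze m w c C"
  define U where "U = ?f -` ball 0 2"
  have cont: "continuous_on UNIV ?f"
    using plane_diffeo_facts(2)[OF plane_diffeo_squeeze[OF w c(1) C(1)]] .
  have openU: "open U" unfolding U_def by (rule open_vimage[OF open_ball cont])
  have "closed (?f -` cball 0 2)" by (rule closed_vimage[OF closed_cball cont])
  then have clU: "closure U \<subseteq> ?f -` cball 0 2"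
    unfolding U_def by (intro closure_minimal vimage_mono) auto
  have box: "\<bar>Re z - m\<bar> \<le> w + \<epsilon>" "\<bar>Im z\<bar> \<le> (1 - r) / 2" if "z \<in> closure U" for z
    using squeeze_preimage_bounds[OF w c(1) C(1) _ \<eta>(1) c(2), where z = z and m = m] clU that
    unfolding \<eta>(2) C(2) by auto
  have int: "closure U \<subseteq> interior disk"
  proof
    fix z assume z: "z \<in> closure U"
    have "Re ?a - \<epsilon> \<le> Re z" "Re z \<le> Re ?b + \<epsilon>" using box(1)[OF z] mw by linarith+
    then have "\<bar>Re z\<bar> \<le> r" by (simp add: r_def)
    then have "cmod z \<le> r + (1 - r) / 2" using cmod_le[of z] box(2)[OF z] by linarith
    also have "\<dots> < 1" using r by (simp add: field_simps)
    finally show "z \<in> interior disk" by (simp add: interior_disk)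
  qed
  have a: "?a = of_real (m - w)" and b: "?b = of_real (m + w)"
    using k_Re[OF i1] k_Re[OF i2] mw by simp_all
  have seg: "?f ` closed_segment ?a ?b = closed_segment (- 1) 1"
    by (rule squeeze_segment[OF w c(1) C(1) a b])
  have segU: "closed_segment ?a ?b \<subseteq> U"
  proof
    fix z assume "z \<in> closed_segment ?a ?b"
    then have "?f z \<in> closed_segment (- 1) 1" using seg by blast
    then have "cmod (?f z) \<le> 1" by (simp add: in_unit_segment cmod_eq_Re)
    then show "z \<in> U" by (simp add: U_def)
  qed
  \<comment> \<open>A marked point in the closure is at most \<epsilon> beyond an end of the
    segment, hence equal to that end by admissibility; none lies strictly between the ends.\<close>
  have "closure U \<inter> K = {?a, ?b}"
  proof (intro equalityI subsetI)
    fix z assume "z \<in> closure U \<inter> K"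
    then obtain j where j: "j \<in> {1..n}" "z = k j" and z: "z \<in> closure U" by blast
    have "\<bar>Re (k j) - m\<bar> \<le> w + \<epsilon>" using box(1)[OF z] j(2) by simp
    then have bd: "Re ?a - \<epsilon> \<le> Re (k j)" "Re (k j) \<le> Re ?b + \<epsilon>" using mw by linarith+
    have near: "k j = k l" if "admissible l \<epsilon>" "l \<in> {1..n}" "\<bar>Re (k l) - Re (k j)\<bar> \<le> \<epsilon>" for l
    proof -
      have "k j \<in> cball (k l) \<epsilon>"
        using that k_in(2)[OF j(1)] k_in(2)[OF that(2)] by (simp add: dist_norm cmod_eq_Re)
      then show ?thesis using that(1) j(1) unfolding admissible_def by blast
    qed
    consider "j \<le> i" | "j \<ge> Suc i" by linarith
    then show "z \<in> {?a, ?b}"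
    proof cases
      case 1
      then have "\<bar>Re ?a - Re (k j)\<bar> \<le> \<epsilon>" using k_le[OF j(1) i1] bd by simp
      then show ?thesis using near[OF adm1 i1] j by simp
    next
      case 2
      then have "\<bar>Re ?b - Re (k j)\<bar> \<le> \<epsilon>" using k_le[OF i2 j(1)] bd by simp
      then show ?thesis using near[OF adm2 i2] j by simp
    qed
  next
    fix z assume "z \<in> {?a, ?b}"
    moreover have "?a \<in> closed_segment ?a ?b" "?b \<in> closed_segment ?a ?b" by auto
    ultimately show "z \<in> closure U \<inter> K" using segU closure_subset[of U] i1 i2 by blast
  qed
  moreover have "?f ` U = ball 0 2"
    unfolding U_def using bij_is_surj[OF bij_squeeze[OF w c(1) C(1)]] by (simp add: surj_image_vimage_eq)
  moreover obtain \<alpha> where "twist_profile \<alpha>" using ex_twist_profile by blast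
  ultimately show ?thesis
    unfolding half_twist_diffeo_def
    using openU segU int seg plane_diffeo_squeeze[OF w c(1) C(1)] orientation_preserving_squeeze[OF w c(1) C(1)]
    by (intro exI[of _ "restrict (inv_into UNIV ?f \<circ> twist_map \<alpha> \<circ> ?f) disk"] exI[of _ U] exI[of _ ?f] exI[of _ \<alpha>]) auto
qed

end

section \<open>Braids and words\<close>

lemma smooth_inverse_compose:
  assumes "\<beta> \<in> Bij S" "\<beta>' \<in> Bij S"
    "smooth_on S (inv_into S \<beta>)" "smooth_on S (inv_into S \<beta>')"
  shows "smooth_on S (inv_into S (compose S \<beta>' \<beta>))"
proof -
  have b: "bij_betw \<beta> S S" "bij_betw \<beta>' S S" using assms by (auto simp: Bij_def)
  have i: "inv_into S \<beta>' ` S \<subseteq> S" using bij_betw_imp_surj_on[OF bij_betw_inv_into[OF b(2)]] by simp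
  have "smooth_on S (\<lambda>z. inv_into S \<beta> (inv_into S \<beta>' z))"
    by (rule smooth_on_compose[OF assms(4,3) i])
  then show ?thesis
  proof (rule smooth_on_cong)
    fix z assume z: "z \<in> S"
    let ?x = "inv_into S \<beta> (inv_into S \<beta>' z)"
    have y: "inv_into S \<beta>' z \<in> S" using i z by blast
    have x: "?x \<in> S" using bij_betw_imp_surj_on[OF bij_betw_inv_into[OF b(1)]] y by blast
    have "compose S \<beta>' \<beta> ?x = z"
      using x y z b by (simp add: compose_def bij_betw_inv_into_right)
    moreover have "inj_on (compose S \<beta>' \<beta>) S"
      using compose_Bij[OF assms(2,1)] by (simp add: Bij_def bij_betw_def)
    ultimately show "?x = inv_into S (compose S \<beta>' \<beta>) z"
      using x inv_into_f_f by metis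
  qed
qed

section \<open>The group of diffeomorphisms\<close>

context marked_disk
begin

declare One_nat_def [simp del]

abbreviation "DD \<equiv> carrier (disk_diffeos K)"

lemma DD_D:
  assumes "\<beta> \<in> DD"
  shows "\<beta> \<in> Bij disk" "smooth_on disk \<beta>" "smooth_on disk (inv_into disk \<beta>)" "\<beta> ` K = K"
    "\<And>z. z \<in> frontier disk \<Longrightarrow> \<beta> z = z"
    "bij_betw \<beta> disk disk" "continuous_on X \<beta>" "\<beta> ` X \<subseteq> X" "\<beta> base_pt = base_pt"
proof -
  show 1: "\<beta> \<in> Bij disk" "smooth_on disk \<beta>" "smooth_on disk (inv_into disk \<beta>)" "\<beta> ` K = K"
    "\<And>z. z \<in> frontier disk \<Longrightarrow> \<beta> z = z"
    using assms by (auto simp: disk_diffeos_def)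
  show b: "bij_betw \<beta> disk disk" using 1(1) by (simp add: Bij_def)
  show "continuous_on X \<beta>"
    by (rule continuous_on_subset[OF smooth_on_imp_continuous_on[OF 1(2)]]) blast
  have KD: "K \<subseteq> disk" using k_in(1) by blast
  have "\<beta> ` X = \<beta> ` disk - \<beta> ` K"
    using b KD by (intro inj_on_image_set_diff[of \<beta> disk]) (auto simp: bij_betw_def)
  then show "\<beta> ` X \<subseteq> X" using b 1(4) by (simp add: bij_betw_def)
  have "base_pt \<in> frontier disk" by (simp add: base_pt_def disk_def frontier_cball)
  then show "\<beta> base_pt = base_pt" by (rule 1(5))
qed

lemma DD_I:
  assumes "\<beta> \<in> Bij disk" "smooth_on disk \<beta>" "smooth_on disk (inv_into disk \<beta>)" "\<beta> ` K = K"
    "\<And>z. z \<in> frontier disk \<Longrightarrow> \<beta> z = z"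
  shows "\<beta> \<in> DD"
  using assms by (simp add: disk_diffeos_def)

lemma frontier_subset_disk: "frontier disk \<subseteq> disk"
  by (simp add: disk_def frontier_cball sphere_cball)

lemma K_subset_disk: "K \<subseteq> disk"
  using k_in(1) by blast

lemma DD_compose:
  assumes "\<beta> \<in> DD" "\<beta>' \<in> DD"
  shows "compose disk \<beta>' \<beta> \<in> DD"
proof (rule DD_I)
  note b = DD_D[OF assms(1)] and b' = DD_D[OF assms(2)]
  show "compose disk \<beta>' \<beta> \<in> Bij disk" by (rule compose_Bij[OF b'(1) b(1)])
  have im: "\<beta> ` disk \<subseteq> disk" using b(6) by (simp add: bij_betw_def)
  have "smooth_on disk (\<lambda>z. \<beta>' (\<beta> z))" by (rule smooth_on_compose[OF b(2) b'(2) im])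
  then show "smooth_on disk (compose disk \<beta>' \<beta>)" by (rule smooth_on_cong) (simp add: compose_def)
  show "smooth_on disk (inv_into disk (compose disk \<beta>' \<beta>))"
    by (rule smooth_inverse_compose[OF b(1) b'(1) b(3) b'(3)])
  have "compose disk \<beta>' \<beta> ` K = \<beta>' ` \<beta> ` K"
    unfolding image_comp[of \<beta>' \<beta> K]
  proof (rule image_cong)
    fix x assume "x \<in> K"
    then have "x \<in> disk" using K_subset_disk by blast
    then show "compose disk \<beta>' \<beta> x = (\<beta>' \<circ> \<beta>) x" by (simp add: compose_def)
  qed simp
  then show "compose disk \<beta>' \<beta> ` K = K" using b(4) b'(4) by simp
  show "compose disk \<beta>' \<beta> z = z" if "z \<in> frontier disk" for z
    using b(5)[OF that] b'(5)[OF that] subsetD[OF frontier_subset_disk that] by (simp add: compose_def)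
qed

lemma DD_inverse:
  assumes "\<beta> \<in> DD"
  defines "\<beta>' \<equiv> restrict (inv_into disk \<beta>) disk"
  shows "\<beta>' \<in> DD" "\<And>z. z \<in> disk \<Longrightarrow> \<beta>' (\<beta> z) = z" "\<And>z. z \<in> disk \<Longrightarrow> \<beta> (\<beta>' z) = z"
proof -
  note b = DD_D[OF assms(1)]
  show l: "\<beta>' (\<beta> z) = z" if "z \<in> disk" for z
    using that b(6) bij_betw_apply[OF b(6) that] by (simp add: \<beta>'_def bij_betw_inv_into_left)
  show r: "\<beta> (\<beta>' z) = z" if "z \<in> disk" for z
    using that b(6) by (simp add: \<beta>'_def bij_betw_inv_into_right)
  have B: "\<beta>' \<in> Bij disk" unfolding \<beta>'_def by (rule restrict_inv_into_Bij[OF b(1)])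
  show "\<beta>' \<in> DD"
  proof (rule DD_I[OF B])
    show "smooth_on disk \<beta>'" by (rule smooth_on_cong[OF b(3)]) (simp add: \<beta>'_def)
    show "smooth_on disk (inv_into disk \<beta>')"
    proof (rule smooth_on_cong[OF b(2)])
      fix z assume z: "z \<in> disk"
      have "inj_on \<beta>' disk" using B by (simp add: Bij_def bij_betw_def)
      then show "\<beta> z = inv_into disk \<beta>' z"
        using l[OF z] inv_into_f_f[of \<beta>' disk "\<beta> z"] bij_betw_apply[OF b(6) z] by simp
    qed
    have "\<beta>' ` \<beta> ` K = K"
      unfolding image_image using l K_subset_disk by (force intro!: image_eqI)
    then show "\<beta>' ` K = K" using b(4) by simp
    show "\<beta>' z = z" if "z \<in> frontier disk" for z
      using l[of z] b(5)[OF that] that frontier_subset_disk by auto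
  qed
qed

lemma DD_one: "(\<lambda>z\<in>disk. z) \<in> DD"
proof (rule DD_I)
  show B: "(\<lambda>z\<in>disk. z) \<in> Bij disk" by (rule id_Bij)
  have id: "smooth_on disk (\<lambda>z::complex. z)"
    by (rule smooth_on_subset[of UNIV]) (simp_all add: smooth_on_UNIV Ck_on_bounded_linear)
  then show "smooth_on disk (\<lambda>z\<in>disk. z)" by (rule smooth_on_cong) simp
  show "smooth_on disk (inv_into disk (\<lambda>z\<in>disk. z))"
  proof (rule smooth_on_cong[OF id])
    fix z assume z: "z \<in> disk"
    have "inj_on (\<lambda>z\<in>disk. z) disk" by (simp add: inj_on_def)
    then show "z = inv_into disk (\<lambda>z\<in>disk. z) z" using z inv_into_f_f[of "\<lambda>z\<in>disk. z" disk z] by simp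
  qed
  show "(\<lambda>z\<in>disk. z) ` K = K" using K_subset_disk by (force simp: image_iff)
  show "\<And>z. z \<in> frontier disk \<Longrightarrow> (\<lambda>z\<in>disk. z) z = z" using frontier_subset_disk by auto
qed

section \<open>The action on the free group and the braid group\<close>

definition acts :: "(complex \<Rightarrow> complex) \<Rightarrow> nat \<Rightarrow> nat fgroup" where
  "acts \<beta> j = W (\<beta> \<circ> std_loop j)"

lemma DD_path: "\<beta> \<in> DD \<Longrightarrow> path_between X base_pt base_pt p \<Longrightarrow> path_between X base_pt base_pt (\<beta> \<circ> p)"
  using path_between_image[OF _ DD_D(7,8)] DD_D(9) by metis

lemma W_cong:
  assumes "path_between X x y p" "\<And>t. t \<in> {0..1} \<Longrightarrow> p t = q t"
  shows "W p = W q"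
  by (rule W_homotopic, rule homotopic_paths_eq) (use assms in \<open>auto simp: path_between_def\<close>)

lemma W_DD:
  assumes "\<beta> \<in> DD" "path_between X base_pt base_pt p" "W p = fg_class w" "fst ` set w \<subseteq> {1..n}"
  shows "W (\<beta> \<circ> p) = fg_eval (acts \<beta>) w"
  using W_image_eq_fg_eval[OF std_loop W_std_loop DD_D(7,8,9)[OF assms(1)] assms(2-4)]
  unfolding acts_def .

lemma fg_word_W: "fst ` set (fg_word (W p)) \<subseteq> {1..n}"
  using fg_letters_W[of p] by (simp add: fg_letters_def)

lemma fg_eval_cong: "(\<And>j. j \<in> A \<Longrightarrow> f j = g j) \<Longrightarrow> fst ` set w \<subseteq> A \<Longrightarrow> fg_eval f w = fg_eval g w"
  by (induction w) auto

text \<open>The composite applies \<beta> first. So the word of the image of the loop under \<beta>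
  is read, and each of its letters is replaced by the word that \<beta>' assigns to it.\<close>

lemma acts_compose:
  assumes "\<beta> \<in> DD" "\<beta>' \<in> DD" "j \<in> {1..n}" "acts \<beta> j = fg_class w" "fst ` set w \<subseteq> {1..n}"
  shows "acts (compose disk \<beta>' \<beta>) j = fg_eval (acts \<beta>') w"
proof -
  have p: "path_between X base_pt base_pt (\<beta> \<circ> std_loop j)" by (rule DD_path[OF assms(1) std_loop[OF assms(3)]])
  have "W (compose disk \<beta>' \<beta> \<circ> std_loop j) = W (\<beta>' \<circ> (\<beta> \<circ> std_loop j))"
  proof (rule W_cong[OF DD_path[OF DD_compose[OF assms(1,2)] std_loop[OF assms(3)]]])
    fix t :: real assume "t \<in> {0..1}"
    then have "std_loop j t \<in> disk" using path_between_in[OF std_loop[OF assms(3)]] by blast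
    then show "(compose disk \<beta>' \<beta> \<circ> std_loop j) t = (\<beta>' \<circ> (\<beta> \<circ> std_loop j)) t" by (simp add: compose_def)
  qed
  also have "\<dots> = fg_eval (acts \<beta>') w"
    by (rule W_DD[OF assms(2) p]) (use assms in \<open>auto simp: acts_def\<close>)
  finally show ?thesis by (simp add: acts_def)
qed

lemma acts_one: "j \<in> {1..n} \<Longrightarrow> acts (\<lambda>z\<in>disk. z) j = fg_gen j"
proof -
  assume j: "j \<in> {1..n}"
  have "W ((\<lambda>z\<in>disk. z) \<circ> std_loop j) = W (std_loop j)"
  proof (rule W_cong[OF DD_path[OF DD_one std_loop[OF j]]])
    fix t :: real assume "t \<in> {0..1}"
    then have "std_loop j t \<in> disk" using path_between_in[OF std_loop[OF j]] by blast
    then show "((\<lambda>z\<in>disk. z) \<circ> std_loop j) t = std_loop j t" by simp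
  qed
  then show ?thesis by (simp add: acts_def W_std_loop[OF j])
qed

lemma induced_aut_class:
  assumes "\<beta> \<in> DD" "path_between X base_pt base_pt p"
  shows "induced_aut K \<beta> (homotopy_class X p) = homotopy_class X (\<beta> \<circ> p)"
proof -
  have "homotopy_class X (\<beta> \<circ> q) = homotopy_class X (\<beta> \<circ> p)" if "q \<in> homotopy_class X p" for q
  proof -
    have "homotopic_paths X p q" using that by (simp add: homotopy_class_def)
    then have "homotopic_paths X (\<beta> \<circ> p) (\<beta> \<circ> q)"
      by (rule homotopic_paths_continuous_image[OF _ DD_D(7)[OF assms(1)]]) (use DD_D(8)[OF assms(1)] in blast)
    then show ?thesis using homotopy_class_eq_iff[OF DD_path[OF assms]] by metis
  qed
  moreover have "p \<in> homotopy_class X p" using hp_refl[OF assms(2)] by (simp add: homotopy_class_def)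
  ultimately have "(\<Union>q\<in>homotopy_class X p. homotopy_class X (\<beta> \<circ> q)) = homotopy_class X (\<beta> \<circ> p)" by blast
  then show ?thesis
    unfolding induced_aut_def using fundamental_group_carrierI[OF assms(2)] by simp
qed

text \<open>The word of the image of a loop is obtained by substituting the values on the standard
  loops, and words decide homotopy; so these values determine the automorphism.\<close>

lemma induced_aut_eq_iff:
  assumes "\<beta> \<in> DD" "\<beta>' \<in> DD"
  shows "induced_aut K \<beta> = induced_aut K \<beta>' \<longleftrightarrow> (\<forall>j\<in>{1..n}. acts \<beta> j = acts \<beta>' j)"
proof
  assume eq: "induced_aut K \<beta> = induced_aut K \<beta>'"
  show "\<forall>j\<in>{1..n}. acts \<beta> j = acts \<beta>' j"
  proof
    fix j assume j: "j \<in> {1..n}"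
    note s = std_loop[OF j]
    have "homotopy_class X (\<beta> \<circ> std_loop j) = homotopy_class X (\<beta>' \<circ> std_loop j)"
      using induced_aut_class[OF assms(1) s] induced_aut_class[OF assms(2) s] eq by simp
    then have "homotopic_paths X (\<beta> \<circ> std_loop j) (\<beta>' \<circ> std_loop j)"
      using homotopy_class_eq_iff[OF DD_path[OF assms(1) s]] by blast
    then show "acts \<beta> j = acts \<beta>' j" unfolding acts_def by (rule W_homotopic)
  qed
next
  assume eq: "\<forall>j\<in>{1..n}. acts \<beta> j = acts \<beta>' j"
  show "induced_aut K \<beta> = induced_aut K \<beta>'"
  proof
    fix Y
    show "induced_aut K \<beta> Y = induced_aut K \<beta>' Y"
    proof (cases "Y \<in> carrier (pi1_disk K)")
      case True
      then obtain p where p: "path_between X base_pt base_pt p" "Y = homotopy_class X p"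
        by (rule fundamental_group_carrierE)
      have "W (\<beta> \<circ> p) = fg_eval (acts \<beta>) (fg_word (W p))"
        by (rule W_DD[OF assms(1) p(1) _ fg_word_W]) simp
      also have "\<dots> = fg_eval (acts \<beta>') (fg_word (W p))"
        by (rule fg_eval_cong[OF _ fg_word_W]) (use eq in blast)
      also have "\<dots> = W (\<beta>' \<circ> p)"
        by (rule W_DD[OF assms(2) p(1) _ fg_word_W, symmetric]) simp
      finally have "homotopic_paths X (\<beta> \<circ> p) (\<beta>' \<circ> p)"
        using homotopic_iff_W[OF DD_path[OF assms(1) p(1)] DD_path[OF assms(2) p(1)]] by simp
      then have "homotopy_class X (\<beta> \<circ> p) = homotopy_class X (\<beta>' \<circ> p)"
        using homotopy_class_eq_iff[OF DD_path[OF assms(1) p(1)]] by blast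
      then show ?thesis
        using induced_aut_class[OF assms(1) p(1)] induced_aut_class[OF assms(2) p(1)] p(2) by simp
    \<comment> \<open>Off the carrier both maps are \<open>undefined\<close>.\<close>
    qed (simp add: induced_aut_def)
  qed
qed

lemma braid_class_eq_iff:
  assumes "\<beta> \<in> DD" "\<beta>' \<in> DD"
  shows "braid_class K \<beta> = braid_class K \<beta>' \<longleftrightarrow> (\<forall>j\<in>{1..n}. acts \<beta> j = acts \<beta>' j)"
  unfolding induced_aut_eq_iff[OF assms, symmetric]
proof
  assume "braid_class K \<beta> = braid_class K \<beta>'"
  moreover have "\<beta> \<in> braid_class K \<beta>" using assms by (simp add: braid_class_def)
  ultimately show "induced_aut K \<beta> = induced_aut K \<beta>'" by (simp add: braid_class_def)
qed (simp add: braid_class_def)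

lemma braid_class_mem_iff:
  assumes "\<beta> \<in> DD"
  shows "\<beta>' \<in> braid_class K \<beta> \<longleftrightarrow> \<beta>' \<in> DD \<and> (\<forall>j\<in>{1..n}. acts \<beta>' j = acts \<beta> j)"
  using assms induced_aut_eq_iff by (auto simp: braid_class_def)

lemma acts_compose_word:
  "\<beta> \<in> DD \<Longrightarrow> \<beta>' \<in> DD \<Longrightarrow> j \<in> {1..n} \<Longrightarrow>
    acts (compose disk \<beta>' \<beta>) j = fg_eval (acts \<beta>') (fg_word (acts \<beta> j))"
  by (rule acts_compose) (auto simp: acts_def intro: subsetD[OF fg_word_W])

text \<open>The product is a union over all representatives. By \<open>acts_compose_word\<close> the
  action of a composite depends only on the actions of its factors, so all the classes in the union
  are equal.\<close>

lemma braid_mult: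
  assumes "\<beta> \<in> DD" "\<beta>' \<in> DD"
  shows "braid_class K \<beta> \<otimes>\<^bsub>braid_group K\<^esub> braid_class K \<beta>' = braid_class K (compose disk \<beta>' \<beta>)"
proof -
  have "braid_class K (compose disk \<gamma>' \<gamma>) = braid_class K (compose disk \<beta>' \<beta>)"
    if g: "\<gamma> \<in> braid_class K \<beta>" "\<gamma>' \<in> braid_class K \<beta>'" for \<gamma> \<gamma>'
  proof -
    have gD: "\<gamma> \<in> DD" "\<gamma>' \<in> DD" "\<And>j. j \<in> {1..n} \<Longrightarrow> acts \<gamma> j = acts \<beta> j" "\<And>j. j \<in> {1..n} \<Longrightarrow> acts \<gamma>' j = acts \<beta>' j"
      using g assms by (auto simp: braid_class_mem_iff)
    have "acts (compose disk \<gamma>' \<gamma>) j = acts (compose disk \<beta>' \<beta>) j" if j: "j \<in> {1..n}" for j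
    proof -
      have "acts (compose disk \<gamma>' \<gamma>) j = fg_eval (acts \<gamma>') (fg_word (acts \<beta> j))"
        using acts_compose_word[OF gD(1,2) j] gD(3)[OF j] by simp
      also have "\<dots> = fg_eval (acts \<beta>') (fg_word (acts \<beta> j))"
        by (intro fg_eval_cong[where A = "{1..n}"] gD(4)) (simp_all only: acts_def fg_word_W)
      finally show ?thesis using acts_compose_word[OF assms j] by simp
    qed
    then show ?thesis using braid_class_eq_iff DD_compose gD assms by blast
  qed
  moreover have "\<beta> \<in> braid_class K \<beta>" "\<beta>' \<in> braid_class K \<beta>'"
    using assms by (auto simp: braid_class_mem_iff)
  ultimately have "(\<Union>\<gamma>\<in>braid_class K \<beta>. \<Union>\<gamma>'\<in>braid_class K \<beta>'. braid_class K (compose disk \<gamma>' \<gamma>)) =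
      braid_class K (compose disk \<beta>' \<beta>)" by blast
  then show ?thesis by (simp add: braid_group_def disk_diffeos_def)
qed

lemma braid_one: "\<one>\<^bsub>braid_group K\<^esub> = braid_class K (\<lambda>z\<in>disk. z)"
  by (simp add: braid_group_def disk_diffeos_def)

lemma braid_carrier: "carrier (braid_group K) = braid_class K ` DD"
  by (simp add: braid_group_def)

lemma group_braid_group: "group (braid_group K)"
proof (rule groupI)
  show "\<one>\<^bsub>braid_group K\<^esub> \<in> carrier (braid_group K)"
    unfolding braid_one braid_carrier using DD_one by blast
  show "x \<otimes>\<^bsub>braid_group K\<^esub> y \<in> carrier (braid_group K)"
    if "x \<in> carrier (braid_group K)" "y \<in> carrier (braid_group K)" for x y
    using that DD_compose unfolding braid_carrier by (auto simp: braid_mult)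
  show "x \<otimes>\<^bsub>braid_group K\<^esub> y \<otimes>\<^bsub>braid_group K\<^esub> z = x \<otimes>\<^bsub>braid_group K\<^esub> (y \<otimes>\<^bsub>braid_group K\<^esub> z)"
    if xyz: "x \<in> carrier (braid_group K)" "y \<in> carrier (braid_group K)" "z \<in> carrier (braid_group K)" for x y z
  proof -
    obtain a b c where abc: "a \<in> DD" "b \<in> DD" "c \<in> DD" "x = braid_class K a" "y = braid_class K b" "z = braid_class K c"
      using xyz unfolding braid_carrier by blast
    have "a \<in> disk \<rightarrow> disk" using DD_D(6)[OF abc(1)] by (auto simp: bij_betw_def)
    then have "compose disk c (compose disk b a) = compose disk (compose disk c b) a"
      by (auto simp: compose_def fun_eq_iff)
    then show ?thesis using abc by (simp add: braid_mult DD_compose)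
  qed
  show "\<one>\<^bsub>braid_group K\<^esub> \<otimes>\<^bsub>braid_group K\<^esub> x = x" if x: "x \<in> carrier (braid_group K)" for x
  proof -
    obtain a where a: "a \<in> DD" "x = braid_class K a" using x unfolding braid_carrier by blast
    have "a \<in> extensional disk" using DD_D(1)[OF a(1)] by (simp add: Bij_def)
    then have "compose disk a (\<lambda>z\<in>disk. z) = a"
      by (auto simp: compose_def fun_eq_iff extensional_def)
    then show ?thesis using a by (simp add: braid_one braid_mult DD_one)
  qed
  show "\<exists>y\<in>carrier (braid_group K). y \<otimes>\<^bsub>braid_group K\<^esub> x = \<one>\<^bsub>braid_group K\<^esub>"
    if x: "x \<in> carrier (braid_group K)" for x
  proof -
    obtain a where a: "a \<in> DD" "x = braid_class K a" using x unfolding braid_carrier by blast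
    let ?i = "restrict (inv_into disk a) disk"
    have "compose disk a ?i = (\<lambda>z\<in>disk. z)"
      using DD_inverse(3)[OF a(1)] by (auto simp: compose_def fun_eq_iff)
    then have "braid_class K ?i \<otimes>\<^bsub>braid_group K\<^esub> x = \<one>\<^bsub>braid_group K\<^esub>"
      using a DD_inverse(1)[OF a(1)] by (simp add: braid_one braid_mult)
    then show ?thesis using DD_inverse(1)[OF a(1)] unfolding braid_carrier by blast
  qed
qed

lemma braid_inverse:
  assumes "\<beta> \<in> DD"
  shows "inv\<^bsub>braid_group K\<^esub> (braid_class K \<beta>) = braid_class K (restrict (inv_into disk \<beta>) disk)"
proof (rule group.inv_equality[OF group_braid_group])
  let ?i = "restrict (inv_into disk \<beta>) disk"
  note i = DD_inverse[OF assms]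
  have "compose disk \<beta> ?i = (\<lambda>z\<in>disk. z)"
    using i(3) by (auto simp: compose_def fun_eq_iff)
  then show "braid_class K ?i \<otimes>\<^bsub>braid_group K\<^esub> braid_class K \<beta> = \<one>\<^bsub>braid_group K\<^esub>"
    using i(1) assms by (simp add: braid_one braid_mult)
  show "braid_class K \<beta> \<in> carrier (braid_group K)" "braid_class K ?i \<in> carrier (braid_group K)"
    unfolding braid_carrier using assms i(1) by blast+
qed

end

text \<open>Rotation preserves the modulus, so the twist is inverted by the twist with the negated
  profile; this inverse is smooth for the same reason as the twist itself.\<close>

lemma (in half_twist) twist_in_DD:
  "restrict \<beta> disk \<in> DD" "j \<in> {1..n} \<Longrightarrow> acts (restrict \<beta> disk) j = W (\<beta> \<circ> std_loop j)"
proof -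
  let ?h' = "twist_map (\<lambda>r. - \<alpha> r)" and ?B = "restrict \<beta> disk"
  define \<gamma> where "\<gamma> z = g (?h' (f z))" for z
  have hh: "?h' (h z) = z" "h (?h' z) = z" for z
    by (simp_all add: twist_map_def norm_mult mult.assoc cis_mult)
  have l: "\<gamma> (\<beta> z) = z" and r: "\<beta> (\<gamma> z) = z" for z
    using hh by (simp_all add: \<beta>_def \<gamma>_def)
  have \<gamma>_out: "\<gamma> z = z" if "z \<notin> U" for z
    using l[of z] \<beta>_outside[OF that] by simp
  have U_disk: "U \<subseteq> disk" using U(3) closure_subset interior_subset_disk by blast
  have \<beta>D: "\<beta> z \<in> disk" if "z \<in> disk" for z
    using that \<beta>_outside[of z] \<beta>_U[of z] U_disk by (cases "z \<in> U") auto
  have \<gamma>D: "\<gamma> z \<in> disk" if "z \<in> disk" for z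
  proof (cases "z \<in> U")
    case True
    then have "\<gamma> z \<in> U" by (simp add: \<gamma>_def in_U_iff)
    then show ?thesis using U_disk by blast
  qed (use that \<gamma>_out in simp)
  have bij: "bij_betw ?B disk disk"
    by (rule bij_betw_byWitness[of _ \<gamma>]) (use l r \<beta>D \<gamma>D in auto)
  have inv: "inv_into disk ?B z = \<gamma> z" if "z \<in> disk" for z
    using bij_betw_inv_into_left[OF bij \<gamma>D[OF that]] \<gamma>D[OF that] r[of z] by simp
  have sf: "smooth_on UNIV f" "smooth_on UNIV g"
    using diffeo by (auto simp: plane_diffeo_def g_def)
  have s\<alpha>: "smooth_on {0..} \<alpha>" "\<And>r. r \<in> {0..3 / 2} \<Longrightarrow> \<alpha> r = 1"
    using profile by (auto simp: twist_profile_def)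
  have "smooth_on UNIV h" by (rule smooth_twist_map[OF s\<alpha>])
  then have "smooth_on UNIV \<beta>"
    unfolding \<beta>_def[abs_def] by (intro smooth_on_compose[OF smooth_on_compose[OF sf(1)] sf(2)]) auto
  then have "smooth_on disk \<beta>" by (rule smooth_on_subset) simp
  then have s1: "smooth_on disk ?B" by (rule smooth_on_cong) simp
  have "smooth_on UNIV (\<lambda>x::real. - x)"
    unfolding smooth_on_UNIV by (intro allI Ck_on_bounded_linear bounded_linear_minus bounded_linear_ident)
  then have "smooth_on {0..} (\<lambda>r. - \<alpha> r)"
    by (rule smooth_on_compose[OF s\<alpha>(1)]) simp
  then have "smooth_on UNIV ?h'" by (rule smooth_twist_map[of _ "- 1"]) (use s\<alpha>(2) in simp)
  then have "smooth_on UNIV \<gamma>"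
    unfolding \<gamma>_def[abs_def] by (intro smooth_on_compose[OF smooth_on_compose[OF sf(1)] sf(2)]) auto
  then have "smooth_on disk \<gamma>" by (rule smooth_on_subset) simp
  then have s2: "smooth_on disk (inv_into disk ?B)" by (rule smooth_on_cong) (simp add: inv)
  have K\<beta>: "\<beta> ` K \<subseteq> K"
  proof (rule image_subsetI)
    fix z assume z: "z \<in> K"
    show "\<beta> z \<in> K"
    proof (cases "z \<in> U")
      case True
      then have "z \<in> {k i, k (Suc i)}" using U(4) closure_subset z by blast
      then show ?thesis using \<beta>_ends i1 i2 by auto
    qed (use z \<beta>_outside in simp)
  qed
  have "inj_on \<beta> K" using l by (metis inj_on_inverseI)
  \<comment> \<open>An injective map of a finite set into itself is onto.\<close>
  then have "\<beta> ` K = K" using K\<beta> by (intro card_subset_eq) (auto simp: card_image)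
  moreover have "?B ` K = \<beta> ` K" using K_subset_disk by (intro image_cong) auto
  ultimately have KB: "?B ` K = K" by simp
  show B: "?B \<in> DD"
  proof (rule DD_I[OF _ s1 s2 KB])
    show "?B \<in> Bij disk" using bij by (simp add: Bij_def)
    fix z assume z: "z \<in> frontier disk"
    then have "cmod z = 1" by (simp add: disk_def frontier_cball)
    then have "z \<notin> interior disk" by (simp add: interior_disk)
    then have "z \<notin> U" using U(3) closure_subset by blast
    then show "?B z = z" using \<beta>_outside z frontier_subset_disk by auto
  qed
  show "acts ?B j = W (\<beta> \<circ> std_loop j)" if j: "j \<in> {1..n}"
    unfolding acts_def
  proof (rule W_cong[OF DD_path[OF B std_loop[OF j]]])
    fix t :: real assume "t \<in> {0..1}"
    then have "std_loop j t \<in> disk" using path_between_in[OF std_loop[OF j]] by blast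
    then show "(?B \<circ> std_loop j) t = (\<beta> \<circ> std_loop j) t" by simp
  qed
qed

context marked_disk
begin

lemma half_twist_diffeo_acts:
  assumes "i \<in> {1..<n}" "half_twist_diffeo K (linepath (k i) (k (Suc i))) \<beta>"
  shows "\<beta> \<in> DD" "acts \<beta> i = fg_gen (Suc i)"
    "acts \<beta> (Suc i) = fg_gen (Suc i) + fg_gen i - fg_gen (Suc i)"
    "\<And>j. j \<in> {1..n} \<Longrightarrow> j \<noteq> i \<Longrightarrow> j \<noteq> Suc i \<Longrightarrow> acts \<beta> j = fg_gen j"
proof -
  obtain U f \<alpha> where u: "open U" "closed_segment (k i) (k (Suc i)) \<subseteq> U" "closure U \<subseteq> interior disk"
      "closure U \<inter> K = {k i, k (Suc i)}" "plane_diffeo f" "orientation_preserving f"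
      "f ` closed_segment (k i) (k (Suc i)) = closed_segment (- 1) 1" "f ` U = ball 0 2" "twist_profile \<alpha>"
    and \<beta>: "\<beta> = restrict (inv_into UNIV f \<circ> twist_map \<alpha> \<circ> f) disk"
    using assms(2) unfolding half_twist_diffeo_def by auto
  interpret H: half_twist n k i U f \<alpha>
    by (intro half_twist.intro half_twist_axioms.intro marked_disk_axioms assms(1) u)
  have eq: "\<beta> = restrict H.\<beta> disk"
    unfolding \<beta> by (rule restrict_ext) (simp add: H.\<beta>_def H.g_def)
  show "\<beta> \<in> DD" unfolding eq by (rule H.twist_in_DD(1))
  show "acts \<beta> i = fg_gen (Suc i)" "acts \<beta> (Suc i) = fg_gen (Suc i) + fg_gen i - fg_gen (Suc i)"
    unfolding eq H.twist_in_DD(2)[OF H.i1] H.twist_in_DD(2)[OF H.i2] by (rule H.W_\<beta>_first_two)+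
  show "acts \<beta> j = fg_gen j" if "j \<in> {1..n}" "j \<noteq> i" "j \<noteq> Suc i" for j
    unfolding eq H.twist_in_DD(2)[OF that(1)] by (rule H.W_\<beta>_other[OF that])
qed

text \<open>The choice is legitimate by \<open>ex_half_twist_diffeo\<close>, and
  \<open>half_twist_diffeo_acts\<close> gives the same action for every possible choice.\<close>

lemma std_frame_class:
  assumes "i \<in> {1..<n}"
  obtains H where "H \<in> DD" "std_frame n k i = braid_class K H" "acts H i = fg_gen (Suc i)"
    "acts H (Suc i) = fg_gen (Suc i) + fg_gen i - fg_gen (Suc i)"
    "\<And>j. j \<in> {1..n} \<Longrightarrow> j \<noteq> i \<Longrightarrow> j \<noteq> Suc i \<Longrightarrow> acts H j = fg_gen j"
proof -
  define H where "H = (SOME \<beta>. half_twist_diffeo K (linepath (k i) (k (Suc i))) \<beta>)"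
  have "half_twist_diffeo K (linepath (k i) (k (Suc i))) H"
    unfolding H_def using ex_half_twist_diffeo[OF assms] by (rule someI_ex)
  note h = half_twist_diffeo_acts[OF assms this]
  show ?thesis
    by (rule that[OF h(1) _ h(2,3,4)]) (simp_all add: std_frame_def Defs.half_twist_def H_def)
qed

section \<open>Braid words and the algorithm\<close>

lemma fg_class_3: "fg_class [(a, True), (b, True), (a, False)] = fg_gen a + fg_gen b - fg_gen a"
  "fg_class [(b, False), (a, True), (b, True)] = - fg_gen b + fg_gen a + fg_gen b"
  unfolding fg_eval_gen[symmetric] by (simp_all add: add_diff_eq add.assoc)

text \<open>The action of one letter on the generators, spelled so that substituting the entries of
  a tuple into these words is the braid move on that tuple; see
  \<open>fg_class_process_letter\<close>.\<close>

definition letter_word :: "nat \<times> bool \<Rightarrow> nat \<Rightarrow> nat gen_word" where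
  "letter_word = (\<lambda>(i, e) j. if e
     then (if j = i then [(Suc i, True)] else if j = Suc i then [(Suc i, True), (i, True), (Suc i, False)] else [(j, True)])
     else (if j = i then [(i, False), (Suc i, True), (i, True)] else if j = Suc i then [(i, True)] else [(j, True)]))"

lemma letters_letter_word: "i \<in> {1..<n} \<Longrightarrow> j \<in> {1..n} \<Longrightarrow> fst ` set (letter_word (i, e) j) \<subseteq> {1..n}"
  by (auto simp: letter_word_def)

lemma braid_letter_class:
  assumes "i \<in> {1..<n}"
  obtains L where "L \<in> DD" "braid_letter n k (i, e) = braid_class K L"
    "\<And>j. j \<in> {1..n} \<Longrightarrow> acts L j = fg_class (letter_word (i, e) j)"
proof -
  have i1: "i \<in> {1..n}" and i2: "Suc i \<in> {1..n}" using assms by auto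
  obtain H where H: "H \<in> DD" "std_frame n k i = braid_class K H" "acts H i = fg_gen (Suc i)"
    "acts H (Suc i) = fg_gen (Suc i) + fg_gen i - fg_gen (Suc i)"
    "\<And>j. j \<in> {1..n} \<Longrightarrow> j \<noteq> i \<Longrightarrow> j \<noteq> Suc i \<Longrightarrow> acts H j = fg_gen j"
    using std_frame_class[OF assms] by blast
  have gw: "fg_gen j = fg_class [(j, True)]" for j :: nat by (simp add: fg_gen_def)
  have Hw: "acts H j = fg_class (letter_word (i, True) j)" if "j \<in> {1..n}" for j
    using H(3,4) H(5)[OF that] fg_class_3(1)[of "Suc i" i] by (auto simp: letter_word_def gw)
  show ?thesis
  proof (cases e)
    case True
    then show ?thesis using that[OF H(1)] H(2) Hw by (simp add: braid_letter_def)
  next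
    case False
    let ?V = "restrict (inv_into disk H) disk"
    note V = DD_inverse[OF H(1)]
    have "compose disk ?V H = (\<lambda>z\<in>disk. z)"
      using V(2) by (auto simp: compose_def fun_eq_iff)
    \<comment> \<open>The action of the inverse is found by solving equations: substituting it into
      the words of the positive letter must give back the generators.\<close>
    then have VH: "fg_eval (acts ?V) (letter_word (i, True) j) = fg_gen j" if j: "j \<in> {1..n}" for j
      using acts_compose[OF H(1) V(1) j Hw[OF j] letters_letter_word[OF assms j]] acts_one[OF j] by simp
    have v2: "acts ?V (Suc i) = fg_gen i"
      using VH[OF i1] by (simp add: letter_word_def)
    have "acts ?V (Suc i) + acts ?V i - acts ?V (Suc i) = fg_gen (Suc i)"
      using VH[OF i2] by (simp add: letter_word_def add_diff_eq)
    then have "fg_gen i + acts ?V i = fg_gen (Suc i) + fg_gen i"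
      unfolding v2 by (simp add: diff_eq_eq)
    then have v1: "acts ?V i = - fg_gen i + fg_gen (Suc i) + fg_gen i"
      by (metis add.assoc minus_add_cancel)
    have "acts ?V j = fg_class (letter_word (i, False) j)" if j: "j \<in> {1..n}" for j
    proof -
      consider "j = i" | "j = Suc i" | "j \<noteq> i" "j \<noteq> Suc i" by blast
      then show ?thesis
      proof cases
        case 1
        then show ?thesis using v1 fg_class_3(2)[of i "Suc i"] by (simp add: letter_word_def)
      next
        case 2
        then show ?thesis using v2 by (simp add: letter_word_def gw)
      next
        case 3
        then show ?thesis using VH[OF j] by (simp add: letter_word_def gw)
      qed
    qed
    then show ?thesis
      using that[OF V(1)] False H(1,2) braid_inverse[OF H(1)] by (simp add: braid_letter_def)
  qed
qed

abbreviation "PW w \<equiv> process_word (\<lambda>i. i :: nat) w"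

lemma process_word_Cons: "process_word g (l # w) = process_letter l (process_word g w)"
  by (simp add: process_word_def)

lemma fg_class_process_letter:
  "fg_class (process_letter (i, e) \<Gamma> j) = fg_eval (\<lambda>j. fg_class (\<Gamma> j)) (letter_word (i, e) j)"
proof -
  have "i \<noteq> Suc i" by simp
  then show ?thesis
    by (auto simp: process_letter_def letter_word_def braid_move_def braid_move_inv_def
        fg_class_append fg_class_inv_word add.assoc)
qed

lemma letters_process_word:
  assumes "set w \<subseteq> {1..<n} \<times> UNIV" "j \<in> {1..n}"
  shows "fst ` set (PW w j) \<subseteq> {1..n}"
  using assms
proof (induction w arbitrary: j)
  case Nil
  then show ?case by (simp add: process_word_def)
next
  case (Cons l w)
  obtain i e where l: "l = (i, e)" by (cases l)
  have i: "i \<in> {1..n}" "Suc i \<in> {1..n}" using Cons.prems l by auto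
  have IH: "\<And>j. j \<in> {1..n} \<Longrightarrow> fst ` set (PW w j) \<subseteq> {1..n}" using Cons by auto
  have "PW (l # w) j = free_reduce (if e then braid_move i (PW w) j else braid_move_inv i (PW w) j)"
    by (simp add: process_word_Cons l process_letter_def)
  moreover have "fst ` set (if e then braid_move i (PW w) j else braid_move_inv i (PW w) j) \<subseteq> {1..n}"
    using IH[OF i(1)] IH[OF i(2)] IH[OF Cons.prems(2)]
    by (auto simp: braid_move_def braid_move_inv_def image_Un letters_inv_word)
  ultimately show ?case using letters_free_reduce order_trans by metis
qed

text \<open>In a product the left factor is applied first, so the new letter supplies the word and
  the old braid supplies the values to be substituted. This is one braid move on the tuple computed
  for the rest of the word, which explains why the algorithm reads from the end.\<close>

lemma braid_of_word_class:
  assumes "set w \<subseteq> {1..<n} \<times> UNIV"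
  shows "\<exists>B\<in>DD. braid_of_word n k w = braid_class K B \<and> (\<forall>j\<in>{1..n}. acts B j = fg_class (PW w j))"
  using assms
proof (induction w)
  case Nil
  have "acts (\<lambda>z\<in>disk. z) j = fg_class (PW [] j)" if "j \<in> {1..n}" for j
    using acts_one[OF that] by (simp add: process_word_def fg_gen_def)
  then show ?case
    using DD_one by (intro bexI[of _ "\<lambda>z\<in>disk. z"] conjI ballI) (simp_all only: braid_of_word_def braid_one foldr.simps id_apply)
next
  case (Cons l w)
  obtain i e where l: "l = (i, e)" by (cases l)
  have i: "i \<in> {1..<n}" and w: "set w \<subseteq> {1..<n} \<times> UNIV" using Cons.prems l by auto
  obtain B where B: "B \<in> DD" "braid_of_word n k w = braid_class K B"
    "\<And>j. j \<in> {1..n} \<Longrightarrow> acts B j = fg_class (PW w j)"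
    using Cons.IH[OF w] by blast
  obtain L where L: "L \<in> DD" "braid_letter n k (i, e) = braid_class K L"
    "\<And>j. j \<in> {1..n} \<Longrightarrow> acts L j = fg_class (letter_word (i, e) j)"
    using braid_letter_class[OF i, of e] by blast
  have "braid_of_word n k (l # w) = braid_class K L \<otimes>\<^bsub>braid_group K\<^esub> braid_class K B"
    using B(2) L(2) by (simp add: braid_of_word_def l)
  also have "\<dots> = braid_class K (compose disk B L)" by (rule braid_mult[OF L(1) B(1)])
  finally have "braid_of_word n k (l # w) = braid_class K (compose disk B L)" .
  moreover have "acts (compose disk B L) j = fg_class (PW (l # w) j)" if j: "j \<in> {1..n}" for j
  proof -
    note lw = letters_letter_word[OF i j, of e]
    have "acts (compose disk B L) j = fg_eval (acts B) (letter_word (i, e) j)"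
      by (rule acts_compose[OF L(1) B(1) j L(3)[OF j] lw])
    also have "\<dots> = fg_eval (\<lambda>j. fg_class (PW w j)) (letter_word (i, e) j)"
      by (rule fg_eval_cong[OF _ lw]) (rule B(3))
    finally show ?thesis by (simp add: fg_class_process_letter process_word_Cons l)
  qed
  ultimately show ?case using DD_compose[OF L(1) B(1)] by blast
qed

lemma process_word_reduced: "free_reduce (process_word g w j) = process_word g w j"
proof (cases w)
  case Nil
  then show ?thesis by (simp add: process_word_def free_reduce_def)
next
  case (Cons l w')
  then show ?thesis by (cases l) (simp add: process_word_Cons process_letter_def)
qed

lemma inv_word_map: "inv_word (map (map_prod f (\<lambda>e. e)) w) = map (map_prod f (\<lambda>e. e)) (inv_word w)"
  by (simp add: inv_word_def rev_map case_prod_unfold)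

text \<open>Moves and inversion do not look at the labels, and reduction only compares them; so on
  distinct labels the algorithm commutes with renaming.\<close>

lemma process_word_map:
  assumes "inj_on g {1..n}" "set w \<subseteq> {1..<n} \<times> UNIV" "j \<in> {1..n}"
  shows "process_word g w j = map (map_prod g (\<lambda>e. e)) (PW w j)"
  using assms(2,3)
proof (induction w arbitrary: j)
  case Nil
  then show ?case by (simp add: process_word_def)
next
  case (Cons l w)
  let ?m = "map (map_prod g (\<lambda>e. e))"
  obtain i e where l: "l = (i, e)" by (cases l)
  have i: "i \<in> {1..n}" "Suc i \<in> {1..n}" and w: "set w \<subseteq> {1..<n} \<times> UNIV" using Cons.prems l by auto
  note IH = Cons.IH[OF w]
  let ?v = "if e then braid_move i (PW w) j else braid_move_inv i (PW w) j"
  have "process_word g (l # w) j = free_reduce (if e then braid_move i (process_word g w) j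
      else braid_move_inv i (process_word g w) j)"
    by (simp add: process_word_Cons l process_letter_def)
  also have "(if e then braid_move i (process_word g w) j else braid_move_inv i (process_word g w) j) = ?m ?v"
    using IH[OF i(1)] IH[OF i(2)] IH[OF Cons.prems(2)]
    by (auto simp: braid_move_def braid_move_inv_def inv_word_map)
  also have "free_reduce (?m ?v) = ?m (free_reduce ?v)"
  proof (rule free_reduce_map[OF assms(1)])
    show "fst ` set ?v \<subseteq> {1..n}"
      using letters_process_word[OF w i(1)] letters_process_word[OF w i(2)] letters_process_word[OF w Cons.prems(2)]
      by (auto simp: braid_move_def braid_move_inv_def image_Un letters_inv_word)
  qed
  also have "free_reduce ?v = PW (l # w) j"
    by (simp add: process_word_Cons l process_letter_def)
  finally show ?case .
qed

theorem braid_of_word_eq_iff: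
  assumes "set \<beta>\<^sub>1 \<subseteq> {1..<n} \<times> UNIV" "set \<beta>\<^sub>2 \<subseteq> {1..<n} \<times> UNIV"
  defines "g \<equiv> \<lambda>i. std_gen K (k i)"
  shows "braid_of_word n k \<beta>\<^sub>1 = braid_of_word n k \<beta>\<^sub>2 \<longleftrightarrow>
    (\<forall>i\<in>{1..n}. process_word g \<beta>\<^sub>1 i = process_word g \<beta>\<^sub>2 i)"
proof -
  have inj: "inj_on g {1..n}" unfolding g_def by (rule std_gen_inj)
  obtain B1 where B1: "B1 \<in> DD" "braid_of_word n k \<beta>\<^sub>1 = braid_class K B1"
    "\<forall>j\<in>{1..n}. acts B1 j = fg_class (PW \<beta>\<^sub>1 j)" using braid_of_word_class[OF assms(1)] by blast
  obtain B2 where B2: "B2 \<in> DD" "braid_of_word n k \<beta>\<^sub>2 = braid_class K B2"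
    "\<forall>j\<in>{1..n}. acts B2 j = fg_class (PW \<beta>\<^sub>2 j)" using braid_of_word_class[OF assms(2)] by blast
  have "process_word g \<beta>\<^sub>1 j = process_word g \<beta>\<^sub>2 j \<longleftrightarrow> PW \<beta>\<^sub>1 j = PW \<beta>\<^sub>2 j" if j: "j \<in> {1..n}" for j
  proof -
    have "inj_on (map_prod g (\<lambda>e::bool. e)) ({1..n} \<times> UNIV)"
      by (rule map_prod_inj_on[OF inj inj_on_id2])
    moreover have "set (PW \<beta>\<^sub>1 j) \<union> set (PW \<beta>\<^sub>2 j) \<subseteq> {1..n} \<times> UNIV"
      using letters_process_word[OF assms(1) j] letters_process_word[OF assms(2) j] by force
    ultimately have "inj_on (map_prod g (\<lambda>e::bool. e)) (set (PW \<beta>\<^sub>1 j) \<union> set (PW \<beta>\<^sub>2 j))"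
      by (rule inj_on_subset)
    then show ?thesis
      unfolding process_word_map[OF inj assms(1) j] process_word_map[OF inj assms(2) j]
      by (rule inj_on_map_eq_map)
  qed
  moreover have "fg_class (PW \<beta>\<^sub>1 j) = fg_class (PW \<beta>\<^sub>2 j) \<longleftrightarrow> PW \<beta>\<^sub>1 j = PW \<beta>\<^sub>2 j" for j
    by (simp add: fg_class_eq_iff process_word_reduced)
  ultimately show ?thesis
    using braid_class_eq_iff[OF B1(1) B2(1)] B1 B2 by simp
qed

end

theorem mainTheorem3:
  fixes n :: nat and k :: "nat \<Rightarrow> complex" and \<beta>\<^sub>1 \<beta>\<^sub>2 :: braid_word
    and \<Gamma>\<^sub>1 \<Gamma>\<^sub>2 :: "nat \<Rightarrow> (real \<Rightarrow> complex) set gen_word"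
  assumes "\<forall>i\<in>{1..n}. k i \<in> interior disk \<and> Im (k i) = 0"
    and "strict_mono_on {1..n} (\<lambda>i. Re (k i))"
    and "set \<beta>\<^sub>1 \<subseteq> {1..<n} \<times> UNIV"
    and "set \<beta>\<^sub>2 \<subseteq> {1..<n} \<times> UNIV"
    and "\<Gamma>\<^sub>1 = process_word (\<lambda>i. std_gen (k ` {1..n}) (k i)) \<beta>\<^sub>1"
    and "\<Gamma>\<^sub>2 = process_word (\<lambda>i. std_gen (k ` {1..n}) (k i)) \<beta>\<^sub>2"
  shows "braid_of_word n k \<beta>\<^sub>1 = braid_of_word n k \<beta>\<^sub>2 \<longleftrightarrow> (\<forall>i\<in>{1..n}. \<Gamma>\<^sub>1 i = \<Gamma>\<^sub>2 i)"
proof -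
  interpret marked_disk n k
    using assms(1,2) by unfold_locales
  show ?thesis
    unfolding assms(5,6) by (rule braid_of_word_eq_iff[OF assms(3,4)])
qed

end
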